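(* Assume the Riemann Hypothesis. Then there exists a positive constant $C_0$ such that \[ M_{\tau}(x)\ll x^{1/2} \] holds for any $\tau=\tau(x)\ge \frac{C_0\log\log x}{\log\log\log\log x}$.
   Context: $\mu(n)$ is the Möbius function; for $\tau\ge0$, $x>0$, $M_\tau(x) := \frac{1}{\Gamma(\tau+1)}\sum_{n\le x}\mu(n)(1-\frac{n}{x})^{\tau}$, evaluated at $\tau=\tau(x)$ when $\tau$ depends on $x$. $f\ll g$ means $|f|\le cg$ for some constant $c$ independent of $x$ (for $x$ sufficiently large). *)

theory Defs
  imports
    "HOL-Complex_Analysis.Complex_Analysis"
    "HOL-Computational_Algebra.Squarefree"
    "HOL-Library.Landau_Symbols"
begin

definition moebius_mu :: "nat \<Rightarrow> int" where
  "moebius_mu n = (if squarefree n then (- 1) ^ card (prime_factors n) else 0)"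

text \<open>
  For \<open>\<tau> = 0\<close> every weight is 1, so that \<open>M\<^sub>0(x)\<close> is the Mertens function. This
  needs a case distinction because \<open>0 powr 0 = 0\<close>, which would drop the term \<open>n = x\<close>.
\<close>
definition riesz_weight :: "real \<Rightarrow> real \<Rightarrow> real" where
  "riesz_weight \<tau> u = (if \<tau> = 0 then 1 else (1 - u) powr \<tau>)"

definition riesz_M :: "real \<Rightarrow> real \<Rightarrow> real" where
  "riesz_M \<tau> x =
     (1 / Gamma (\<tau> + 1)) *
     (\<Sum>n | 1 \<le> n \<and> real n \<le> x. of_int (moebius_mu n) * riesz_weight \<tau> (real n / x))"

definition is_zeta :: "(complex \<Rightarrow> complex) \<Rightarrow> bool" where
  "is_zeta f \<longleftrightarrow> f holomorphic_on (- {1}) \<and>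
     (\<forall>s. Re s > 1 \<longrightarrow> (\<lambda>n. 1 / of_nat (Suc n) powr s) sums f s)"

text \<open>
  The value at the pole \<open>s = 1\<close> is unspecified. That the continuation exists and is unique
  away from the pole is shown in \<open>is_zeta_zeta\<close> and \<open>is_zeta_unique\<close> below.
\<close>
definition zeta :: "complex \<Rightarrow> complex" where
  "zeta = (SOME f. is_zeta f)"

definition riemann_hypothesis :: bool where
  "riemann_hypothesis \<longleftrightarrow>
     (\<forall>s. 0 < Re s \<and> Re s < 1 \<and> zeta s = 0 \<longrightarrow> Re s = 1 / 2)"

lemma is_zeta_unique:
  assumes "is_zeta f" "is_zeta g" "s \<noteq> 1"
  shows "f s = g s"
proof (rule analytic_continuation_open[of "{s. Re s > 1}" "- {1}" f g])
  show "open {s. Re s > 1}" by (simp add: open_halfspace_Re_gt)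
  show "{s. Re s > 1} \<noteq> {}" by (auto intro: exI[of _ 2])
  show "connected (- {1 :: complex})"
    by (rule connected_punctured_universe) simp
  show "f z = g z" if "z \<in> {s. Re s > 1}" for z
    using assms that by (auto simp: is_zeta_def intro: sums_unique2)
qed (use assms in \<open>auto simp: is_zeta_def\<close>)

text \<open>
  Existence: Taylor expansion of \<open>(x + 1) powr (1 - s)\<close> at \<open>x = 1, 2, \<dots>\<close> and summation over
  \<open>x\<close> expresses \<open>(s - 1) \<zeta>(s)\<close> through its values at \<open>s + 1, s + 2, \<dots>\<close>, up to a remainder
  that is holomorphic in a half-plane reaching further to the left.
\<close>
definition ffact :: "nat \<Rightarrow> complex \<Rightarrow> complex" where
  "ffact i a = (\<Prod>k<i. a - of_nat k)"

definition taylor_rem :: "nat \<Rightarrow> complex \<Rightarrow> nat \<Rightarrow> complex" where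
  "taylor_rem m s n = of_nat (Suc (Suc n)) powr (1 - s) -
     (\<Sum>i\<le>m. ffact i (1 - s) * of_nat (Suc n) powr (1 - s - of_nat i) / fact i)"

lemma ffact_Suc: "ffact (Suc i) a = ffact i a * (a - of_nat i)"
  by (simp add: ffact_def)

lemma ffact_holo [holomorphic_intros]:
  "f holomorphic_on A \<Longrightarrow> (\<lambda>s. ffact i (f s)) holomorphic_on A"
  unfolding ffact_def by (intro holomorphic_intros)

lemma taylor_rem_bound:
  assumes "Re s > - real m"
  shows "norm (taylor_rem m s n) \<le>
           norm (ffact (Suc m) (1 - s)) * real (Suc n) powr (- Re s - real m)"
proof -
  define x :: complex where "x = of_nat (Suc n)"
  define S where "S = closed_segment x (x + 1)"
  define f where "f = (\<lambda>i z. ffact i (1 - s) * z powr (1 - s - of_nat i))"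
  define B where "B = norm (ffact (Suc m) (1 - s)) * real (Suc n) powr (- Re s - real m)"
  have S: "z \<in> \<real> \<and> Re z \<ge> real (Suc n)" if zS: "z \<in> S" for z
  proof -
    obtain u where u: "0 \<le> u" "u \<le> 1" "z = (1 - u) *\<^sub>R x + u *\<^sub>R (x + 1)"
      using zS unfolding S_def closed_segment_def by auto
    have "z = of_real (real (Suc n) + u)"
      using u(3) by (simp add: x_def scaleR_conv_of_real algebra_simps)
    thus ?thesis using u(1) by simp
  qed
  have "norm (f 0 (x + 1) - (\<Sum>i\<le>m. f i x * (x + 1 - x) ^ i / fact i))
          \<le> B * norm (x + 1 - x) ^ Suc m / fact m"
  proof (rule complex_Taylor)
    show "convex S" by (simp add: S_def)
    show "x \<in> S" "x + 1 \<in> S" by (auto simp: S_def)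
    show "(f i has_field_derivative f (Suc i) z) (at z within S)" if "z \<in> S" for i z
    proof -
      have "z \<notin> \<real>\<^sub>\<le>\<^sub>0" using S[OF that] by (auto simp: complex_nonpos_Reals_iff)
      hence "((\<lambda>z. z powr (1 - s - of_nat i)) has_field_derivative
               ((1 - s - of_nat i) * z powr (1 - s - of_nat i - 1))) (at z within S)"
        by (rule has_field_derivative_at_within[OF has_field_derivative_powr])
      from DERIV_cmult[OF this, of "ffact i (1 - s)"] show ?thesis
        unfolding f_def ffact_Suc by (simp add: diff_diff_eq add.commute mult.assoc)
    qed
    show "norm (f (Suc m) z) \<le> B" if "z \<in> S" for z
    proof -
      have "norm (z powr (1 - s - of_nat (Suc m))) = Re z powr (- Re s - real m)"
        using S[OF that] by (subst norm_powr_real_powr) auto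
      also have "\<dots> \<le> real (Suc n) powr (- Re s - real m)"
        using S[OF that] assms by (intro powr_mono2') auto
      finally show ?thesis
        unfolding f_def B_def norm_mult by (intro mult_left_mono) auto
    qed
  qed
  also have "B * norm (x + 1 - x) ^ Suc m / fact m \<le> B / 1"
    by (simp, rule divide_left_mono[of 1 "fact m" B, simplified]) (auto simp: B_def)
  finally show ?thesis
    by (simp add: f_def taylor_rem_def B_def x_def ffact_def add_ac)
qed

lemma taylor_rem_uniform:
  assumes "Re z > 1 - real m"
  shows "\<exists>d>0. cball z d \<subseteq> {s. Re s > 1 - real m} \<and>
           uniform_limit (cball z d) (\<lambda>N s. \<Sum>n<N. taylor_rem m s n)
             (\<lambda>s. \<Sum>n. taylor_rem m s n) sequentially"
proof -
  define d where "d = (Re z - (1 - real m)) / 2"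
  have d: "d > 0" using assms by (simp add: d_def)
  have Re_s: "Re s \<ge> 1 - real m + d" if "s \<in> cball z d" for s
  proof -
    have "\<bar>Re (z - s)\<bar> \<le> d"
      using that abs_Re_le_cmod[of "z - s"] by (simp add: dist_norm)
    hence "Re z - Re s \<le> d" by simp
    thus ?thesis unfolding d_def by argo
  qed
  have "continuous_on (cball z d) (\<lambda>s. ffact (Suc m) (1 - s))"
    by (intro holomorphic_on_imp_continuous_on holomorphic_intros)
  hence "bounded ((\<lambda>s. ffact (Suc m) (1 - s)) ` cball z d)"
    by (intro compact_imp_bounded compact_continuous_image) auto
  then obtain C where C: "\<And>s. s \<in> cball z d \<Longrightarrow> norm (ffact (Suc m) (1 - s)) \<le> C"
    unfolding bounded_iff by blast
  have "summable (\<lambda>n. real n powr (- 1 - d))"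
    using d by (subst summable_real_powr_iff) auto
  hence sm: "summable (\<lambda>n. C * real (Suc n) powr (- 1 - d))"
    by (intro summable_mult) (subst summable_Suc_iff)
  have "uniform_limit (cball z d) (\<lambda>N s. \<Sum>n<N. taylor_rem m s n)
          (\<lambda>s. \<Sum>n. taylor_rem m s n) sequentially"
  proof (rule Weierstrass_m_test[OF _ sm])
    fix n s assume s: "s \<in> cball z d"
    have "norm (taylor_rem m s n) \<le>
            norm (ffact (Suc m) (1 - s)) * real (Suc n) powr (- Re s - real m)"
      using Re_s[OF s] d by (intro taylor_rem_bound) auto
    also have "\<dots> \<le> C * real (Suc n) powr (- 1 - d)"
    proof (intro mult_mono C s powr_mono)
      show "0 \<le> C" using C[OF s] norm_ge_zero order_trans by blast
    qed (use Re_s[OF s] in auto)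
    finally show "norm (taylor_rem m s n) \<le> C * real (Suc n) powr (- 1 - d)" .
  qed
  moreover have "cball z d \<subseteq> {s. Re s > 1 - real m}"
    using Re_s d by force
  ultimately show ?thesis using d by blast
qed

lemma taylor_rem_holo:
  "(\<lambda>s. \<Sum>n. taylor_rem m s n) holomorphic_on {s. Re s > 1 - real m}"
proof (rule holomorphic_uniform_sequence)
  show "open {s. Re s > 1 - real m}" by (simp add: open_halfspace_Re_gt)
  show "(\<lambda>s. \<Sum>n<N. taylor_rem m s n) holomorphic_on {s. Re s > 1 - real m}" for N
    unfolding taylor_rem_def by (intro holomorphic_intros) auto
qed (use taylor_rem_uniform in auto)

definition dirichlet_sum :: "complex \<Rightarrow> complex" where
  "dirichlet_sum s = (\<Sum>n. of_nat (Suc n) powr (- s))"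

lemma dirichlet_sum_sums:
  assumes "Re s > 1"
  shows "(\<lambda>n. of_nat (Suc n) powr (- s)) sums dirichlet_sum s"
proof -
  have "summable (\<lambda>n. real n powr (- Re s))"
    using assms by (subst summable_real_powr_iff) auto
  hence "summable (\<lambda>n. real (Suc n) powr (- Re s))"
    by (subst summable_Suc_iff)
  moreover have "norm (of_nat (Suc n) powr (- s) :: complex) = real (Suc n) powr (- Re s)" for n
    by (subst norm_powr_real_powr) auto
  ultimately have "summable (\<lambda>n. norm (of_nat (Suc n) powr (- s) :: complex))"
    by simp
  hence "summable (\<lambda>n. of_nat (Suc n) powr (- s) :: complex)"
    by (rule summable_norm_cancel)
  thus ?thesis by (simp add: dirichlet_sum_def summable_sums)
qed

lemma dirichlet_sum_rec:
  assumes "Re s > 1"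
  shows "(\<Sum>n. taylor_rem m s n) =
           - 1 + (\<Sum>j<m. ffact j (1 - s) / fact (Suc j) * ((s + of_nat j - 1) * dirichlet_sum (s + of_nat j)))"
proof -
  define g :: "nat \<Rightarrow> complex" where "g = (\<lambda>n. of_nat (Suc n) powr (1 - s))"
  have g0: "g \<longlonglongrightarrow> 0"
    unfolding g_def using assms
    by (intro tendsto_neg_powr_complex_of_nat filterlim_Suc) auto
  have tel: "(\<lambda>n. g (Suc n) - g n) sums (0 - g 0)"
    by (rule telescope_sums[OF g0])
  have eq: "taylor_rem m s n = (g (Suc n) - g n) +
      (\<Sum>j<m. ffact j (1 - s) / fact (Suc j) * ((s + of_nat j - 1) *
         of_nat (Suc n) powr (- (s + of_nat j))))" for n
  proof -
    have "(\<Sum>i\<le>m. ffact i (1 - s) * of_nat (Suc n) powr (1 - s - of_nat i) / fact i) =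
          g n + (\<Sum>j<m. ffact (Suc j) (1 - s) * of_nat (Suc n) powr (1 - s - of_nat (Suc j)) / fact (Suc j))"
      by (subst sum.atMost_shift) (simp add: g_def ffact_def)
    also have "(\<Sum>j<m. ffact (Suc j) (1 - s) * of_nat (Suc n) powr (1 - s - of_nat (Suc j)) / fact (Suc j)) =
          (\<Sum>j<m. - (ffact j (1 - s) / fact (Suc j) * ((s + of_nat j - 1) *
             of_nat (Suc n) powr (- (s + of_nat j)))))"
    proof (rule sum.cong)
      fix j
      have e: "1 - s - of_nat (Suc j) = - (s + of_nat j)" by simp
      show "ffact (Suc j) (1 - s) * of_nat (Suc n) powr (1 - s - of_nat (Suc j)) / fact (Suc j) =
          - (ffact j (1 - s) / fact (Suc j) * ((s + of_nat j - 1) *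
             of_nat (Suc n) powr (- (s + of_nat j))))"
        unfolding e ffact_Suc by (simp add: field_simps del: fact_Suc of_nat_Suc)
    qed simp
    finally show ?thesis
      by (simp add: taylor_rem_def g_def sum_negf)
  qed
  have "(\<lambda>n. taylor_rem m s n) sums ((0 - g 0) +
      (\<Sum>j<m. ffact j (1 - s) / fact (Suc j) * ((s + of_nat j - 1) * dirichlet_sum (s + of_nat j))))"
    unfolding eq using assms
    by (intro sums_add tel sums_sum sums_mult dirichlet_sum_sums) auto
  thus ?thesis by (simp add: sums_iff g_def)
qed

lemma dirichlet_sum_extend:
  "\<exists>F. F holomorphic_on {s. Re s > 1 - real (Suc m)} \<and> (\<forall>s. Re s > 1 \<longrightarrow> F s = (s - 1) * dirichlet_sum s)"
proof (induction m)
  case 0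
  have "(\<lambda>s. 1 + (\<Sum>n. taylor_rem 1 s n)) holomorphic_on {s. Re s > 1 - real (Suc 0)}"
    using taylor_rem_holo[of 1] by (intro holomorphic_intros) auto
  moreover have "1 + (\<Sum>n. taylor_rem 1 s n) = (s - 1) * dirichlet_sum s" if "Re s > 1" for s
    using dirichlet_sum_rec[OF that, of 1] by (simp add: ffact_def)
  ultimately show ?case by (intro exI[of _ "\<lambda>s. 1 + (\<Sum>n. taylor_rem 1 s n)"]) blast
next
  case (Suc m)
  then obtain G where G: "G holomorphic_on {s. Re s > 1 - real (Suc m)}"
    "\<And>s. Re s > 1 \<Longrightarrow> G s = (s - 1) * dirichlet_sum s" by blast
  define H where "H = {s. Re s > 1 - real (Suc (Suc m))}"
  define F where "F = (\<lambda>s. 1 + (\<Sum>n. taylor_rem (Suc (Suc m)) s n) -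
    (\<Sum>j<Suc m. ffact (Suc j) (1 - s) / fact (Suc (Suc j)) * G (s + of_nat (Suc j))))"
  have Gs: "(\<lambda>s. G (s + of_nat (Suc j))) holomorphic_on H" for j
  proof -
    have "(G \<circ> (\<lambda>s. s + of_nat (Suc j))) holomorphic_on H"
      by (intro holomorphic_on_compose_gen[OF _ G(1)] holomorphic_intros) (auto simp: H_def)
    thus ?thesis by (simp add: o_def)
  qed
  have "F holomorphic_on H"
    unfolding F_def using taylor_rem_holo[of "Suc (Suc m)"]
    by (intro holomorphic_intros Gs) (auto simp: H_def)
  moreover have "F s = (s - 1) * dirichlet_sum s" if s: "Re s > 1" for s
  proof -
    have "(\<Sum>n. taylor_rem (Suc (Suc m)) s n) = - 1 + ((s - 1) * dirichlet_sum s +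
      (\<Sum>j<Suc m. ffact (Suc j) (1 - s) / fact (Suc (Suc j)) *
         ((s + of_nat (Suc j) - 1) * dirichlet_sum (s + of_nat (Suc j)))))"
      unfolding dirichlet_sum_rec[OF s] by (subst sum.lessThan_Suc_shift) (simp add: ffact_def)
    also have "(\<Sum>j<Suc m. ffact (Suc j) (1 - s) / fact (Suc (Suc j)) *
         ((s + of_nat (Suc j) - 1) * dirichlet_sum (s + of_nat (Suc j)))) =
       (\<Sum>j<Suc m. ffact (Suc j) (1 - s) / fact (Suc (Suc j)) * G (s + of_nat (Suc j)))"
      using s by (intro sum.cong refl) (subst G(2), auto)
    finally show ?thesis by (simp add: F_def)
  qed
  ultimately show ?case unfolding H_def by blast
qed

lemma ex_is_zeta: "\<exists>f. is_zeta f"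
proof -
  define H where "H = (\<lambda>m. {s. Re s > 1 - real (Suc m)})"
  obtain F where F: "\<And>m. F m holomorphic_on H m"
    "\<And>m s. Re s > 1 \<Longrightarrow> F m s = (s - 1) * dirichlet_sum s"
    using dirichlet_sum_extend unfolding H_def by metis
  have H_open: "open (H m)" for m
    by (simp add: H_def open_halfspace_Re_gt)
  have H_mono: "H m \<subseteq> H n" if "m \<le> n" for m n
    using that by (auto simp: H_def)
  have agree_le: "F m s = F n s" if "m \<le> n" "s \<in> H m" for m n s
  proof (rule analytic_continuation_open[of "{s. Re s > 1}" "H m" "F m" "F n"])
    show "open {s. Re s > 1}" by (simp add: open_halfspace_Re_gt)
    show "{s. Re s > 1} \<noteq> {}" by (auto intro: exI[of _ 2])
    show "connected (H m)"
      unfolding H_def by (intro convex_connected convex_halfspace_Re_gt)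
    show "F n holomorphic_on H m"
      using F(1) H_mono[OF that(1)] holomorphic_on_subset by blast
  qed (use F H_open that in \<open>auto simp: H_def\<close>)
  have agree: "F m s = F n s" if "s \<in> H m" "s \<in> H n" for m n s
  proof (cases "m \<le> n")
    case True
    thus ?thesis using that(1) by (rule agree_le)
  next
    case False
    thus ?thesis using that(2) by (intro agree_le[symmetric]) auto
  qed
  define idx where "idx = (\<lambda>s. nat \<lceil>1 + \<bar>Re s\<bar>\<rceil>)"
  have idx: "s \<in> H (idx s)" for s
  proof -
    have "real (idx s) \<ge> 1 + \<bar>Re s\<bar>" unfolding idx_def by linarith
    thus ?thesis by (auto simp: H_def)
  qed
  define E where "E = (\<lambda>s. F (idx s) s)"
  have E_holo: "E holomorphic_on UNIV"
  proof -
    have "E holomorphic_on H m" for m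
      using F(1)[of m] by (rule holomorphic_transform) (auto simp: E_def intro: agree idx)
    hence "E holomorphic_on (\<Union>m. H m)"
      by (intro holomorphic_on_UN_open H_open)
    moreover have "(\<Union>m. H m) = UNIV" using idx by auto
    ultimately show ?thesis by simp
  qed
  have "(\<lambda>s. E s / (s - 1)) holomorphic_on - {1}"
    by (intro holomorphic_intros holomorphic_on_subset[OF E_holo]) auto
  moreover have "(\<lambda>n. 1 / of_nat (Suc n) powr s) sums (E s / (s - 1))" if s: "Re s > 1" for s
  proof -
    have "s \<noteq> 1" using s by auto
    hence "E s / (s - 1) = dirichlet_sum s" using F(2)[OF s] by (simp add: E_def)
    thus ?thesis using dirichlet_sum_sums[OF s] by (simp add: powr_minus divide_inverse)
  qed
  ultimately show ?thesis
    unfolding is_zeta_def by (intro exI[of _ "\<lambda>s. E s / (s - 1)"]) blast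
qed

lemma is_zeta_zeta: "is_zeta zeta"
  unfolding zeta_def using ex_is_zeta by (rule someI_ex)

end

theory Submission
  imports Defs "HOL-Number_Theory.Prime_Powers" "HOL-Real_Asymp.Real_Asymp"
begin

text \<open>
  For an integer \<open>k\<close>, Perron's formula expresses \<open>M\<^sub>k(x)\<close> as the integral of
  \<open>x\<^sup>s / (\<zeta>(s) s (s + 1) \<dots> (s + k))\<close>, which can be taken over the line \<open>Re s = 1/2 + 1 / log x\<close>. It remains to
  see that \<open>1 / \<zeta>\<close> is controlled by the product \<open>s (s + 1) \<dots> (s + k)\<close> there. The main point is the bound
  \<open>|1 / \<zeta>(1/2 + a + i t)| \<le> exp (C log T / log log T \<cdot> log (5 / a))\<close> with \<open>T = |t| + T\<^sub>0\<close>. With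
  \<open>1 / a \<le> log x\<close> the exponent is about \<open>log log x \<cdot> log T / log log T\<close>. For \<open>|t| > log log x\<close> this is absorbed by
  \<open>|t|\<^sup>k\<close> and for \<open>|t| \<le> log log x\<close> by \<open>k!\<close>, exactly when \<open>k\<close> is a large multiple of
  \<open>log log x / log log log log x\<close>.

  For the bound of \<open>1 / \<zeta>\<close>, let \<open>h(s) = (s - 1) \<zeta>(s)\<close> and \<open>g = h' / h\<close>. Comparing \<open>h\<close> with its reflection
  in a vertical line to the right of all zeros gives \<open>Re g \<ge> - K\<close> with \<open>K = O(log T)\<close>. Hence
  \<open>g / (g + 2 K)\<close> is bounded by \<open>1\<close>; it is \<open>O(1 / K)\<close> on \<open>Re s = 5/4\<close>, and by a three lines argument it is at
  most \<open>exp (- a log log T / 4)\<close> at distance \<open>a\<close> from the critical line. Solving for \<open>g\<close> and integrating in \<open>a\<close>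
  gives the bound.

  Real orders are reduced to integer orders, because \<open>x\<^sup>\<tau> M\<^sub>\<tau>(x)\<close> with \<open>\<tau> = k + \<alpha>\<close> is a fractional integral of
  \<open>u\<^sup>k M\<^sub>k(u)\<close>.
\<close>

subsection \<open>Bounds for zero-free holomorphic functions\<close>

text \<open>The obstacle is uniformity up to the critical line. Borel-Caratheodory on a disc
  touching a vertical line bounds ln |h| from below only with a loss 1/d at distance d from that
  line. The reflection tolerates exactly a loss 1/d on an arc and returns Re g >= - K with K
  independent of a. The rate log log T is, up to constants, the logarithm of the ratio of the bounds
  1 and O(1/K) on the vertical edges. Solving for g gives 2 K q / (1 - q) with q = exp (- a log log
  T / 4), which has a simple pole at a = 0; its primitive has size (K / log log T) log (1 / a), the
  origin of both the denominator log log T and the factor log (5 / a). Put L = log log x. For t just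
  above L, t^k absorbs exp (c L log t / log log t) once k is a multiple of L / log log L, hence the
  fourfold logarithm; for smaller t, k! does the same because log k and log L are comparable. The
  fractional integral needs M_k(u) for all u <= x with one k, so the line of integration depends on
  x but not on u.\<close>

text \<open>Meant for functions without continuous boundary values: \<open>F\<close> in
  \<open>reflected_quotient_bound\<close> involves the exponential of a function with poles at two
  frontier points. If the bound failed, the open set where the norm exceeds B + e would have its
  closure inside S, and the usual maximum principle on that set gives a contradiction.\<close>

lemma norm_le_of_limsup_frontier:
  fixes f :: "complex \<Rightarrow> complex"
  assumes S: "open S" "bounded S" and f: "f holomorphic_on S"
    and le: "\<And>\<xi> e. \<xi> \<in> frontier S \<Longrightarrow> e > 0 \<Longrightarrow> \<exists>d>0. \<forall>z\<in>S \<inter> ball \<xi> d. norm (f z) \<le> B + e"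
    and z: "z \<in> S"
  shows "norm (f z) \<le> B"
proof (rule ccontr)
  assume "\<not> norm (f z) \<le> B"
  define e where "e = (norm (f z) - B) / 2"
  have e: "e > 0" and fz: "norm (f z) > B + e"
    using \<open>\<not> norm (f z) \<le> B\<close> by (auto simp: e_def field_simps)
  have cont: "continuous_on S f" by (rule holomorphic_on_imp_continuous_on[OF f])
  define V where "V = S \<inter> (\<lambda>w. norm (f w)) -` {B + e<..}"
  have V: "open V" unfolding V_def
    by (intro continuous_open_preimage S(1) continuous_intros cont)
  have clV: "closure V \<subseteq> S"
  proof
    fix \<xi> assume \<xi>: "\<xi> \<in> closure V"
    show "\<xi> \<in> S"
    proof (rule ccontr)
      assume "\<xi> \<notin> S"
      moreover have "\<xi> \<in> closure S" using \<xi> closure_mono[of V S] by (auto simp: V_def)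
      ultimately have "\<xi> \<in> frontier S" using S(1) by (simp add: frontier_def interior_open)
      from le[OF this e] obtain d where d: "d > 0" "\<forall>z\<in>S \<inter> ball \<xi> d. norm (f z) \<le> B + e"
        by blast
      moreover obtain w where "w \<in> V" "dist w \<xi> < d"
        using \<xi> d(1) closure_approachable by blast
      ultimately show False by (force simp: V_def dist_commute)
    qed
  qed
  have "norm (f z) \<le> B + e"
  proof (rule maximum_modulus_frontier[of f V])
    show "f holomorphic_on interior V"
      unfolding interior_open[OF V] using f by (rule holomorphic_on_subset) (auto simp: V_def)
    show "continuous_on (closure V) f" using cont clV continuous_on_subset by blast
    show "bounded V" using S(2) bounded_subset[of S V] by (auto simp: V_def)
    show "z \<in> V" using z fz by (simp add: V_def)
    fix w assume "w \<in> frontier V"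
    hence "w \<in> S" "w \<notin> V" using clV V by (auto simp: frontier_def interior_open)
    thus "norm (f w) \<le> B + e" by (auto simp: V_def)
  qed
  thus False using fz by simp
qed

text \<open>A zero-free function on a disc has a logarithm L there, and G = L - L(z0) has real part
  below A. Then G / (2 A - G) maps the unit disc to itself and fixes 0, so the Schwarz lemma
  applies; solving for G bounds its norm and hence - Re G.\<close>

lemma borel_caratheodory_zero_free:
  fixes f :: "complex \<Rightarrow> complex"
  assumes holo: "f holomorphic_on ball z0 1" and nz: "\<And>w. w \<in> ball z0 1 \<Longrightarrow> f w \<noteq> 0"
    and M: "\<And>w. w \<in> ball z0 1 \<Longrightarrow> norm (f w) < M"
    and \<rho>: "\<rho> < 1" and z: "norm (z - z0) \<le> \<rho>"
  shows "ln (norm (f z)) \<ge> ln (norm (f z0)) - 2 * \<rho> / (1 - \<rho>) * (ln M - ln (norm (f z0)))"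
proof -
  have \<rho>0: "\<rho> \<ge> 0" using z norm_ge_zero order_trans by blast
  obtain L where L: "L holomorphic_on ball z0 1" "\<And>w. w \<in> ball z0 1 \<Longrightarrow> exp (L w) = f w"
    using holomorphic_logarithm_exists[of "ball z0 1" f z0] holo nz by auto
  have ReL: "Re (L w) = ln (norm (f w))" if "w \<in> ball z0 1" for w
  proof -
    have "norm (f w) = exp (Re (L w))" using L(2)[OF that] by (metis norm_exp_eq_Re)
    thus ?thesis by simp
  qed
  define A where "A = ln M - ln (norm (f z0))"
  have z0: "z0 \<in> ball z0 1" by simp
  have "0 < norm (f z0)" using nz[OF z0] by simp
  hence A: "A > 0" using M[OF z0] unfolding A_def by (smt (verit) ln_less_cancel_iff)
  define G where "G = (\<lambda>w. L (z0 + w) - L z0)"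
  have Gh: "G holomorphic_on ball 0 1"
  proof -
    have "(L \<circ> (\<lambda>w. z0 + w)) holomorphic_on ball 0 1"
      by (intro holomorphic_on_compose_gen[OF _ L(1)] holomorphic_intros) (auto simp: dist_norm)
    thus ?thesis unfolding G_def o_def by (intro holomorphic_intros)
  qed
  have ReG: "Re (G w) < A" if "norm w < 1" for w
  proof -
    have b: "z0 + w \<in> ball z0 1" using that by (simp add: dist_norm)
    have "ln (norm (f (z0 + w))) < ln M"
      using M[OF b] nz[OF b] by (smt (verit) ln_less_cancel_iff zero_less_norm_iff)
    thus ?thesis by (simp add: G_def A_def ReL[OF b] ReL[OF z0])
  qed
  have ne: "2 * of_real A - G w \<noteq> 0" if "norm w < 1" for w
    using ReG[OF that] A by (auto simp: complex_eq_iff)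
  define \<phi> where "\<phi> = (\<lambda>w. G w / (2 * of_real A - G w))"
  have "norm (\<phi> w) \<le> norm w" if w: "norm w < 1" for w
  proof (rule Schwarz_Lemma(1)[OF _ _ _ w])
    show "\<phi> holomorphic_on ball 0 1"
      unfolding \<phi>_def using ne by (intro holomorphic_intros Gh) auto
    show "\<phi> 0 = 0" by (simp add: \<phi>_def G_def)
    fix v :: complex assume v: "norm v < 1"
    \<comment> \<open>Being closer to 0 than to 2 A is the same as having real part below A.\<close>
    have "(Re (G v))\<^sup>2 < (2 * A - Re (G v))\<^sup>2"
      using mult_strict_left_mono[OF ReG[OF v], of "4 * A"] A
      by (simp add: power2_eq_square algebra_simps)
    hence "(norm (G v))\<^sup>2 < (norm (2 * of_real A - G v))\<^sup>2"
      by (simp add: cmod_power2)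
    hence "norm (G v) < norm (2 * of_real A - G v)"
      by (rule power_less_imp_less_base) simp
    thus "norm (\<phi> v) < 1" using ne[OF v] by (simp add: \<phi>_def norm_divide)
  qed
  hence \<phi>z: "norm (\<phi> (z - z0)) \<le> \<rho>" using z \<rho> by (meson le_less_trans order_trans)
  have w1: "norm (z - z0) < 1" using z \<rho> by simp
  have "G (z - z0) = \<phi> (z - z0) * (2 * of_real A - G (z - z0))"
    using ne[OF w1] by (simp add: \<phi>_def)
  hence "norm (G (z - z0)) = norm (\<phi> (z - z0)) * norm (2 * of_real A - G (z - z0))"
    by (metis norm_mult)
  also have "\<dots> \<le> \<rho> * (2 * A + norm (G (z - z0)))"
    using A norm_triangle_ineq4[of "2 * of_real A" "G (z - z0)"]
    by (intro mult_mono \<phi>z \<rho>0) (auto simp: norm_mult)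
  finally have "norm (G (z - z0)) * (1 - \<rho>) \<le> 2 * \<rho> * A" by (simp add: algebra_simps)
  hence "norm (G (z - z0)) \<le> 2 * \<rho> / (1 - \<rho>) * A" using \<rho> by (simp add: field_simps)
  moreover have "- Re (G (z - z0)) \<le> norm (G (z - z0))"
    using abs_Re_le_cmod[of "G (z - z0)"] by linarith
  moreover have zb: "z \<in> ball z0 1" using w1 by (simp add: dist_norm norm_minus_commute)
  moreover have "Re (G (z - z0)) = ln (norm (f z)) - ln (norm (f z0))"
    by (simp add: G_def ReL[OF zb] ReL[OF z0])
  ultimately show ?thesis by (simp add: A_def)
qed

text \<open>Near the point, ln |h| equals a constant plus Re (Ln (h / h a)). The quotient is close
  to 1, so the principal branch is harmless. The parameter u allows both horizontal
  directions.\<close>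

lemma has_real_derivative_ln_norm:
  fixes h :: "complex \<Rightarrow> complex" and x u :: real
  assumes h: "(h has_field_derivative D) (at (w + of_real (u * x)))" and nz: "h (w + of_real (u * x)) \<noteq> 0"
  shows "((\<lambda>x. ln (norm (h (w + of_real (u * x))))) has_real_derivative u * Re (D / h (w + of_real (u * x)))) (at x)"
proof -
  define a where "a = w + of_real (u * x)"
  define q where "q = (\<lambda>z. Ln (h (w + of_real u * z) / h a))"
  have a': "w + of_real u * of_real x = a" by (simp add: a_def)
  have h': "(h has_field_derivative D) (at (w + of_real u * of_real x))"
    using h by simp
  have "((\<lambda>z. w + of_real u * z) has_field_derivative of_real u) (at (of_real x))"
    by (auto intro!: derivative_eq_intros)
  from DERIV_chain2[OF h' this]
  have "((\<lambda>z. h (w + of_real u * z)) has_field_derivative D * of_real u) (at (of_real x))" .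
  hence "((\<lambda>z. h (w + of_real u * z) / h a) has_field_derivative D * of_real u / h a) (at (of_real x))"
    by (rule DERIV_cdivide)
  moreover have "(Ln has_field_derivative 1) (at (h (w + of_real u * of_real x) / h a))"
    using nz has_field_derivative_Ln[of 1] by (simp add: a_def)
  ultimately have "(q has_field_derivative 1 * (D * of_real u / h a)) (at (of_real x))"
    unfolding q_def by (intro DERIV_chain2[where f = Ln])
  hence "(q has_field_derivative D * of_real u / h a) (at (of_real x))" by simp
  hence "((\<lambda>x. q (of_real x)) has_vector_derivative D * of_real u / h a) (at x)"
    by (rule has_vector_derivative_real_field)
  hence "((\<lambda>x. Re (q (of_real x))) has_real_derivative Re (D * of_real u / h a)) (at x)"
    by (rule has_field_derivative_Re)
  from DERIV_add[OF DERIV_const[of "ln (norm (h a))"] this]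
  have "((\<lambda>x. ln (norm (h a)) + Re (q (of_real x))) has_real_derivative Re (D * of_real u / h a)) (at x)"
    by simp
  moreover have "Re (D * of_real u / h a) = u * Re (D / h a)"
    by (simp add: mult.commute[of D] times_divide_eq_right[symmetric] del: times_divide_eq_right)
  ultimately have der: "((\<lambda>x. ln (norm (h a)) + Re (q (of_real x))) has_real_derivative u * Re (D / h a)) (at x)"
    by simp
  have "continuous (at x) (\<lambda>x. h (w + of_real (u * x)))"
  proof -
    have "isCont h (w + of_real (u * x))" using h DERIV_isCont by blast
    thus ?thesis by (intro continuous_within_compose3[where g = h and f = "\<lambda>x. w + of_real (u * x)"]) (auto intro!: continuous_intros)
  qed
  hence "((\<lambda>x. h (w + of_real (u * x))) \<longlongrightarrow> h a) (at x)" by (simp add: isCont_def a_def)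
  hence "\<forall>\<^sub>F y in at x. h (w + of_real (u * y)) \<noteq> 0"
    by (rule tendsto_imp_eventually_ne) (use nz in \<open>simp add: a_def\<close>)
  hence "\<forall>\<^sub>F y in nhds x. h (w + of_real (u * y)) \<noteq> 0"
    using nz by (simp add: eventually_nhds_conv_at)
  hence ev: "\<forall>\<^sub>F y in nhds x. ln (norm (h a)) + Re (q (of_real y)) = ln (norm (h (w + of_real (u * y))))"
    by eventually_elim (use nz in \<open>simp add: q_def a_def norm_divide ln_div\<close>)
  show ?thesis using der unfolding a_def[symmetric]
    by (subst (asm) DERIV_cong_ev[OF refl ev refl])
qed

text \<open>The two poles lie on the circle itself, where |v -+ i r|^2 = 2 r (r -+ Im v); over the
  common denominator r^2 - (Im v)^2 = (Re v)^2 everything collapses. This supplies the boundary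
  values of \<open>Q\<close> on the arc.\<close>

lemma Re_inverse_sum_on_circle:
  fixes v :: complex
  assumes "norm v = r" "Re v > 0"
  shows "Re (1 / (v - \<i> * of_real r) + 1 / (v + \<i> * of_real r)) = 1 / Re v"
proof -
  have r2: "(Re v)\<^sup>2 + (Im v)\<^sup>2 = r\<^sup>2" using assms(1) by (metis cmod_power2)
  have p: "(Re v)\<^sup>2 > 0" using assms(2) by simp
  have "(Im v)\<^sup>2 < r\<^sup>2" using r2 p by linarith
  moreover have "r > 0" using assms(1) assms(2) by (metis zero_less_norm_iff less_irrefl zero_complex.simps(1))
  ultimately have im: "\<bar>Im v\<bar> < r" by (metis power2_abs power2_less_imp_less less_imp_le)
  have a1: "(Re v)\<^sup>2 + (Im v - r)\<^sup>2 = 2 * r * (r - Im v)"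
    and a2: "(Re v)\<^sup>2 + (Im v + r)\<^sup>2 = 2 * r * (r + Im v)"
    using r2 by (simp_all add: power2_eq_square algebra_simps)
  have "Re (1 / (v - \<i> * of_real r) + 1 / (v + \<i> * of_real r)) =
          Re v / (2 * r * (r - Im v)) + Re v / (2 * r * (r + Im v))"
    by (simp add: Re_divide a1 a2)
  also have "\<dots> = Re v / (r\<^sup>2 - (Im v)\<^sup>2)"
  proof -
    have *: "x / ((p + q) * p) + x / ((p + q) * q) = x / (p * q)" if "p > 0" "q > 0" for x p q :: real
      using that by (simp add: divide_simps add_pos_pos) (simp add: algebra_simps)
    have "r\<^sup>2 - (Im v)\<^sup>2 = (r - Im v) * (r + Im v)" by (simp add: power2_eq_square algebra_simps)
    thus ?thesis using *[of "r - Im v" "r + Im v" "Re v"] im by simp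
  qed
  also have "r\<^sup>2 - (Im v)\<^sup>2 = (Re v)\<^sup>2" using r2 by simp
  finally show ?thesis using assms(2) by (simp add: power2_eq_square)
qed

text \<open>
  On the right half of the disc the quotient \<open>\<psi>\<close> of the reflected function by \<open>h\<close> has modulus \<open>1\<close> on the
  diameter. The function \<open>Q\<close> has real part \<open>0\<close> on the diameter and exactly \<open>1 / (Re z - Re w\<^sub>0)\<close> on the
  arc, so \<open>\<psi> exp (- B Q)\<close> is bounded by \<open>1\<close> on the whole boundary.
\<close>
lemma reflected_quotient_bound:
  fixes h :: "complex \<Rightarrow> complex"
  assumes S: "open S" "cball w0 r \<subseteq> S" and h: "h holomorphic_on S" and r: "r > 0" and B: "B \<ge> 0"
    and nz: "\<And>z. z \<in> cball w0 r \<Longrightarrow> Re z \<ge> Re w0 \<Longrightarrow> h z \<noteq> 0"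
    and arc: "\<And>z. norm (z - w0) = r \<Longrightarrow> Re z > Re w0 \<Longrightarrow>
      norm (h (2 * of_real (Re w0) - cnj z)) \<le> norm (h z) * exp (B / (Re z - Re w0))"
    and \<delta>: "0 < \<delta>" "\<delta> < r"
  shows "norm (h (w0 - of_real \<delta>)) \<le> norm (h (w0 + of_real \<delta>)) * exp (2 * B * \<delta> / r\<^sup>2)"
proof -
  define c where "c = Re w0"
  define refl where "refl = (\<lambda>z. 2 * of_real c - cnj z)"
  \<comment> \<open>Reflection alone is antiholomorphic; the outer conjugation makes the numerator
    holomorphic without changing its modulus.\<close>
  define \<psi> where "\<psi> = (\<lambda>z. cnj (h (refl z)) / h z)"
  define Q where "Q = (\<lambda>z. 1 / ((z - w0) - \<i> * of_real r) + 1 / ((z - w0) + \<i> * of_real r))"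
  define F where "F = (\<lambda>z. \<psi> z * exp (- of_real B * Q z))"
  define D where "D = ball w0 r \<inter> {z. Re z > c}"
  define Dc where "Dc = cball w0 r \<inter> {z. Re z \<ge> c}"
  have refl_dist: "norm (refl z - w0) = norm (z - w0)" for z
  proof -
    have "refl z - w0 = - cnj (z - w0)" by (simp add: refl_def c_def complex_eq_iff)
    thus ?thesis by (simp only: norm_minus_cancel complex_mod_cnj)
  qed
  have DDc: "D \<subseteq> Dc" by (auto simp: D_def Dc_def)
  have opD: "open D" unfolding D_def by (intro open_Int open_halfspace_Re_gt) simp
  have clDc: "closed Dc" unfolding Dc_def by (intro closed_Int closed_halfspace_Re_ge) simp
  have contS: "continuous_on S h" using h by (rule holomorphic_on_imp_continuous_on)
  have cont_refl: "continuous_on Dc (\<lambda>z. h (refl z))"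
  proof (rule continuous_on_compose2[OF contS])
    show "continuous_on Dc refl" unfolding refl_def by (intro continuous_intros)
    show "refl ` Dc \<subseteq> S" using S(2) refl_dist by (force simp: Dc_def dist_norm norm_minus_commute)
  qed
  have nzD: "h z \<noteq> 0" if "z \<in> Dc" for z using nz that by (auto simp: Dc_def c_def)
  have cont\<psi>: "continuous_on Dc \<psi>"
    unfolding \<psi>_def using nzD S(2)
    by (intro continuous_intros cont_refl continuous_on_subset[OF contS]) (auto simp: Dc_def)
  have nzQ: "(z - w0) - \<i> * of_real r \<noteq> 0" "(z - w0) + \<i> * of_real r \<noteq> 0" if "Re z > c" for z
    using that by (auto simp: complex_eq_iff c_def)
  have holoF: "F holomorphic_on D"
  proof -
    have "(\<lambda>z. cnj (h (refl z))) = cnj \<circ> (\<lambda>z. h (2 * of_real c - z)) \<circ> cnj"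
      by (auto simp: refl_def)
    moreover have "cnj \<circ> (\<lambda>z. h (2 * of_real c - z)) \<circ> cnj holomorphic_on D"
    proof (rule holomorphic_on_compose_cnj_cnj[OF _ opD])
      have "(h \<circ> (\<lambda>z. 2 * of_real c - z)) holomorphic_on cnj ` D"
      proof (intro holomorphic_on_compose_gen[OF _ h] holomorphic_intros)
        show "(\<lambda>z. 2 * of_real c - z) ` cnj ` D \<subseteq> S"
          using S(2) refl_dist by (force simp: D_def dist_norm norm_minus_commute refl_def)
      qed
      thus "(\<lambda>z. h (2 * of_real c - z)) holomorphic_on cnj ` D" by (simp add: o_def)
    qed
    ultimately have "(\<lambda>z. cnj (h (refl z))) holomorphic_on D" by simp
    thus ?thesis
      unfolding F_def \<psi>_def Q_def using nzQ nzD DDc S(2)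
      by (intro holomorphic_intros holomorphic_on_subset[OF h]) (auto simp: D_def)
  qed
  have ReQ: "Re (Q z) \<ge> 0" if "Re z \<ge> c" for z
    using that unfolding Q_def by (auto simp: Re_divide c_def)
  have normF: "norm (F z) = norm (\<psi> z) * exp (- (B * Re (Q z)))" for z
    unfolding F_def norm_mult norm_exp_eq_Re by simp
  have FD: "norm (F z) \<le> norm (\<psi> z)" if "Re z \<ge> c" for z
    using ReQ[OF that] B unfolding normF by (intro mult_right_le_one_le) auto
  have bd: "norm (F z) \<le> 1" if z: "z \<in> D" for z
  proof (rule norm_le_of_limsup_frontier[OF opD _ holoF _ z])
    show "bounded D" by (rule bounded_subset[of "ball w0 r"]) (auto simp: D_def)
    fix \<xi> and e :: real assume \<xi>: "\<xi> \<in> frontier D" and e: "e > 0"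
    have \<xi>c: "\<xi> \<in> Dc" using \<xi> closure_minimal[OF DDc clDc] by (auto simp: frontier_def)
    have \<xi>D: "\<xi> \<notin> D" using \<xi> opD by (auto simp: frontier_def interior_open)
    show "\<exists>d>0. \<forall>z\<in>D \<inter> ball \<xi> d. norm (F z) \<le> 1 + e"
    proof (cases "Re \<xi> = c")
      \<comment> \<open>This case contains the two corners, where \<open>Q\<close> has its poles.
        Only Re Q >= 0 is used there: it gives |F| <= |\<psi>|, and \<psi> is continuous with
        modulus 1 on the diameter.\<close>
      case True
      hence "refl \<xi> = \<xi>" by (simp add: refl_def complex_eq_iff)
      hence 1: "norm (\<psi> \<xi>) = 1" using nzD[OF \<xi>c] by (simp add: \<psi>_def norm_divide)
      obtain d where d: "d > 0" "\<And>z. z \<in> Dc \<Longrightarrow> dist z \<xi> < d \<Longrightarrow> dist (\<psi> z) (\<psi> \<xi>) < e"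
        using cont\<psi> \<xi>c e unfolding continuous_on_iff by blast
      have "norm (F z) \<le> 1 + e" if "z \<in> D" "z \<in> ball \<xi> d" for z
      proof -
        have "dist (\<psi> z) (\<psi> \<xi>) < e" using that DDc by (intro d(2)) (auto simp: dist_commute)
        hence "norm (\<psi> z) \<le> 1 + e"
          using 1 norm_triangle_ineq2[of "\<psi> z" "\<psi> \<xi>"] by (simp add: dist_norm)
        thus ?thesis using FD[of z] that(1) by (auto simp: D_def)
      qed
      with d(1) show ?thesis by blast
    next
      case False
      hence Re: "Re \<xi> > c" using \<xi>c by (auto simp: Dc_def)
      hence nr: "norm (\<xi> - w0) = r"
        using \<xi>c \<xi>D by (auto simp: Dc_def D_def dist_norm norm_minus_commute)
      have Q1: "Re (Q \<xi>) = 1 / (Re \<xi> - c)"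
        using Re_inverse_sum_on_circle[OF nr] Re by (simp add: Q_def c_def)
      have "norm (\<psi> \<xi>) \<le> exp (B / (Re \<xi> - c))"
        using arc[OF nr] Re nzD[OF \<xi>c] by (simp add: \<psi>_def norm_divide refl_def c_def divide_simps mult.commute)
      hence F1: "norm (F \<xi>) \<le> 1"
        unfolding normF Q1 by (simp add: exp_minus field_simps)
      have "continuous_on (Dc \<inter> {z. Re z > c}) F"
        unfolding F_def Q_def using nzQ
        by (intro continuous_intros continuous_on_subset[OF cont\<psi>]) auto
      then obtain d where d: "d > 0" "\<And>z. z \<in> Dc \<inter> {z. Re z > c} \<Longrightarrow> dist z \<xi> < d \<Longrightarrow> dist (F z) (F \<xi>) < e"
        using \<xi>c Re e unfolding continuous_on_iff by blast
      have "norm (F z) \<le> 1 + e" if "z \<in> D" "z \<in> ball \<xi> d" for z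
      proof -
        have "dist (F z) (F \<xi>) < e" using that DDc by (intro d(2)) (auto simp: dist_commute D_def)
        thus ?thesis
          using F1 norm_triangle_ineq2[of "F z" "F \<xi>"] by (simp add: dist_norm)
      qed
      with d(1) show ?thesis by blast
    qed
  qed
  define z where "z = w0 + of_real \<delta>"
  have zD: "z \<in> D" using \<delta> by (auto simp: z_def D_def dist_norm c_def)
  have rz: "refl z = w0 - of_real \<delta>" by (simp add: refl_def z_def c_def complex_eq_iff)
  \<comment> \<open>Of first order in \<delta>, so the final inequality can be differentiated at
    \<delta> = 0.\<close>
  have "Re (Q z) = 2 * \<delta> / (\<delta>\<^sup>2 + r\<^sup>2)"
    by (simp add: Q_def z_def Re_divide)
  also have "\<dots> \<le> 2 * \<delta> / r\<^sup>2"
    using \<delta> r by (intro divide_left_mono) (auto intro!: mult_pos_pos add_nonneg_pos)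
  finally have "B * Re (Q z) \<le> 2 * B * \<delta> / r\<^sup>2"
    by (metis mult_left_mono[OF _ B] mult.assoc mult.left_commute times_divide_eq_right)
  moreover have "norm (h (refl z)) \<le> norm (h z) * exp (B * Re (Q z))"
    using bd[OF zD] nzD[of z] zD DDc unfolding normF
    by (auto simp: \<psi>_def norm_divide exp_minus field_simps)
  ultimately have "norm (h (refl z)) \<le> norm (h z) * exp (2 * B * \<delta> / r\<^sup>2)"
    by (elim order_trans) (intro mult_left_mono, auto)
  thus ?thesis unfolding rz by (simp add: z_def)
qed

text \<open>By \<open>reflected_quotient_bound\<close>, ln |h(w0 + \<delta>)| - ln |h(w0 -
  \<delta>)| + 2 B \<delta> / r^2 is nonnegative for small \<delta> > 0 and vanishes at 0. Its
  derivative at 0 is 2 Re (h'/h) + 2 B / r^2, which therefore cannot be negative.\<close>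

lemma Re_logderiv_ge_of_reflection:
  fixes h :: "complex \<Rightarrow> complex"
  assumes S: "open S" "cball w0 r \<subseteq> S" and h: "h holomorphic_on S" and r: "r > 0" and B: "B \<ge> 0"
    and nz: "\<And>z. z \<in> cball w0 r \<Longrightarrow> Re z \<ge> Re w0 \<Longrightarrow> h z \<noteq> 0"
    and arc: "\<And>z. norm (z - w0) = r \<Longrightarrow> Re z > Re w0 \<Longrightarrow>
      norm (h (2 * of_real (Re w0) - cnj z)) \<le> norm (h z) * exp (B / (Re z - Re w0))"
  shows "Re (deriv h w0 / h w0) \<ge> - (B / r\<^sup>2)"
proof (rule ccontr)
  assume neg: "\<not> ?thesis"
  define f where "f = (\<lambda>\<delta>::real. ln (norm (h (w0 + of_real (1 * \<delta>)))) - ln (norm (h (w0 + of_real ((- 1) * \<delta>)))) + 2 * B * \<delta> / r\<^sup>2)"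
  have w0S: "w0 \<in> S" using S(2) r by auto
  have h0: "h w0 \<noteq> 0" using nz[of w0] r by simp
  have d: "(h has_field_derivative deriv h w0) (at w0)"
    using holomorphic_derivI[OF h S(1) w0S] .
  have "((\<lambda>\<delta>. ln (norm (h (w0 + of_real (1 * \<delta>))))) has_real_derivative 1 * Re (deriv h w0 / h w0)) (at 0)"
    "((\<lambda>\<delta>. ln (norm (h (w0 + of_real ((- 1) * \<delta>))))) has_real_derivative (- 1) * Re (deriv h w0 / h w0)) (at 0)"
    using has_real_derivative_ln_norm[of h "deriv h w0" w0 1 0]
      has_real_derivative_ln_norm[of h "deriv h w0" w0 "- 1" 0] d h0 by simp_all
  from DERIV_add[OF DERIV_diff[OF this] DERIV_cmult[OF DERIV_ident, of "2 * B / r\<^sup>2"]]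
  have "(f has_real_derivative 1 * Re (deriv h w0 / h w0) - (- 1) * Re (deriv h w0 / h w0) + 2 * B / r\<^sup>2) (at 0)"
    unfolding f_def by simp
  moreover have "1 * Re (deriv h w0 / h w0) - (- 1) * Re (deriv h w0 / h w0) + 2 * B / r\<^sup>2 < 0"
    using neg by simp
  ultimately obtain d1 where d1: "d1 > 0" "\<And>\<delta>. 0 < \<delta> \<Longrightarrow> \<delta> < d1 \<Longrightarrow> f \<delta> < f 0"
    using DERIV_neg_dec_right[of f _ 0] by force
  have f0: "f 0 = 0" by (simp add: f_def)
  have "isCont h w0" using d DERIV_isCont by blast
  then obtain d2 where d2: "d2 > 0" "\<And>z. dist z w0 < d2 \<Longrightarrow> h z \<noteq> 0"
    using continuous_at_avoid[of w0 h 0] h0 by (auto simp: dist_commute)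
  define \<delta> where "\<delta> = min (min d1 d2) r / 2"
  have \<delta>: "0 < \<delta>" "\<delta> < d1" "\<delta> < d2" "\<delta> < r" using d1(1) d2(1) r by (auto simp: \<delta>_def)
  have n1: "h (w0 - of_real \<delta>) \<noteq> 0" "h (w0 + of_real \<delta>) \<noteq> 0"
    using \<delta> by (auto intro!: d2(2) simp: dist_norm)
  have "norm (h (w0 - of_real \<delta>)) \<le> norm (h (w0 + of_real \<delta>)) * exp (2 * B * \<delta> / r\<^sup>2)"
    by (rule reflected_quotient_bound[OF S h r B nz arc \<delta>(1) \<delta>(4)])
  hence "ln (norm (h (w0 - of_real \<delta>))) \<le> ln (norm (h (w0 + of_real \<delta>)) * exp (2 * B * \<delta> / r\<^sup>2))"
    using n1 by (subst ln_le_cancel_iff) auto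
  also have "\<dots> = ln (norm (h (w0 + of_real \<delta>))) + 2 * B * \<delta> / r\<^sup>2"
    using n1 by (subst ln_mult_pos) auto
  finally have "f \<delta> \<ge> 0" by (simp add: f_def)
  with d1(2)[OF \<delta>(1,2)] f0 show False by simp
qed

text \<open>
  Since \<open>Re g \<ge> - K\<close>, the Cayley transform \<open>\<phi> = g / (g + 2 K)\<close> is bounded by \<open>1\<close>, and it is \<open>O(1 / K)\<close> on
  the right edge of the rectangle. The factor \<open>exp (\<kappa> (z - s\<^sub>0))\<close> interpolates between the vertical edges
  as in the three lines theorem; the Gaussian makes the horizontal edges harmless.
\<close>
lemma norm_logderiv_bound:
  fixes g :: "complex \<Rightarrow> complex"
  assumes a: "0 < a" "a \<le> 3 / 4" and R: "R = cbox (s0 - Complex (a / 2) Y) (s0 + Complex (3 / 4 - a) Y)"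
    and S: "open S" "R \<subseteq> S" and g: "g holomorphic_on S"
    and K: "K > 0" "\<And>z. z \<in> R \<Longrightarrow> Re (g z) \<ge> - K"
    and C: "\<And>z. z \<in> R \<Longrightarrow> Re z = Re s0 + (3 / 4 - a) \<Longrightarrow> norm (g z) \<le> C"
    and \<kappa>: "\<kappa> \<ge> 1" "C * exp (3 / 4 * \<kappa> + 1) \<le> K" "\<kappa> + 1 \<le> Y\<^sup>2" "Y \<ge> 0"
  shows "norm (g s0) \<le> 2 * K * exp (- \<kappa> * a / 4) / (1 - exp (- \<kappa> * a / 4))"
proof -
  define q where "q = exp (- \<kappa> * a / 4)"
  have q: "0 < q" "q < 1" using a \<kappa> by (auto simp: q_def)
  define b where "b = 3 / 4 - a"
  have b: "0 \<le> b" "b \<le> 3 / 4" using a by (auto simp: b_def)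
  have ka: "\<kappa> * a \<ge> 0" using a \<kappa> by simp
  have kb: "\<kappa> * b = 3 / 4 * \<kappa> - \<kappa> * a" by (simp add: b_def algebra_simps)
  have b2: "b\<^sup>2 \<le> 1" using b by (simp add: abs_square_le_1)
  define \<phi> where "\<phi> = (\<lambda>z. g z / (g z + 2 * of_real K))"
  define \<Phi> where "\<Phi> = (\<lambda>z. \<phi> z * exp (of_real \<kappa> * (z - s0) + (z - s0)\<^sup>2))"
  have Rz: "z \<in> R \<longleftrightarrow> Re s0 - a / 2 \<le> Re z \<and> Re z \<le> Re s0 + b \<and> \<bar>Im z - Im s0\<bar> \<le> Y" for z
    unfolding R by (auto simp: in_cbox_complex_iff b_def)
  have ReK: "Re (g z + 2 * of_real K) \<ge> K" if "z \<in> R" for z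
    using K(2)[OF that] by simp
  hence nz: "g z + 2 * of_real K \<noteq> 0" if "z \<in> R" for z
    using that K(1) by (metis less_le_not_le zero_complex.simps(1))
  have nK: "norm (g z + 2 * of_real K) \<ge> K" if "z \<in> R" for z
    using ReK[OF that] complex_Re_le_cmod order_trans by blast
  have \<phi>1: "norm (\<phi> z) \<le> 1" if "z \<in> R" for z
  proof -
    \<comment> \<open>This is the difference |g + 2 K|^2 - |g|^2.\<close>
    have "0 \<le> 4 * K * (Re (g z) + K)" using K(1) K(2)[OF that] by simp
    hence "(norm (g z))\<^sup>2 \<le> (norm (g z + 2 * of_real K))\<^sup>2"
      unfolding cmod_power2 by (simp add: power2_eq_square algebra_simps)
    hence "norm (g z) \<le> norm (g z + 2 * of_real K)"
      by (rule power2_le_imp_le) simp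
    thus ?thesis using nz[OF that] by (simp add: \<phi>_def norm_divide)
  qed
  have norm\<Phi>: "norm (\<Phi> z) = norm (\<phi> z) * exp (\<kappa> * (Re z - Re s0) + (Re z - Re s0)\<^sup>2 - (Im z - Im s0)\<^sup>2)" for z
    by (simp add: \<Phi>_def norm_mult power2_eq_square)
  have cont: "continuous_on R \<Phi>" unfolding \<Phi>_def \<phi>_def using nz
    by (intro continuous_intros continuous_on_subset[OF holomorphic_on_imp_continuous_on[OF g] S(2)]) auto
  have "norm (\<Phi> s0) \<le> q"
  proof (rule maximum_modulus_frontier[of \<Phi> R])
    show "\<Phi> holomorphic_on interior R" unfolding \<Phi>_def \<phi>_def using nz S(2) interior_subset[of R]
      by (intro holomorphic_intros holomorphic_on_subset[OF g]) auto
    show "continuous_on (closure R) \<Phi>" using cont by (simp add: R)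
    show "bounded R" by (simp add: R)
    show "s0 \<in> R" unfolding Rz using a b \<kappa> by simp
    fix z assume "z \<in> frontier R"
    hence z: "z \<in> R" "z \<notin> box (s0 - Complex (a / 2) Y) (s0 + Complex (3 / 4 - a) Y)"
      by (auto simp: R frontier_def interior_cbox)
    then consider "Re z = Re s0 - a / 2" | "Re z = Re s0 + b" | "\<bar>Im z - Im s0\<bar> = Y"
      unfolding Rz by (fastforce simp: in_box_complex_iff b_def)
    thus "norm (\<Phi> z) \<le> q"
    proof cases
      case 1
      \<comment> \<open>The exponential contributes exp (- \<kappa> a / 2) on the left edge. Half of
        the exponent pays for the factor exp (a^2 / 4) of the Gaussian; the other half is q.\<close>
      have "a * a \<le> \<kappa> * a" using a \<kappa> by (intro mult_right_mono) auto
      moreover have "\<kappa> * (Re z - Re s0) + (Re z - Re s0)\<^sup>2 - (Im z - Im s0)\<^sup>2 \<le> - (\<kappa> * a / 2) + a * a / 4"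
        unfolding 1 by (simp add: power2_eq_square)
      ultimately have "\<kappa> * (Re z - Re s0) + (Re z - Re s0)\<^sup>2 - (Im z - Im s0)\<^sup>2 \<le> - \<kappa> * a / 4" by simp
      hence "norm (\<Phi> z) \<le> 1 * q" unfolding norm\<Phi> q_def
        by (intro mult_mono \<phi>1 z) auto
      thus ?thesis by simp
    next
      case 2
      have "norm (\<phi> z) \<le> C / K"
        using order_trans[OF norm_ge_zero C[OF z(1)]] C[OF z(1)] 2 nK[OF z(1)] K(1)
        unfolding \<phi>_def norm_divide b_def by (intro frac_le) auto
      \<comment> \<open>On the right edge the weight is at most exp (\<kappa> b + 1) with b = 3/4 -
        a. The assumed relation between C and K gains exp (- 3/4 \<kappa> - 1), so exp (- \<kappa>
        a) is left.\<close>
      also have "\<dots> \<le> exp (- (3 / 4 * \<kappa>) - 1)"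
      proof -
        have "- (3 / 4 * \<kappa>) - 1 = - (3 / 4 * \<kappa> + 1)" by simp
        thus ?thesis using \<kappa>(2) K(1) by (simp only: exp_minus) (simp add: field_simps)
      qed
      finally have "norm (\<Phi> z) \<le> exp (- (3 / 4 * \<kappa>) - 1) * exp (\<kappa> * b + b\<^sup>2)"
        unfolding norm\<Phi> 2 by (intro mult_mono) auto
      also have "\<dots> = exp (- (3 / 4 * \<kappa>) - 1 + (\<kappa> * b + b\<^sup>2))" by (simp add: exp_add)
      also have "\<dots> \<le> q" unfolding q_def exp_le_cancel_iff using b2 ka kb by linarith
      finally show ?thesis .
    next
      case 3
      have "\<kappa> * (Re z - Re s0) \<le> \<kappa> * b" using z(1) \<kappa> unfolding Rz by (intro mult_left_mono) auto
      moreover have "\<bar>Re z - Re s0\<bar> \<le> 1" using z(1) a b unfolding Rz by auto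
      hence "(Re z - Re s0)\<^sup>2 \<le> 1" by (simp add: abs_square_le_1)
      moreover have "(Im z - Im s0)\<^sup>2 = Y\<^sup>2" using 3 by (metis power2_abs)
      ultimately have "\<kappa> * (Re z - Re s0) + (Re z - Re s0)\<^sup>2 - (Im z - Im s0)\<^sup>2 \<le> \<kappa> * b - \<kappa>"
        using \<kappa>(3) by simp
      also have "\<dots> \<le> - \<kappa> * a / 4" using ka kb \<kappa>(1) by linarith
      finally have "norm (\<Phi> z) \<le> 1 * q" unfolding norm\<Phi> q_def
        by (intro mult_mono \<phi>1 z) auto
      thus ?thesis by simp
    qed
  qed
  hence \<phi>q: "norm (\<phi> s0) \<le> q" by (simp add: \<Phi>_def)
  have s0: "s0 \<in> R" unfolding Rz using a b \<kappa> by simp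
  \<comment> \<open>Inverting the Cayley transform: g = 2 K \<phi> / (1 - \<phi>).\<close>
  have "g s0 * (1 - \<phi> s0) = 2 * of_real K * \<phi> s0"
    using nz[OF s0] by (simp add: \<phi>_def field_simps)
  hence "norm (g s0) * norm (1 - \<phi> s0) = 2 * K * norm (\<phi> s0)"
    using K(1) by (metis (no_types, lifting) abs_of_pos norm_mult norm_numeral norm_of_real)
  also have "\<dots> \<le> 2 * K * q" using \<phi>q K(1) by simp
  finally have "norm (g s0) * norm (1 - \<phi> s0) \<le> 2 * K * q" .
  moreover have "1 - q \<le> norm (1 - \<phi> s0)"
    using norm_triangle_ineq2[of 1 "\<phi> s0"] \<phi>q by simp
  hence "norm (g s0) * (1 - q) \<le> norm (g s0) * norm (1 - \<phi> s0)" by (intro mult_left_mono) auto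
  ultimately have "norm (g s0) * (1 - q) \<le> 2 * K * q" by linarith
  hence "norm (g s0) \<le> 2 * K * q / (1 - q)" using q by (simp add: field_simps)
  thus ?thesis unfolding q_def .
qed

subsection \<open>Dirichlet series and nonvanishing of zeta\<close>

text \<open>Pairs (m, n) correspond to pairs (m n, m) of an integer and one of its divisors;
  absolute convergence of the double series allows summation over the fibres.\<close>

lemma has_sum_divisor_convolution:
  fixes f g :: "nat \<Rightarrow> complex"
  assumes f: "(\<lambda>n. norm (f n)) summable_on {0<..}" and g: "(\<lambda>n. norm (g n)) summable_on {0<..}"
  shows "((\<lambda>n. \<Sum>d | d dvd n. f d * g (n div d)) has_sum (infsum f {0<..} * infsum g {0<..})) {0<..}"
proof -
  let ?N = "{0<..} :: nat set"
  have f': "(f has_sum infsum f ?N) ?N" and g': "(g has_sum infsum g ?N) ?N"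
    using Infinite_Sum.abs_summable_summable[OF f] Infinite_Sum.abs_summable_summable[OF g] by simp_all
  have "(\<lambda>x. norm (case x of (m, n) \<Rightarrow> f m * g n)) summable_on ?N \<times> ?N"
  proof -
    have "(\<lambda>m. norm (f m) * (\<Sum>\<^sub>\<infinity>n\<in>?N. norm (g n))) summable_on ?N"
      using f by (intro summable_on_cmult_left)
    hence "(\<lambda>m. norm (\<Sum>\<^sub>\<infinity>n\<in>?N. norm (f m * g n))) summable_on ?N"
      by (simp add: norm_mult infsum_cmult_right' infsum_nonneg abs_mult)
    thus ?thesis using g
      by (subst Infinite_Sum.abs_summable_on_Sigma_iff) (auto simp: norm_mult intro: summable_on_cmult_right)
  qed
  hence "(\<lambda>(m, n). f m * g n) summable_on ?N \<times> ?N" by (rule Infinite_Sum.abs_summable_summable)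
  hence "((\<lambda>(m, n). f m * g n) has_sum (infsum f ?N * infsum g ?N)) (?N \<times> ?N)"
    by (intro has_sum_SigmaI[where g = "\<lambda>m. f m * infsum g ?N"])
       (auto intro: has_sum_cmult_right g' has_sum_cmult_left f')
  hence "((\<lambda>(n, d). f d * g (n div d)) has_sum (infsum f ?N * infsum g ?N)) (SIGMA n:?N. {d. d dvd n})"
    by (subst has_sum_reindex_bij_witness[where T = "?N \<times> ?N" and i = "\<lambda>(m, n). (m * n, m)" and j = "\<lambda>(n, d). (d, n div d)" and h = "\<lambda>(m, n). f m * g n"])
       (auto intro: Nat.gr0I)
  thus ?thesis
    by (rule has_sum_SigmaD) (auto intro!: has_sum_finiteI)
qed

lemma moebius_mu_prime_mult:
  assumes p: "prime p" and "\<not> p dvd d" and d: "d > 0"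
  shows "moebius_mu (p * d) = - moebius_mu d"
proof -
  have cop: "coprime p d" using assms by (simp add: prime_imp_coprime)
  have "squarefree (p * d) \<longleftrightarrow> squarefree d"
    using squarefree_mult_coprime[OF cop squarefree_prime[OF p]] squarefree_multD(2)[of p d] by blast
  moreover have "prime_factors (p * d) = insert p (prime_factors d)"
    using p d by (subst prime_factors_product) (auto simp: prime_prime_factors)
  moreover have "p \<notin> prime_factors d" using assms by auto
  ultimately show ?thesis by (simp add: moebius_mu_def)
qed

text \<open>For a prime p dividing n, multiplication by p maps the squarefree divisors prime to p
  bijectively onto the squarefree divisors divisible by p and flips the sign of
  \<open>moebius_mu\<close>.\<close>

lemma sum_moebius_mu_dvd:
  assumes n: "n > 0"
  shows "(\<Sum>d | d dvd n. moebius_mu d) = (if n = 1 then 1 else 0)"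
proof (cases "n = 1")
  case True
  thus ?thesis by (simp add: moebius_mu_def)
next
  case False
  then obtain p where p: "prime p" "p dvd n" using prime_factor_nat by blast
  define A where "A = {d. d dvd n \<and> squarefree d \<and> \<not> p dvd d}"
  define B where "B = {d. d dvd n \<and> squarefree d \<and> p dvd d}"
  have fin: "finite {d. d dvd n}" using n by simp
  have finAB: "finite A" "finite B" by (rule finite_subset[OF _ fin]; auto simp: A_def B_def)+
  have B: "B = (\<lambda>d. p * d) ` A"
  proof (intro equalityI subsetI)
    fix d assume d: "d \<in> B"
    then obtain e where e: "d = p * e" by (auto simp: B_def)
    have "\<not> p dvd e"
    proof
      assume "p dvd e"
      hence "p\<^sup>2 dvd d" by (simp add: e power2_eq_square)
      hence "p dvd 1" using d by (auto simp: B_def dest: squarefreeD)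
      thus False using p(1) by simp
    qed
    hence "e \<in> A" using d unfolding A_def B_def e
      by (auto dest: squarefree_multD dvd_mult_right)
    thus "d \<in> (\<lambda>d. p * d) ` A" using e by blast
  next
    fix d assume "d \<in> (\<lambda>d. p * d) ` A"
    then obtain e where e: "e \<in> A" "d = p * e" by blast
    have cop: "coprime p e" using e p by (auto simp: A_def intro: prime_imp_coprime)
    have "squarefree (p * e)" "p * e dvd n"
      using e p cop squarefree_mult_coprime[OF cop squarefree_prime[OF p(1)]]
      by (auto simp: A_def intro: divides_mult)
    thus "d \<in> B" by (simp add: B_def e(2))
  qed
  have inj: "inj_on (\<lambda>d. p * d) A" using p(1) by (auto intro!: inj_onI)
  have "(\<Sum>d | d dvd n. moebius_mu d) = (\<Sum>d\<in>A \<union> B. moebius_mu d)"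
    by (rule sum.mono_neutral_right[OF fin]) (auto simp: A_def B_def moebius_mu_def)
  also have "\<dots> = (\<Sum>d\<in>A. moebius_mu d) + (\<Sum>d\<in>B. moebius_mu d)"
    by (rule sum.union_disjoint[OF finAB]) (auto simp: A_def B_def)
  also have "(\<Sum>d\<in>B. moebius_mu d) = (\<Sum>d\<in>A. moebius_mu (p * d))"
    unfolding B by (simp add: sum.reindex[OF inj])
  also have "\<dots> = (\<Sum>d\<in>A. - moebius_mu d)"
  proof (rule sum.cong)
    fix d assume "d \<in> A"
    moreover from this n have "d > 0" by (auto simp: A_def intro: Nat.gr0I)
    ultimately show "moebius_mu (p * d) = - moebius_mu d"
      using p by (intro moebius_mu_prime_mult) (auto simp: A_def)
  qed simp
  finally show ?thesis using False by (simp add: sum_negf)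
qed

lemma abs_moebius_mu_le: "\<bar>moebius_mu n\<bar> \<le> 1"
  by (auto simp: moebius_mu_def)

section \<open>Absolutely convergent Dirichlet series and the logarithmic derivative of zeta\<close>

text \<open>An unordered sum, since products of Dirichlet series require rearrangement;
  \<open>dsum_sums\<close> converts back to ordinary series.\<close>

definition dsum :: "(nat \<Rightarrow> complex) \<Rightarrow> complex \<Rightarrow> complex" where
  "dsum a s = (\<Sum>\<^sub>\<infinity>n\<in>{0<..}. a n * of_nat n powr (- s))"

lemma norm_of_nat_powr: "n > 0 \<Longrightarrow> norm (of_nat n powr (- s) :: complex) = real n powr (- Re s)"
  by (subst norm_powr_real_powr) auto

lemma summable_on_nat_powr:
  assumes "\<sigma> > 1" shows "(\<lambda>n. real n powr (- \<sigma>)) summable_on {0<..}"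
proof -
  have "summable (\<lambda>n. real n powr (- \<sigma>))" using assms by (subst summable_real_powr_iff) auto
  hence "(\<lambda>n. real n powr (- \<sigma>)) summable_on UNIV"
    by (intro norm_summable_imp_summable_on) simp
  thus ?thesis by (rule summable_on_subset_banach) simp
qed

text \<open>The growth condition with \<epsilon> treats bounded coefficients (\<epsilon> = 0) and
  the coefficients ln n and \<open>mangoldt n\<close> (any \<epsilon> > 0) alike.\<close>

lemma norm_dsum_term_le:
  assumes "n > 0" "norm (a n) \<le> M * real n powr \<epsilon>"
  shows "norm (a n * of_nat n powr (- s)) \<le> M * real n powr (- (Re s - \<epsilon>))"
proof -
  have "norm (a n * of_nat n powr (- s)) = norm (a n) * real n powr (- Re s)"
    using assms(1) by (simp add: norm_mult norm_of_nat_powr)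
  also have "\<dots> \<le> M * real n powr \<epsilon> * real n powr (- Re s)"
    using assms(2) by (intro mult_right_mono) auto
  also have "\<dots> = M * real n powr (- (Re s - \<epsilon>))" by (simp add: powr_add[symmetric])
  finally show ?thesis .
qed

lemma dsum_abs_summable:
  assumes "\<And>n. n > 0 \<Longrightarrow> norm (a n) \<le> M * real n powr \<epsilon>" "Re s > 1 + \<epsilon>"
  shows "(\<lambda>n. norm (a n * of_nat n powr (- s))) summable_on {0<..}"
proof (rule summable_on_comparison_test)
  show "(\<lambda>n. M * real n powr (- (Re s - \<epsilon>))) summable_on {0<..}"
    using assms(2) by (intro summable_on_cmult_right summable_on_nat_powr) auto
qed (use assms(1) norm_dsum_term_le in auto)

lemma norm_dsum_le:
  assumes a: "\<And>n. n > 0 \<Longrightarrow> norm (a n) \<le> 1" and s: "Re s \<ge> \<sigma>" "\<sigma> > 1"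
  shows "norm (dsum a s) \<le> (\<Sum>\<^sub>\<infinity>n\<in>{0<..}. real n powr (- \<sigma>))"
proof -
  have a': "norm (a n) \<le> 1 * real n powr 0" if "n > 0" for n using a[OF that] that by simp
  have sm: "(\<lambda>n. norm (a n * of_nat n powr (- s))) summable_on {0<..}"
    by (rule dsum_abs_summable[OF a']) (use s in auto)
  have "norm (dsum a s) \<le> (\<Sum>\<^sub>\<infinity>n\<in>{0<..}. norm (a n * of_nat n powr (- s)))"
    unfolding dsum_def by (rule norm_infsum_bound[OF sm])
  also have "\<dots> \<le> (\<Sum>\<^sub>\<infinity>n\<in>{0<..}. real n powr (- \<sigma>))"
  proof (rule infsum_mono[OF sm summable_on_nat_powr[OF s(2)]])
    fix n :: nat assume n: "n \<in> {0<..}"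
    have "norm (a n * of_nat n powr (- s)) \<le> 1 * real n powr (- (Re s - 0))"
      using n by (intro norm_dsum_term_le a') auto
    also have "\<dots> \<le> real n powr (- \<sigma>)" using n s by (simp, intro powr_mono) auto
    finally show "norm (a n * of_nat n powr (- s)) \<le> real n powr (- \<sigma>)" .
  qed
  finally show ?thesis .
qed

lemma dsum_mult:
  assumes a: "\<And>n. n > 0 \<Longrightarrow> norm (a n) \<le> M * real n powr \<epsilon>" and b: "\<And>n. n > 0 \<Longrightarrow> norm (b n) \<le> M' * real n powr \<epsilon>"
    and s: "Re s > 1 + \<epsilon>"
  shows "dsum a s * dsum b s = dsum (\<lambda>n. \<Sum>d | d dvd n. a d * b (n div d)) s"
proof -
  have "((\<lambda>n. \<Sum>d | d dvd n. (a d * of_nat d powr (- s)) * (b (n div d) * of_nat (n div d) powr (- s)))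
          has_sum (dsum a s * dsum b s)) {0<..}"
    unfolding dsum_def
    by (intro has_sum_divisor_convolution dsum_abs_summable[OF a s] dsum_abs_summable[OF b s])
  also have "?this \<longleftrightarrow> ((\<lambda>n. (\<Sum>d | d dvd n. a d * b (n div d)) * of_nat n powr (- s))
          has_sum (dsum a s * dsum b s)) {0<..}"
  proof (rule has_sum_cong)
    fix n :: nat assume n: "n \<in> {0<..}"
    show "(\<Sum>d | d dvd n. (a d * of_nat d powr (- s)) * (b (n div d) * of_nat (n div d) powr (- s))) =
          (\<Sum>d | d dvd n. a d * b (n div d)) * of_nat n powr (- s)"
      unfolding sum_distrib_right
    proof (rule sum.cong)
      fix d assume "d \<in> {d. d dvd n}"
      then obtain e where e: "n = d * e" by auto
      have de: "d > 0" "e > 0" using n e by auto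
      have "(of_nat (d * e) :: complex) powr (- s) = of_nat d powr (- s) * of_nat e powr (- s)"
        using powr_times_real[of "of_nat d" "of_nat e" "- s"] by simp
      thus "(a d * of_nat d powr (- s)) * (b (n div d) * of_nat (n div d) powr (- s)) =
            a d * b (n div d) * of_nat n powr (- s)"
        using de by (simp add: e)
    qed simp
  qed
  finally show ?thesis by (simp add: dsum_def infsumI)
qed

lemma dsum_sums:
  assumes "\<And>n. n > 0 \<Longrightarrow> norm (a n) \<le> M * real n powr \<epsilon>" "Re s > 1 + \<epsilon>"
  shows "(\<lambda>n. a (Suc n) * of_nat (Suc n) powr (- s)) sums dsum a s"
proof -
  have "((\<lambda>n. a n * of_nat n powr (- s)) has_sum dsum a s) {0<..}"
    using Infinite_Sum.abs_summable_summable[OF dsum_abs_summable[OF assms]] by (simp add: dsum_def)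
  hence "((\<lambda>n. a (Suc n) * of_nat (Suc n) powr (- s)) has_sum dsum a s) UNIV"
    by (subst has_sum_reindex_bij_witness[where T = "{0<..}" and i = "\<lambda>n. n - 1" and j = Suc and h = "\<lambda>n. a n * of_nat n powr (- s)"]) auto
  thus ?thesis by (rule has_sum_imp_sums)
qed

lemma zeta_sums:
  assumes "Re s > 1" shows "(\<lambda>n. of_nat (Suc n) powr (- s)) sums zeta s"
  using is_zeta_zeta assms by (simp add: is_zeta_def powr_minus divide_inverse)

lemma zeta_eq_dsum:
  assumes "Re s > 1" shows "zeta s = dsum (\<lambda>_. 1) s"
proof -
  have "(\<lambda>n. 1 * of_nat (Suc n) powr (- s)) sums dsum (\<lambda>_. 1) s"
    using assms by (intro dsum_sums[of _ 1 0]) auto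
  thus ?thesis using sums_unique2[OF zeta_sums[OF assms]] by simp
qed

lemma dsum_moebius_mult_zeta:
  assumes "Re s > 1"
  shows "dsum (\<lambda>n. of_int (moebius_mu n)) s * zeta s = 1"
proof -
  have b: "norm (of_int (moebius_mu n) :: complex) \<le> 1 * real n powr 0" if "n > 0" for n
    using abs_moebius_mu_le[of n] that by simp
  have "dsum (\<lambda>n. of_int (moebius_mu n)) s * zeta s =
          dsum (\<lambda>n. \<Sum>d | d dvd n. of_int (moebius_mu d) * 1) s"
    unfolding zeta_eq_dsum[OF assms] using assms by (intro dsum_mult[OF b]) auto
  also have "\<dots> = (\<Sum>\<^sub>\<infinity>n\<in>{1}. of_nat n powr (- s))"
    unfolding dsum_def
  proof (rule infsum_cong_neutral)
    fix n :: nat assume n: "n \<in> {0<..} - {1}"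
    have "(\<Sum>d | d dvd n. of_int (moebius_mu d) :: complex) = of_int (\<Sum>d | d dvd n. moebius_mu d)" by simp
    thus "(\<Sum>d | d dvd n. of_int (moebius_mu d) * 1) * of_nat n powr (- s) = 0"
      using n by (subst (asm) sum_moebius_mu_dvd) auto
  next
    fix n :: nat assume n: "n \<in> {0<..} \<inter> {1}"
    thus "(\<Sum>d | d dvd n. of_int (moebius_mu d) * 1) * of_nat n powr (- s) = of_nat n powr (- s)"
      by (simp add: moebius_mu_def)
  qed auto
  finally show ?thesis by simp
qed

lemma zeta_has_derivative:
  assumes "Re s > 1"
  shows "(zeta has_field_derivative - dsum (\<lambda>n. of_real (ln (real n))) s) (at s)"
proof -
  define S where "S = {s. Re s > 1}"
  define f where "f = (\<lambda>n s. of_nat (Suc n) powr (- s) :: complex)"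
  define f' where "f' = (\<lambda>n s. - (of_real (ln (real (Suc n))) * of_nat (Suc n) powr (- s)) :: complex)"
  have S: "open S" by (simp add: S_def open_halfspace_Re_gt)
  have der: "(f n has_field_derivative f' n x) (at x)" if "x \<in> S" for n x
  proof -
    have "((\<lambda>z. of_nat (Suc n) powr z) has_field_derivative
            Ln (of_nat (Suc n)) * of_nat (Suc n) powr (- x)) (at (- x))"
      by (rule has_field_derivative_powr_right) (simp del: of_nat_Suc)
    from DERIV_chain2[OF this DERIV_minus[OF DERIV_ident]] show ?thesis
      unfolding f_def f'_def by (simp add: Ln_of_nat del: of_nat_Suc)
  qed
  have "\<exists>g g'. \<forall>x\<in>S. ((\<lambda>n. f n x) sums g x) \<and> ((\<lambda>n. f' n x) sums g' x) \<and> (g has_field_derivative g' x) (at x)"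
  proof (rule series_and_derivative_comparison_complex[OF S der])
    fix x assume x: "x \<in> S"
    define d where "d = (Re x - 1) / 2"
    have d: "d > 0" using x by (simp add: d_def S_def)
    have "summable (\<lambda>n. real n powr (- (1 + d)))" using d by (subst summable_real_powr_iff) auto
    hence "summable (\<lambda>n. real (Suc n) powr (- (1 + d)))" by (subst summable_Suc_iff)
    hence sm: "summable (\<lambda>n. of_real (real (Suc n) powr (- (1 + d))) :: complex)"
      by (subst summable_of_real_iff)
    have "norm (f n y) \<le> norm (of_real (real (Suc n) powr (- (1 + d))) :: complex)" if y: "y \<in> ball x d" for n y
    proof -
      have "\<bar>Re (x - y)\<bar> < d" using y abs_Re_le_cmod[of "x - y"] by (simp add: dist_norm)
      hence "Re x - Re y < d" by simp
      hence "Re y \<ge> 1 + d" unfolding d_def by (simp add: field_simps)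
      thus ?thesis unfolding f_def by (subst norm_of_nat_powr) (auto intro!: powr_mono)
    qed
    thus "\<exists>d h. 0 < d \<and> summable h \<and> range h \<subseteq> \<real>\<^sub>\<ge>\<^sub>0 \<and> (\<forall>\<^sub>F n in sequentially. \<forall>y\<in>ball x d \<inter> S. cmod (f n y) \<le> cmod (h n))"
      using d sm by (intro exI[of _ d] exI[of _ "\<lambda>n. of_real (real (Suc n) powr (- (1 + d)))"]) auto
  qed
  then obtain g g' where g: "\<And>x. x \<in> S \<Longrightarrow> (\<lambda>n. f n x) sums g x" "\<And>x. x \<in> S \<Longrightarrow> (\<lambda>n. f' n x) sums g' x"
    "\<And>x. x \<in> S \<Longrightarrow> (g has_field_derivative g' x) (at x)" by blast
  have s: "s \<in> S" using assms by (simp add: S_def)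
  have "(\<lambda>n. f n x) sums zeta x" if "x \<in> S" for x
    using zeta_sums[of x] that by (simp add: S_def f_def)
  hence gz: "g x = zeta x" if "x \<in> S" for x using g(1)[OF that] sums_unique2 that by blast
  have z': "(zeta has_field_derivative g' s) (at s)"
    using has_field_derivative_transform_within_open[OF g(3)[OF s] S s] gz by blast
  define \<epsilon> where "\<epsilon> = (Re s - 1) / 2"
  have \<epsilon>: "\<epsilon> > 0" "Re s > 1 + \<epsilon>" using assms by (auto simp: \<epsilon>_def field_simps)
  have b: "norm (of_real (ln (real n)) :: complex) \<le> 1 / \<epsilon> * real n powr \<epsilon>" if "n > 0" for n
    using ln_powr_bound[of "real n" \<epsilon>] that \<epsilon> by simp
  have "(\<lambda>n. of_real (ln (real (Suc n))) * of_nat (Suc n) powr (- s)) sums dsum (\<lambda>n. of_real (ln (real n))) s"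
    by (rule dsum_sums[OF b \<epsilon>(2)])
  hence "(\<lambda>n. f' n s) sums - dsum (\<lambda>n. of_real (ln (real n))) s"
    unfolding f'_def by (rule sums_minus)
  hence "g' s = - dsum (\<lambda>n. of_real (ln (real n))) s" using g(2)[OF s] sums_unique2 by blast
  thus ?thesis using z' by simp
qed

lemma norm_mangoldt_le_powr:
  assumes "\<epsilon> > 0" "n > 0"
  shows "norm (mangoldt n :: complex) \<le> 1 / \<epsilon> * real n powr \<epsilon>"
proof -
  have "norm (mangoldt n :: complex) = mangoldt n" by simp
  also have "\<dots> \<le> ln (real n)" using mangoldt_le[OF assms(2)] by simp
  also have "\<dots> \<le> 1 / \<epsilon> * real n powr \<epsilon>" using ln_powr_bound[of "real n" \<epsilon>] assms by simp
  finally show ?thesis .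
qed

lemma zeta_nonzero_Re_gt_1: "Re s > 1 \<Longrightarrow> zeta s \<noteq> 0"
  using dsum_moebius_mult_zeta[of s] by auto

text \<open>The divisor sum of \<open>mangoldt\<close> is ln n, so multiplying its Dirichlet series
  by that of zeta gives the series of - zeta'.\<close>

lemma zeta_logderiv:
  assumes "Re s > 1"
  shows "deriv zeta s / zeta s = - dsum mangoldt s"
proof -
  define \<epsilon> where "\<epsilon> = (Re s - 1) / 2"
  have \<epsilon>: "\<epsilon> > 0" "Re s > 1 + \<epsilon>" using assms by (auto simp: \<epsilon>_def field_simps)
  have b: "norm (1 :: complex) \<le> 1 * real n powr \<epsilon>" if "n > 0" for n
    using that \<epsilon> by (simp add: ge_one_powr_ge_zero)
  have "dsum mangoldt s * zeta s = dsum (\<lambda>n. \<Sum>d | d dvd n. mangoldt d * 1) s"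
    unfolding zeta_eq_dsum[OF assms]
    by (rule dsum_mult[OF norm_mangoldt_le_powr[OF \<epsilon>(1)] b \<epsilon>(2)])
  also have "\<dots> = dsum (\<lambda>n. of_real (ln (real n))) s"
    unfolding dsum_def using mangoldt_sum[where ?'a = complex] by (intro infsum_cong) auto
  also have "\<dots> = - deriv zeta s" using DERIV_imp_deriv[OF zeta_has_derivative[OF assms]] by simp
  finally show ?thesis using zeta_nonzero_Re_gt_1[OF assms] by (simp add: field_simps)
qed


text \<open>Termwise this is 3 + 4 cos v + cos 2v = 2 (1 + cos v)^2 >= 0 with v = t ln n, multiplied
  by nonnegative coefficients.\<close>

lemma dsum_mangoldt_3_4_1:
  assumes "\<sigma> > 1"
  shows "3 * Re (dsum mangoldt (of_real \<sigma>)) + 4 * Re (dsum mangoldt (\<i> * of_real t + of_real \<sigma>))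
           + Re (dsum mangoldt (\<i> * of_real (2 * t) + of_real \<sigma>)) \<ge> 0"
proof -
  define \<epsilon> where "\<epsilon> = (\<sigma> - 1) / 2"
  have \<epsilon>: "\<epsilon> > 0" "\<sigma> > 1 + \<epsilon>" using assms by (auto simp: \<epsilon>_def field_simps)
  have sums: "((\<lambda>n. mangoldt n * exp (- \<sigma> * ln (real n)) * cos (u * ln (real n))) has_sum
          Re (dsum mangoldt (\<i> * of_real u + of_real \<sigma>))) {0<..}" for u
  proof -
    let ?s = "\<i> * of_real u + of_real \<sigma> :: complex"
    have "(\<lambda>n. mangoldt n * of_nat n powr (- ?s)) summable_on {0<..}"
      by (rule Infinite_Sum.abs_summable_summable[OF dsum_abs_summable[OF norm_mangoldt_le_powr[OF \<epsilon>(1)]]]) (use \<epsilon> in auto)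
    hence "((\<lambda>n. mangoldt n * of_nat n powr (- ?s)) has_sum dsum mangoldt ?s) {0<..}"
      by (simp add: dsum_def)
    hence "((\<lambda>n. Re (mangoldt n * of_nat n powr (- ?s))) has_sum Re (dsum mangoldt ?s)) {0<..}"
      by (rule has_sum_Re)
    also have "?this \<longleftrightarrow> ?thesis"
    proof (rule has_sum_cong)
      fix n :: nat assume n: "n \<in> {0<..}"
      have "(of_nat n :: complex) powr (- ?s) = exp (- ?s * of_real (ln (real n)))"
        using n by (simp add: powr_def Ln_of_nat)
      hence "Re (of_nat n powr (- ?s)) = exp (- \<sigma> * ln (real n)) * cos (u * ln (real n))"
        by (simp add: Re_exp)
      moreover have "Im (mangoldt n :: complex) = 0" "Re (mangoldt n :: complex) = mangoldt n" by simp_all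
      ultimately show "Re (mangoldt n * of_nat n powr (- ?s)) =
             mangoldt n * exp (- \<sigma> * ln (real n)) * cos (u * ln (real n))"
        unfolding times_complex.sel by simp
    qed
    finally show ?thesis .
  qed
  have "((\<lambda>n. 3 * (mangoldt n * exp (- \<sigma> * ln (real n)) * cos (0 * ln (real n)))
      + 4 * (mangoldt n * exp (- \<sigma> * ln (real n)) * cos (t * ln (real n)))
      + (mangoldt n * exp (- \<sigma> * ln (real n)) * cos ((2 * t) * ln (real n)))) has_sum
      (3 * Re (dsum mangoldt (\<i> * of_real 0 + of_real \<sigma>)) + 4 * Re (dsum mangoldt (\<i> * of_real t + of_real \<sigma>))
           + Re (dsum mangoldt (\<i> * of_real (2 * t) + of_real \<sigma>)))) {0<..}"
    by (intro has_sum_add has_sum_cmult_right sums)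
  hence "0 \<le> 3 * Re (dsum mangoldt (\<i> * of_real 0 + of_real \<sigma>)) + 4 * Re (dsum mangoldt (\<i> * of_real t + of_real \<sigma>))
           + Re (dsum mangoldt (\<i> * of_real (2 * t) + of_real \<sigma>))"
  proof (rule has_sum_nonneg)
    fix n :: nat
    let ?c = "cos (t * ln (real n))"
    have "3 + 4 * ?c + cos (2 * (t * ln (real n))) = 2 * (1 + ?c)\<^sup>2"
      by (subst cos_double_cos) (simp add: power2_eq_square algebra_simps)
    hence "mangoldt n * exp (- \<sigma> * ln (real n)) * (3 + 4 * ?c + cos (2 * (t * ln (real n)))) \<ge> 0"
      by (simp add: mangoldt_nonneg)
    thus "0 \<le> 3 * (mangoldt n * exp (- \<sigma> * ln (real n)) * cos (0 * ln (real n)))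
      + 4 * (mangoldt n * exp (- \<sigma> * ln (real n)) * cos (t * ln (real n)))
      + (mangoldt n * exp (- \<sigma> * ln (real n)) * cos ((2 * t) * ln (real n)))"
      by (simp add: algebra_simps)
  qed
  thus ?thesis by simp
qed

section \<open>Zeta with its pole removed: growth, lower bounds and the line Re s = 1\<close>

lemma zeta_holomorphic: "zeta holomorphic_on - {1}"
  using is_zeta_zeta by (simp add: is_zeta_def)

text \<open>The value \<open>1\<close> is the residue of \<open>\<zeta>\<close> at its pole, where \<^const>\<open>zeta\<close> itself is unspecified.\<close>
definition zeta_reg :: "complex \<Rightarrow> complex" where
  "zeta_reg s = (if s = 1 then 1 else (s - 1) * zeta s)"

text \<open>The recursion \<open>dirichlet_sum_rec\<close> with m = 1 gives this for Re s > 1, and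
  continuation extends it to Re s > 0. The right-hand side shows holomorphy at 1 and quadratic
  growth at once.\<close>

lemma zeta_reg_eq:
  assumes "Re s > 0"
  shows "zeta_reg s = 1 + (\<Sum>n. taylor_rem 1 s n)"
proof (cases "s = 1")
  case True
  \<comment> \<open>At s = 1 the expanded function is constant: the factor \<open>ffact\<close> in
    the remainder bound contains 1 - s = 0.\<close>
  have "norm (taylor_rem 1 1 n) \<le> 0" for n
    using taylor_rem_bound[where s = 1 and m = 1 and n = n] by (simp add: ffact_def)
  thus ?thesis by (simp add: True zeta_reg_def)
next
  case False
  have "(s - 1) * zeta s = 1 + (\<Sum>n. taylor_rem 1 s n)"
  proof (rule analytic_continuation_open[of "{s. Re s > 1}" "{s. Re s > 0} - {1}"
        "\<lambda>s. (s - 1) * zeta s" "\<lambda>s. 1 + (\<Sum>n. taylor_rem 1 s n)"])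
    show "connected ({s. Re s > 0} - {1})"
      by (intro connected_open_delete open_halfspace_Re_gt convex_connected convex_halfspace_Re_gt) auto
    show "(\<lambda>s. (s - 1) * zeta s) holomorphic_on {s. Re s > 0} - {1}"
      by (intro holomorphic_intros holomorphic_on_subset[OF zeta_holomorphic]) auto
    show "(\<lambda>s. 1 + (\<Sum>n. taylor_rem 1 s n)) holomorphic_on {s. Re s > 0} - {1}"
      using taylor_rem_holo[of 1] by (intro holomorphic_intros) (auto elim: holomorphic_on_subset)
    fix z assume z: "z \<in> {s. Re s > 1}"
    have "zeta z = dirichlet_sum z"
      using zeta_sums[of z] dirichlet_sum_sums[of z] z sums_unique2 by blast
    thus "(z - 1) * zeta z = 1 + (\<Sum>n. taylor_rem 1 z n)"
      using dirichlet_sum_rec[of z 1] z by (simp add: ffact_def)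
  qed (use assms False in \<open>auto simp: open_halfspace_Re_gt open_delete intro: exI[of _ 2]\<close>)
  thus ?thesis using False by (simp add: zeta_reg_def)
qed

lemma zeta_reg_holomorphic: "zeta_reg holomorphic_on {s. Re s > 0}"
proof -
  have "(\<lambda>s. 1 + (\<Sum>n. taylor_rem 1 s n)) holomorphic_on {s. Re s > 0}"
    using taylor_rem_holo[of 1] by (intro holomorphic_intros) auto
  thus ?thesis by (rule holomorphic_transform) (use zeta_reg_eq in auto)
qed

text \<open>The factor (1 - s)(- s) of the Taylor remainder gives the square, and the sum of
  n^(-5/4) the constant. The strip contains all points met later: reflection at distance at most 1/4
  from a line right of 1/2, and discs reaching Re s + 2 <= 13/4.\<close>

lemma zeta_reg_upper:
  obtains A where "A \<ge> 1"
    "\<And>s. 1 / 4 \<le> Re s \<Longrightarrow> Re s \<le> 4 \<Longrightarrow> norm (zeta_reg s) < A * (\<bar>Im s\<bar> + 4)\<^sup>2"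
proof -
  define w where "w = (\<lambda>n. real (Suc n) powr (- 5 / 4))"
  have "summable (\<lambda>n. real n powr (- 5 / 4))" by (subst summable_real_powr_iff) auto
  hence w: "summable w" unfolding w_def by (subst summable_Suc_iff)
  define W where "W = suminf w"
  have W: "W \<ge> 0" unfolding W_def by (intro suminf_nonneg w) (simp add: w_def)
  show ?thesis
  proof (rule that[of "1 + W"])
    show "1 \<le> 1 + W" using W by simp
    fix s assume s: "1 / 4 \<le> Re s" "Re s \<le> 4"
    define y where "y = \<bar>Im s\<bar> + 4"
    have y: "y \<ge> 4" by (simp add: y_def)
    have n1: "norm s \<le> y" using cmod_le[of s] s by (simp add: y_def)
    have n2: "norm (1 - s) \<le> y" using cmod_le[of "1 - s"] s by (simp add: y_def)
    have ff: "norm (ffact (Suc 1) (1 - s)) \<le> y * y"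
    proof -
      have "ffact (Suc 1) (1 - s) = (1 - s) * (- s)" by (simp add: ffact_def numeral_2_eq_2)
      thus ?thesis using n1 n2 y by (simp add: norm_mult mult_mono)
    qed
    have b: "norm (taylor_rem 1 s n) \<le> y * y * w n" for n
    proof -
      have "norm (taylor_rem 1 s n) \<le> norm (ffact (Suc 1) (1 - s)) * real (Suc n) powr (- Re s - real 1)"
        using s by (intro taylor_rem_bound) auto
      also have "\<dots> \<le> (y * y) * w n"
        unfolding w_def using ff s y by (intro mult_mono powr_mono) auto
      finally show ?thesis .
    qed
    have "norm (\<Sum>n. taylor_rem 1 s n) \<le> (\<Sum>n. y * y * w n)"
      by (rule norm_suminf_le[OF b summable_mult[OF w]])
    also have "\<dots> = y * y * W" unfolding W_def by (rule suminf_mult[OF w])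
    finally have "norm (zeta_reg s) \<le> 1 + y * y * W"
      using s norm_triangle_ineq[of 1 "\<Sum>n. taylor_rem 1 s n"] by (subst zeta_reg_eq) auto
    also have "1 < y * y" using y mult_mono[of 4 y 4 y] by simp
    hence "1 + y * y * W < (1 + W) * y\<^sup>2" by (simp add: power2_eq_square algebra_simps)
    finally show "norm (zeta_reg s) < (1 + W) * (\<bar>Im s\<bar> + 4)\<^sup>2" by (simp add: y_def)
  qed
qed

text \<open>Here 1 / zeta is the Dirichlet series of \<open>moebius_mu\<close>, bounded by the sum
  of n^(-5/4); the factor s - 1 has modulus at least 1/4.\<close>

lemma zeta_reg_lower:
  obtains c where "c > 0" "\<And>s. 5 / 4 \<le> Re s \<Longrightarrow> norm (zeta_reg s) \<ge> c"
proof -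
  define D where "D = (\<Sum>\<^sub>\<infinity>n\<in>{0<..}. real n powr (- (5 / 4)))"
  have *: "norm (zeta s) * D \<ge> 1" if "Re s \<ge> 5 / 4" for s
  proof -
    have "norm (dsum (\<lambda>n. of_int (moebius_mu n)) s) \<le> D" unfolding D_def
    proof (rule norm_dsum_le)
      show "norm (of_int (moebius_mu n) :: complex) \<le> 1" for n
        using abs_moebius_mu_le[of n] by simp
    qed (use that in auto)
    hence "norm (dsum (\<lambda>n. of_int (moebius_mu n)) s) * norm (zeta s) \<le> D * norm (zeta s)"
      by (intro mult_right_mono) auto
    thus ?thesis using dsum_moebius_mult_zeta[of s] that by (simp add: norm_mult[symmetric] mult.commute)
  qed
  have D: "D > 0"
  proof (rule ccontr)
    assume "\<not> D > 0"
    hence "norm (zeta 2) * D \<le> 0" by (simp add: mult_nonneg_nonpos)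
    thus False using *[of 2] by simp
  qed
  show ?thesis
  proof (rule that[of "1 / (4 * D)"])
    show "1 / (4 * D) > 0" using D by simp
    fix s assume s: "5 / 4 \<le> Re s"
    have "1 / 4 \<le> norm (s - 1)" using complex_Re_le_cmod[of "s - 1"] s by simp
    moreover have "1 / D \<le> norm (zeta s)" using *[OF s] D by (simp add: field_simps)
    ultimately have "1 / 4 * (1 / D) \<le> norm (s - 1) * norm (zeta s)"
      using D by (intro mult_mono) auto
    thus "norm (zeta_reg s) \<ge> 1 / (4 * D)" using s by (auto simp: zeta_reg_def norm_mult)
  qed
qed

text \<open>Absolute convergence makes the bound independent of the height. It is the constant for
  the right edge of the rectangle in \<open>norm_logderiv_bound\<close>.\<close>

lemma zeta_reg_logderiv_bounded:
  obtains C where "C \<ge> 0" "\<And>s. Re s = 5 / 4 \<Longrightarrow> norm (deriv zeta_reg s / zeta_reg s) \<le> C"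
proof -
  \<comment> \<open>From mangoldt n <= 8 n^(1/8) and 5/4 - 1/8 = 9/8 > 1.\<close>
  define D where "D = (\<Sum>\<^sub>\<infinity>n\<in>{0<..}. 8 * real n powr (- (9 / 8)))"
  have D: "norm (dsum mangoldt s) \<le> D" if "Re s = 5 / 4" for s
  proof -
    have sm: "(\<lambda>n. norm (mangoldt n * of_nat n powr (- s))) summable_on {0<..}"
      by (rule dsum_abs_summable[OF norm_mangoldt_le_powr[of "1 / 8"]]) (use that in auto)
    have "norm (dsum mangoldt s) \<le> (\<Sum>\<^sub>\<infinity>n\<in>{0<..}. norm (mangoldt n * of_nat n powr (- s)))"
      unfolding dsum_def by (rule norm_infsum_bound[OF sm])
    also have "\<dots> \<le> D" unfolding D_def
    proof (rule infsum_mono[OF sm])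
      show "(\<lambda>n. 8 * real n powr (- (9 / 8))) summable_on {0<..}"
        by (intro summable_on_cmult_right summable_on_nat_powr) auto
      fix n :: nat assume "n \<in> {0<..}"
      thus "norm (mangoldt n * of_nat n powr (- s)) \<le> 8 * real n powr (- (9 / 8))"
        using norm_dsum_term_le[of n mangoldt 8 "1 / 8" s] norm_mangoldt_le_powr[of "1 / 8" n] that by simp
    qed
    finally show ?thesis .
  qed
  show ?thesis
  proof (rule that[of "4 + D"])
    show "4 + D \<ge> 0" using D[of "5 / 4"] norm_ge_zero[of "dsum mangoldt (5 / 4)"]
      by (simp, linarith)
    fix s :: complex assume s: "Re s = 5 / 4"
    have ne: "s \<noteq> 1" "zeta s \<noteq> 0" "s - 1 \<noteq> 0" using s zeta_nonzero_Re_gt_1[of s] by auto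
    have "(zeta has_field_derivative deriv zeta s) (at s)"
      by (rule holomorphic_derivI[OF zeta_holomorphic]) (use ne in auto)
    hence "((\<lambda>s. (s - 1) * zeta s) has_field_derivative zeta s + (s - 1) * deriv zeta s) (at s)"
      by (auto intro!: derivative_eq_intros)
    hence "(zeta_reg has_field_derivative zeta s + (s - 1) * deriv zeta s) (at s)"
      by (rule has_field_derivative_transform_within_open[where S = "- {1}"])
         (use ne in \<open>auto simp: zeta_reg_def\<close>)
    hence "deriv zeta_reg s = zeta s + (s - 1) * deriv zeta s" by (rule DERIV_imp_deriv)
    hence "deriv zeta_reg s / zeta_reg s = 1 / (s - 1) + deriv zeta s / zeta s"
      using ne by (simp add: zeta_reg_def field_simps)
    also have "deriv zeta s / zeta s = - dsum mangoldt s" using s by (intro zeta_logderiv) auto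
    finally have "norm (deriv zeta_reg s / zeta_reg s) \<le> norm (1 / (s - 1)) + norm (dsum mangoldt s)"
      using norm_triangle_ineq4[of "1 / (s - 1)" "dsum mangoldt s"] by simp
    moreover have "1 / 4 \<le> norm (s - 1)" using complex_Re_le_cmod[of "s - 1"] s by simp
    hence "norm (1 / (s - 1)) \<le> 4" by (simp add: norm_divide divide_simps)
    ultimately show "norm (deriv zeta_reg s / zeta_reg s) \<le> 4 + D" using D[OF s] by linarith
  qed
qed

text \<open>
  The boundary line is not covered by \<^const>\<open>riemann_hypothesis\<close>. The product
  \<open>|\<zeta>(\<sigma>)\<^sup>3 \<zeta>(\<sigma> + i t)\<^sup>4 \<zeta>(\<sigma> + 2 i t)|\<close> decreases in \<open>\<sigma>\<close>, so it stays away from \<open>0\<close> as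
  \<open>\<sigma> \<rightarrow> 1\<close>, whereas a zero at \<open>1 + i t\<close> would outweigh the triple pole.
\<close>
lemma zeta_nonzero_Re_1:
  assumes t: "t \<noteq> 0" shows "zeta (\<i> * of_real t + 1) \<noteq> 0"
proof
  assume z0: "zeta (\<i> * of_real t + 1) = 0"
  define L where "L = (\<lambda>u \<sigma>. ln (norm (zeta (\<i> * of_real u + of_real (1 * \<sigma>)))))"
  define E where "E = (\<lambda>\<sigma>. 3 * L 0 \<sigma> + 4 * L t \<sigma> + L (2 * t) \<sigma>)"
  have dL: "(L u has_real_derivative - Re (dsum mangoldt (\<i> * of_real u + of_real \<sigma>))) (at \<sigma>)"
    if "\<sigma> > 1" for u \<sigma>
  proof -
    have s: "Re (\<i> * of_real u + of_real \<sigma>) > 1" using that by simp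
    have "(L u has_real_derivative 1 * Re (deriv zeta (\<i> * of_real u + of_real (1 * \<sigma>))
             / zeta (\<i> * of_real u + of_real (1 * \<sigma>)))) (at \<sigma>)"
      unfolding L_def using zeta_has_derivative[OF s] DERIV_imp_deriv[OF zeta_has_derivative[OF s]]
        zeta_nonzero_Re_gt_1[OF s]
      by (intro has_real_derivative_ln_norm) auto
    thus ?thesis using zeta_logderiv[OF s] by simp
  qed
  have E2: "E \<sigma> \<ge> E 2" if "1 < \<sigma>" "\<sigma> \<le> 2" for \<sigma>
  proof (rule DERIV_nonpos_imp_nonincreasing[OF that(2)])
    fix x assume x: "\<sigma> \<le> x" "x \<le> 2"
    hence "x > 1" using that by simp
    hence "(E has_real_derivative 3 * (- Re (dsum mangoldt (\<i> * of_real 0 + of_real x)))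
       + 4 * (- Re (dsum mangoldt (\<i> * of_real t + of_real x)))
       + (- Re (dsum mangoldt (\<i> * of_real (2 * t) + of_real x)))) (at x)"
      unfolding E_def by (intro DERIV_add DERIV_cmult dL)
    moreover have "3 * (- Re (dsum mangoldt (\<i> * of_real 0 + of_real x)))
       + 4 * (- Re (dsum mangoldt (\<i> * of_real t + of_real x)))
       + (- Re (dsum mangoldt (\<i> * of_real (2 * t) + of_real x))) \<le> 0"
      using dsum_mangoldt_3_4_1[OF \<open>x > 1\<close>, of t] by simp
    ultimately show "\<exists>y. (E has_real_derivative y) (at x) \<and> y \<le> 0" by blast
  qed
  \<comment> \<open>Three factors \<sigma> - 1 remove the triple pole and four turn the powers of
    the assumed zero into difference quotients. Thus P converges as \<sigma> tends to 1, and the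
    product of zeta values is P with one factor \<sigma> - 1 left over.\<close>
  define P where "P = (\<lambda>\<sigma>::real. zeta_reg (of_real \<sigma>) ^ 3 *
     (zeta (\<i> * of_real t + of_real \<sigma>) / (of_real \<sigma> - 1)) ^ 4 * zeta (\<i> * of_real (2 * t) + of_real \<sigma>))"
  have lower: "exp (E 2) \<le> norm (of_real (\<sigma> - 1) * P \<sigma>)" if \<sigma>: "1 < \<sigma>" "\<sigma> \<le> 2" for \<sigma>
  proof -
    have nz: "zeta (of_real \<sigma>) \<noteq> 0" "zeta (\<i> * of_real t + of_real \<sigma>) \<noteq> 0" "zeta (\<i> * of_real (2 * t) + of_real \<sigma>) \<noteq> 0"
      using \<sigma> by (auto intro!: zeta_nonzero_Re_gt_1)
    have "of_real (\<sigma> - 1) * P \<sigma> = zeta (of_real \<sigma>) ^ 3 * zeta (\<i> * of_real t + of_real \<sigma>) ^ 4 * zeta (\<i> * of_real (2 * t) + of_real \<sigma>)"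
    proof -
      have "e * ((e * a) ^ 3 * (b / e) ^ 4 * c) = a ^ 3 * b ^ 4 * c" if "e \<noteq> 0" for a b c e :: complex
        using that by (simp add: power3_eq_cube power4_eq_xxxx)
      from this[of "of_real \<sigma> - 1"] show ?thesis
        using \<sigma> by (simp add: P_def zeta_reg_def)
    qed
    moreover have "exp (E \<sigma>) = norm (zeta (of_real \<sigma>)) ^ 3 * norm (zeta (\<i> * of_real t + of_real \<sigma>)) ^ 4 * norm (zeta (\<i> * of_real (2 * t) + of_real \<sigma>))"
    proof -
      have "exp (3 * ln x) = x ^ 3" "exp (4 * ln x) = x ^ 4" if "x > 0" for x :: real
        using that exp_of_nat_mult[of 3 "ln x"] exp_of_nat_mult[of 4 "ln x"] by simp_all
      thus ?thesis unfolding E_def L_def exp_add using nz by simp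
    qed
    ultimately have "exp (E \<sigma>) = norm (of_real (\<sigma> - 1) * P \<sigma>)" by (simp add: norm_mult norm_power)
    thus ?thesis using E2[OF \<sigma>] by (metis exp_le_cancel_iff)
  qed
  have F: "((\<lambda>x::real. of_real x) \<longlongrightarrow> (1::complex)) (at_right 1)"
    using tendsto_of_real[OF tendsto_ident_at, of 1 "{1<..}", where ?'a = complex] by simp
  have cz: "isCont zeta w" if "w \<noteq> 1" for w
    by (rule DERIV_isCont[OF holomorphic_derivI[OF zeta_holomorphic]]) (use that in auto)
  have l1: "((\<lambda>\<sigma>::real. zeta_reg (of_real \<sigma>)) \<longlongrightarrow> zeta_reg 1) (at_right 1)"
  proof (rule isCont_tendsto_compose[OF _ F])
    show "isCont zeta_reg 1"
      by (rule DERIV_isCont[OF holomorphic_derivI[OF zeta_reg_holomorphic]])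
         (auto simp: open_halfspace_Re_gt)
  qed
  have l2: "((\<lambda>\<sigma>::real. zeta (\<i> * of_real (2 * t) + of_real \<sigma>)) \<longlongrightarrow> zeta (\<i> * of_real (2 * t) + 1)) (at_right 1)"
    by (rule isCont_tendsto_compose[OF cz]) (use t in \<open>auto intro!: tendsto_intros F\<close>)
  have l3: "((\<lambda>\<sigma>::real. zeta (\<i> * of_real t + of_real \<sigma>) / (of_real \<sigma> - 1)) \<longlongrightarrow> deriv zeta (\<i> * of_real t + 1)) (at_right 1)"
  proof -
    have "(zeta has_field_derivative deriv zeta (\<i> * of_real t + 1)) (at (\<i> * of_real t + 1))"
      by (rule holomorphic_derivI[OF zeta_holomorphic]) (use t in auto)
    hence "((\<lambda>h. zeta (\<i> * of_real t + 1 + h) / h) \<longlongrightarrow> deriv zeta (\<i> * of_real t + 1)) (at 0)"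
      by (simp add: DERIV_def z0)
    moreover have "filterlim (\<lambda>\<sigma>::real. of_real (\<sigma> - 1) :: complex) (at 0) (at_right 1)"
      unfolding filterlim_at
    proof
      show "\<forall>\<^sub>F x::real in at_right 1. (of_real (x - 1) :: complex) \<in> UNIV \<and> (of_real (x - 1) :: complex) \<noteq> 0"
        by (simp add: eventually_at_filter)
      show "((\<lambda>\<sigma>::real. of_real (\<sigma> - 1) :: complex) \<longlongrightarrow> 0) (at_right 1)"
        using tendsto_diff[OF F tendsto_const[of 1]] by simp
    qed
    ultimately have "((\<lambda>\<sigma>::real. zeta (\<i> * of_real t + 1 + of_real (\<sigma> - 1)) / of_real (\<sigma> - 1)) \<longlongrightarrow> deriv zeta (\<i> * of_real t + 1)) (at_right 1)"
      by (rule filterlim_compose)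
    thus ?thesis by simp
  qed
  have "((\<lambda>\<sigma>. norm (of_real (\<sigma> - 1) * P \<sigma>)) \<longlongrightarrow> norm (of_real (1 - 1) * (zeta_reg 1 ^ 3 * deriv zeta (\<i> * of_real t + 1) ^ 4 * zeta (\<i> * of_real (2 * t) + 1)))) (at_right 1)"
    unfolding P_def by (intro tendsto_intros l1 l2 l3)
  hence "((\<lambda>\<sigma>. norm (of_real (\<sigma> - 1) * P \<sigma>)) \<longlongrightarrow> 0) (at_right 1)" by simp
  moreover have "\<forall>\<^sub>F \<sigma> in at_right 1. exp (E 2) \<le> norm (of_real (\<sigma> - 1) * P \<sigma>)"
    using lower by (intro eventually_at_rightI[of 1 2]) auto
  ultimately have "exp (E 2) \<le> 0"
    by (rule tendsto_lowerbound) simp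
  thus False by simp
qed

lemma zeta_reg_nonzero:
  assumes "riemann_hypothesis" and s: "Re s > 1 / 2"
  shows "zeta_reg s \<noteq> 0"
proof (cases "s = 1")
  case False
  have "zeta s \<noteq> 0"
  proof (cases "Re s" "1 :: real" rule: linorder_cases)
    case less
    moreover have "0 < Re s" using s by linarith
    ultimately have "zeta s = 0 \<Longrightarrow> Re s = 1 / 2"
      using assms(1) unfolding riemann_hypothesis_def by blast
    thus ?thesis using s by auto
  next
    case equal
    hence "s = \<i> * of_real (Im s) + 1" by (simp add: complex_eq_iff)
    moreover have "Im s \<noteq> 0" using equal False by (auto simp: complex_eq_iff)
    ultimately show ?thesis using zeta_nonzero_Re_1[of "Im s"] by metis
  next
    case greater
    thus ?thesis by (rule zeta_nonzero_Re_gt_1)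
  qed
  thus ?thesis using False by (simp add: zeta_reg_def)
qed (simp add: zeta_reg_def)

subsection \<open>Lower bounds for zeta to the right of the critical line\<close>

text \<open>On the arc of radius 1/4 around s, Borel-Caratheodory bounds ln |h(z)| from below with a
  loss proportional to 1/d, where d = Re z - Re s. The arc hypothesis of
  \<open>Re_logderiv_ge_of_reflection\<close> permits just this, and the result does not degenerate
  as Re s tends to 1/2.\<close>

lemma Re_zeta_reg_logderiv_ge:
  assumes RH: "riemann_hypothesis"
  obtains C where "C \<ge> 1"
    "\<And>s. 1 / 2 < Re s \<Longrightarrow> Re s \<le> 5 / 4 \<Longrightarrow> Re (deriv zeta_reg s / zeta_reg s) \<ge> - (C * ln (\<bar>Im s\<bar> + 4))"
proof -
  obtain A where A: "A \<ge> 1" "\<And>s. 1 / 4 \<le> Re s \<Longrightarrow> Re s \<le> 4 \<Longrightarrow> norm (zeta_reg s) < A * (\<bar>Im s\<bar> + 4)\<^sup>2"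
    using zeta_reg_upper by metis
  obtain c0 where c0: "c0 > 0" "\<And>s. 5 / 4 \<le> Re s \<Longrightarrow> norm (zeta_reg s) \<ge> c0"
    using zeta_reg_lower by metis
  \<comment> \<open>48 = 3 * 16: the 3 is that of \<open>B\<close>, the 16 comes from dividing by
    the squared radius (1/4)^2, and the summand 2 from ln (T^2).\<close>
  define C where "C = 48 * (\<bar>ln (4 * A / c0)\<bar> + 2)"
  show ?thesis
  proof (rule that[of C])
    show "C \<ge> 1" by (simp add: C_def)
    fix s assume s: "1 / 2 < Re s" "Re s \<le> 5 / 4"
    define T where "T = \<bar>Im s\<bar> + 4"
    have T: "T \<ge> 4" by (simp add: T_def)
    define M where "M = 4 * A * T\<^sup>2"
    have M: "norm (zeta_reg z) < M" if "1 / 4 \<le> Re z" "Re z \<le> 4" "\<bar>Im z\<bar> \<le> \<bar>Im s\<bar> + 5 / 4" for z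
    proof -
      have "norm (zeta_reg z) < A * (\<bar>Im z\<bar> + 4)\<^sup>2" by (rule A(2)[OF that(1,2)])
      also have "\<dots> \<le> A * (2 * T)\<^sup>2"
        using A(1) that(3) T by (intro mult_left_mono power_mono) (auto simp: T_def)
      finally show ?thesis by (simp add: M_def power_mult_distrib mult_ac)
    qed
    define D where "D = ln M - ln c0"
    have c0M: "c0 < M" using le_less_trans[OF c0(2)[of 2] M[of 2]] by simp
    have D: "D > 0" using c0 c0M unfolding D_def by (smt (verit) ln_less_cancel_iff)
    \<comment> \<open>A share 2 D / d is lost in bounding |h(z)| from below, and a share D <= D / d
      in comparing M with c0.\<close>
    define B where "B = 3 * D"
    have ge: "Re (deriv zeta_reg s / zeta_reg s) \<ge> - (B / (1 / 4)\<^sup>2)"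
    proof (rule Re_logderiv_ge_of_reflection[OF _ _ zeta_reg_holomorphic])
      show "open {s. 0 < Re s}" by (rule open_halfspace_Re_gt)
      show "cball s (1 / 4) \<subseteq> {s. 0 < Re s}"
      proof
        fix z assume "z \<in> cball s (1 / 4)"
        hence "Re s - Re z \<le> 1 / 4"
          using complex_Re_le_cmod[of "s - z"] by (simp add: dist_norm)
        thus "z \<in> {s. 0 < Re s}" using s by simp
      qed
      show "B \<ge> 0" using D by (simp add: B_def)
      show "zeta_reg z \<noteq> 0" if "Re s \<le> Re z" for z
        using that s by (intro zeta_reg_nonzero[OF RH]) auto
      fix z assume z: "norm (z - s) = 1 / 4" "Re s < Re z"
      define d where "d = Re z - Re s"
      have "\<bar>Re (z - s)\<bar> \<le> 1 / 4" "\<bar>Im (z - s)\<bar> \<le> 1 / 4"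
        using abs_Re_le_cmod[of "z - s"] abs_Im_le_cmod[of "z - s"] z by auto
      hence d: "0 < d" "d \<le> 1 / 4" and Imz: "\<bar>Im z\<bar> \<le> \<bar>Im s\<bar> + 1 / 4"
        using z unfolding d_def minus_complex.sel by linarith+
      \<comment> \<open>The unit disc around z0 touches the vertical line through s, hence is
        zero-free, and z has distance 1 - d from its centre; z0 lies far enough right for
        \<open>zeta_reg_lower\<close>.\<close>
      define z0 where "z0 = Complex (Re s + 1) (Im z)"
      have bd: "Re s < Re w \<and> Re w < Re s + 2 \<and> \<bar>Im w\<bar> \<le> \<bar>Im s\<bar> + 5 / 4" if "w \<in> ball z0 1" for w
      proof -
        have "\<bar>Re (z0 - w)\<bar> < 1" "\<bar>Im (z0 - w)\<bar> < 1"
          using that abs_Re_le_cmod[of "z0 - w"] abs_Im_le_cmod[of "z0 - w"] by (auto simp: dist_norm)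
        thus ?thesis using Imz unfolding z0_def minus_complex.sel complex.sel by linarith
      qed
      have z0c: "c0 \<le> norm (zeta_reg z0)" using s by (intro c0(2)) (simp add: z0_def)
      have z0M: "norm (zeta_reg z0) < M" using s Imz by (intro M) (auto simp: z0_def)
      have zz0: "z - z0 = of_real (- (1 - d))" by (simp add: complex_eq_iff z0_def d_def)
      have "ln (norm (zeta_reg z)) \<ge> ln (norm (zeta_reg z0)) - 2 * (1 - d) / (1 - (1 - d)) * (ln M - ln (norm (zeta_reg z0)))"
      proof (rule borel_caratheodory_zero_free[where f = zeta_reg and \<rho> = "1 - d" and M = M])
        show "zeta_reg holomorphic_on ball z0 1"
          using bd s by (intro holomorphic_on_subset[OF zeta_reg_holomorphic]) force
        show "zeta_reg w \<noteq> 0" if "w \<in> ball z0 1" for w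
          using bd[OF that] s by (intro zeta_reg_nonzero[OF RH]) auto
        show "norm (zeta_reg w) < M" if "w \<in> ball z0 1" for w
          using bd[OF that] s by (intro M) auto
        show "norm (z - z0) \<le> 1 - d" unfolding zz0 norm_of_real using d by simp
      qed (use d in auto)
      moreover have "2 * (1 - d) / (1 - (1 - d)) * (ln M - ln (norm (zeta_reg z0))) \<le> 2 / d * D"
      proof (rule mult_mono)
        show "2 * (1 - d) / (1 - (1 - d)) \<le> 2 / d" using d by (simp add: divide_simps)
        show "ln M - ln (norm (zeta_reg z0)) \<le> D" unfolding D_def
          using z0c c0(1) by (smt (verit) ln_le_cancel_iff)
        have "ln (norm (zeta_reg z0)) \<le> ln M"
          using z0c c0(1) z0M by (smt (verit) ln_le_cancel_iff)
        thus "0 \<le> ln M - ln (norm (zeta_reg z0))" by simp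
      qed (use d in auto)
      moreover have "ln (norm (zeta_reg z0)) \<ge> ln c0"
        using z0c c0(1) by (smt (verit) ln_le_cancel_iff)
      ultimately have lb: "ln (norm (zeta_reg z)) \<ge> ln c0 - 2 / d * D" by linarith
      have "1 * D \<le> 1 / d * D" using d D by (intro mult_right_mono) (auto simp: divide_simps)
      hence "ln M \<le> ln c0 + 1 / d * D" by (simp add: D_def)
      moreover have "3 / d * D = 1 / d * D + 2 / d * D" using d by (simp add: field_simps)
      ultimately have "ln M \<le> ln (norm (zeta_reg z)) + 3 / d * D" using lb by linarith
      also have "3 / d * D = B / d" by (simp add: B_def)
      finally have "exp (ln M) \<le> exp (ln (norm (zeta_reg z)) + B / d)" by simp
      moreover have "zeta_reg z \<noteq> 0" using z s by (intro zeta_reg_nonzero[OF RH]) auto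
      ultimately have "M \<le> norm (zeta_reg z) * exp (B / d)"
        using c0 c0M by (simp add: exp_add)
      moreover have "norm (zeta_reg (2 * of_real (Re s) - cnj z)) < M"
        using d s Imz by (intro M) (auto simp: d_def)
      ultimately show "norm (zeta_reg (2 * of_real (Re s) - cnj z)) \<le> norm (zeta_reg z) * exp (B / (Re z - Re s))"
        by (simp add: d_def)
    qed auto
    have "D = ln (4 * A / c0) + 2 * ln T"
      using A(1) c0 T by (simp add: D_def M_def ln_mult ln_div ln_realpow)
    also have "\<dots> \<le> \<bar>ln (4 * A / c0)\<bar> * ln T + 2 * ln T"
    proof -
      have "1 \<le> ln T" using T exp_le by (subst ln_ge_iff) auto
      hence "\<bar>ln (4 * A / c0)\<bar> * 1 \<le> \<bar>ln (4 * A / c0)\<bar> * ln T" by (intro mult_left_mono) auto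
      thus ?thesis by linarith
    qed
    finally have "B / (1 / 4)\<^sup>2 \<le> C * ln T"
      by (simp add: B_def C_def power2_eq_square algebra_simps)
    thus "Re (deriv zeta_reg s / zeta_reg s) \<ge> - (C * ln (\<bar>Im s\<bar> + 4))"
      using ge by (simp add: T_def)
  qed
qed

text \<open>\<open>norm_logderiv_bound\<close> with \<kappa> = ln (ln T) and half-height T. The
  rectangle has width at most 3/4, so the interpolating factor costs (ln T)^(3/4), which is below K,
  a multiple of ln T, once T is large. Adding T0 to |t| makes this valid at every height.\<close>

lemma zeta_reg_logderiv_near_line:
  assumes RH: "riemann_hypothesis"
  obtains C T0 where "C \<ge> 1" "T0 \<ge> exp (exp 1)"
    "\<And>a t. 0 < a \<Longrightarrow> a \<le> 3 / 4 \<Longrightarrow>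
       norm (deriv zeta_reg (Complex (1 / 2 + a) t) / zeta_reg (Complex (1 / 2 + a) t)) \<le>
       2 * (C * ln (\<bar>t\<bar> + T0)) * exp (- ln (ln (\<bar>t\<bar> + T0)) * a / 4) / (1 - exp (- ln (ln (\<bar>t\<bar> + T0)) * a / 4))"
proof -
  obtain C1 where C1: "C1 \<ge> 1" "\<And>s. 1 / 2 < Re s \<Longrightarrow> Re s \<le> 5 / 4 \<Longrightarrow>
      Re (deriv zeta_reg s / zeta_reg s) \<ge> - (C1 * ln (\<bar>Im s\<bar> + 4))"
    using Re_zeta_reg_logderiv_ge[OF RH] by metis
  obtain C3 where C3: "C3 \<ge> 0" "\<And>s. Re s = 5 / 4 \<Longrightarrow> norm (deriv zeta_reg s / zeta_reg s) \<le> C3"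
    using zeta_reg_logderiv_bounded by metis
  have "\<forall>\<^sub>F T in at_top. (C3 + 1) * exp (3 / 4 * ln (ln T) + 1) \<le> 2 * ln (T::real)"
    using C3(1) by real_asymp
  moreover have "\<forall>\<^sub>F T in at_top. ln (ln T) + 1 \<le> (T::real)\<^sup>2" by real_asymp
  moreover have "\<forall>\<^sub>F T in at_top. T \<ge> exp (exp 1) + (4::real)" by (rule eventually_ge_at_top)
  ultimately have "\<forall>\<^sub>F T in at_top. (C3 + 1) * exp (3 / 4 * ln (ln T) + 1) \<le> 2 * ln (T::real) \<and>
      ln (ln T) + 1 \<le> T\<^sup>2 \<and> T \<ge> exp (exp 1) + 4" by eventually_elim auto
  then obtain T0 where T0: "\<And>T. T \<ge> T0 \<Longrightarrow> (C3 + 1) * exp (3 / 4 * ln (ln T) + 1) \<le> 2 * ln (T::real) \<and>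
      ln (ln T) + 1 \<le> T\<^sup>2 \<and> T \<ge> exp (exp 1) + 4"
    unfolding eventually_at_top_linorder by blast
  show ?thesis
  proof (rule that[of "2 * C1" T0])
    show "2 * C1 \<ge> 1" using C1(1) by simp
    show "T0 \<ge> exp (exp 1)" using T0[of T0] by simp
    fix a t :: real assume a: "0 < a" "a \<le> 3 / 4"
    define T where "T = \<bar>t\<bar> + T0"
    have T: "(C3 + 1) * exp (3 / 4 * ln (ln T) + 1) \<le> 2 * ln T" "ln (ln T) + 1 \<le> T\<^sup>2" "T \<ge> exp (exp 1) + 4"
      using T0[of T] by (auto simp: T_def)
    have T4: "T \<ge> 4" using T(3) exp_ge_zero[of "exp 1 :: real"] by linarith
    have tT: "\<bar>t\<bar> \<le> T" using T0[of T0] exp_ge_zero[of "exp 1 :: real"] unfolding T_def by linarith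
    have lT: "exp 1 \<le> ln T" using T(3) T4 by (subst ln_ge_iff) auto
    hence lT1: "ln T \<ge> 1" using exp_ge_add_one_self[of "1::real"] by linarith
    have llT: "1 \<le> ln (ln T)" using lT lT1 by (subst ln_ge_iff) auto
    \<comment> \<open>The factor 2 accounts for the height of the rectangle: |Im z| + 4 <= 2 T + 4
      <= T^2.\<close>
    define K where "K = 2 * C1 * ln T"
    define R where "R = cbox (Complex (1 / 2 + a) t - Complex (a / 2) T) (Complex (1 / 2 + a) t + Complex (3 / 4 - a) T)"
    have R: "1 / 2 + a / 2 \<le> Re z \<and> Re z \<le> 5 / 4 \<and> \<bar>Im z - t\<bar> \<le> T" if "z \<in> R" for z
      using that by (auto simp: R_def in_cbox_complex_iff)
    show "norm (deriv zeta_reg (Complex (1 / 2 + a) t) / zeta_reg (Complex (1 / 2 + a) t)) \<le>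
       2 * (2 * C1 * ln (\<bar>t\<bar> + T0)) * exp (- ln (ln (\<bar>t\<bar> + T0)) * a / 4) / (1 - exp (- ln (ln (\<bar>t\<bar> + T0)) * a / 4))"
      unfolding T_def[symmetric] K_def[symmetric]
    proof (rule norm_logderiv_bound[OF a R_def, where S = "{s. Re s > 1 / 2}" and C = C3 and g = "\<lambda>s. deriv zeta_reg s / zeta_reg s"])
      show "open {s. Re s > 1 / 2}" by (rule open_halfspace_Re_gt)
      show "R \<subseteq> {s. Re s > 1 / 2}" using R a by force
      have h: "zeta_reg holomorphic_on {s. Re s > 1 / 2}"
        by (rule holomorphic_on_subset[OF zeta_reg_holomorphic]) auto
      show "(\<lambda>s. deriv zeta_reg s / zeta_reg s) holomorphic_on {s. Re s > 1 / 2}"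
        using zeta_reg_nonzero[OF RH] by (intro holomorphic_intros h open_halfspace_Re_gt) auto
      show "K > 0" using C1(1) lT1 by (simp add: K_def)
      show "Re (deriv zeta_reg z / zeta_reg z) \<ge> - K" if "z \<in> R" for z
      proof -
        note z = R[OF that]
        have "\<bar>Im z\<bar> + 4 \<le> 2 * T + 4" using z tT by linarith
        also have "4 * T \<le> T * T" using T4 by (intro mult_right_mono) auto
        hence "2 * T + 4 \<le> T\<^sup>2" using T4 unfolding power2_eq_square by linarith
        finally have "ln (\<bar>Im z\<bar> + 4) \<le> ln (T\<^sup>2)" using T4 by (subst ln_le_cancel_iff) auto
        also have "\<dots> = 2 * ln T" using T4 by (simp add: ln_realpow)
        finally have "C1 * ln (\<bar>Im z\<bar> + 4) \<le> K" using C1(1) by (simp add: K_def)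
        thus ?thesis using C1(2)[of z] z a by force
      qed
      show "norm (deriv zeta_reg z / zeta_reg z) \<le> C3"
        if "z \<in> R" "Re z = Re (Complex (1 / 2 + a) t) + (3 / 4 - a)" for z
        using that by (intro C3(2)) simp
      show "1 \<le> ln (ln T)" by (rule llT)
      have "C3 * exp (3 / 4 * ln (ln T) + 1) \<le> (C3 + 1) * exp (3 / 4 * ln (ln T) + 1)"
        by (intro mult_right_mono) auto
      also note T(1)
      also have "2 * ln T \<le> K" using C1(1) lT1 by (simp add: K_def)
      finally show "C3 * exp (3 / 4 * ln (ln T) + 1) \<le> K" .
      show "ln (ln T) + 1 \<le> T\<^sup>2" by (rule T(2))
      show "T \<ge> 0" using T4 by simp
    qed
  qed
qed

lemma neg_ln_one_minus_exp_le:
  fixes x :: real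
  assumes "x > 0" shows "- ln (1 - exp (- x)) \<le> ln (1 + 1 / x)"
proof -
  have "1 + x \<le> exp x" by (rule exp_ge_add_one_self)
  hence "exp (- x) \<le> 1 / (1 + x)" using assms by (simp add: exp_minus field_simps)
  hence "x / (1 + x) \<le> 1 - exp (- x)" using assms by (simp add: field_simps)
  hence "ln (x / (1 + x)) \<le> ln (1 - exp (- x))"
    using assms by (subst ln_le_cancel_iff) auto
  moreover have "1 + 1 / x = (1 + x) / x" using assms by (simp add: field_simps)
  hence "ln (1 + 1 / x) = - ln (x / (1 + x))" using assms by (simp add: ln_div)
  ultimately show ?thesis by linarith
qed

text \<open>Integrates the bound for h'/h from 1/2 + a to the line Re s = 5/4, where |h| >= c0.
  Putting |h| on the larger side of a product inequality also records that it does not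
  vanish.\<close>

lemma zeta_reg_lower_near_line:
  assumes RH: "riemann_hypothesis"
  obtains C T0 where "C \<ge> 1" "T0 \<ge> exp (exp 1)"
    "\<And>a t. 0 < a \<Longrightarrow> a \<le> 3 / 4 \<Longrightarrow>
       1 \<le> norm (zeta_reg (Complex (1 / 2 + a) t)) * (C * exp (C * (ln (\<bar>t\<bar> + T0) / ln (ln (\<bar>t\<bar> + T0))) * ln (5 / a)))"
proof -
  obtain C T0 where C: "C \<ge> 1" "T0 \<ge> exp (exp 1)"
    "\<And>a t. 0 < a \<Longrightarrow> a \<le> 3 / 4 \<Longrightarrow>
       norm (deriv zeta_reg (Complex (1 / 2 + a) t) / zeta_reg (Complex (1 / 2 + a) t)) \<le>
       2 * (C * ln (\<bar>t\<bar> + T0)) * exp (- ln (ln (\<bar>t\<bar> + T0)) * a / 4) / (1 - exp (- ln (ln (\<bar>t\<bar> + T0)) * a / 4))"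
    using zeta_reg_logderiv_near_line[OF RH] by metis
  obtain c0 where c0: "c0 > 0" "\<And>s. 5 / 4 \<le> Re s \<Longrightarrow> norm (zeta_reg s) \<ge> c0"
    using zeta_reg_lower by metis
  \<comment> \<open>One constant for two purposes: 8 C in the exponent and 1 / c0 in front.\<close>
  define C' where "C' = max (8 * C) (1 / c0)"
  show ?thesis
  proof (rule that[of C' T0])
    show "C' \<ge> 1" using C(1) by (simp add: C'_def)
    show "T0 \<ge> exp (exp 1)" by (rule C(2))
    fix a t :: real assume a: "0 < a" "a \<le> 3 / 4"
    define T where "T = \<bar>t\<bar> + T0"
    have T: "T \<ge> exp (exp 1)" using C(2) by (simp add: T_def)
    have T0: "T > 0" using T exp_gt_zero[of "exp 1 :: real"] by linarith
    have lT: "exp 1 \<le> ln T" using T T0 by (subst ln_ge_iff) auto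
    hence lT1: "ln T \<ge> 1" using exp_ge_add_one_self[of "1::real"] by linarith
    define \<kappa> where "\<kappa> = ln (ln T)"
    have \<kappa>: "1 \<le> \<kappa>" unfolding \<kappa>_def using lT lT1 by (subst ln_ge_iff) auto
    define K where "K = C * ln T"
    have K: "K > 0" using C(1) lT1 by (simp add: K_def)
    define F where "F = (\<lambda>b. ln (norm (zeta_reg (Complex (1 / 2) t + of_real (1 * b)))))"
    \<comment> \<open>The primitive of 2 K q / (1 - q) with q = exp (- \<kappa> b / 4); the
      integration becomes monotonicity of F - P.\<close>
    define P where "P = (\<lambda>b. 8 * K / \<kappa> * ln (1 - exp (- \<kappa> * b / 4)))"
    have line: "Complex (1 / 2) t + of_real b = Complex (1 / 2 + b) t" for b
      by (simp add: complex_eq_iff)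
    have nz: "zeta_reg (Complex (1 / 2 + b) t) \<noteq> 0" if "b > 0" for b
      using that by (intro zeta_reg_nonzero[OF RH]) simp
    have "F a - P a \<ge> F (3 / 4) - P (3 / 4)"
    proof (rule DERIV_nonpos_imp_nonincreasing[of a "3 / 4" "\<lambda>b. F b - P b"])
      show "a \<le> 3 / 4" by (rule a)
      fix b assume b: "a \<le> b" "b \<le> 3 / 4"
      have b0: "b > 0" using a b by simp
      define q where "q = exp (- \<kappa> * b / 4)"
      have q: "0 < q" "q < 1" using b0 \<kappa> by (auto simp: q_def)
      have "(zeta_reg has_field_derivative deriv zeta_reg (Complex (1 / 2 + b) t)) (at (Complex (1 / 2 + b) t))"
        by (rule holomorphic_derivI[OF zeta_reg_holomorphic open_halfspace_Re_gt]) (use b0 in simp)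
      hence F': "(F has_real_derivative 1 * Re (deriv zeta_reg (Complex (1 / 2 + b) t) / zeta_reg (Complex (1 / 2 + b) t))) (at b)"
        unfolding F_def using has_real_derivative_ln_norm[of zeta_reg "deriv zeta_reg (Complex (1 / 2 + b) t)" "Complex (1 / 2) t" 1 b]
          nz[OF b0] by (simp add: line)
      have P': "(P has_real_derivative 2 * K * q / (1 - q)) (at b)"
      proof -
        have "((\<lambda>b. ln (1 - exp (- \<kappa> * b / 4))) has_real_derivative \<kappa> / 4 * q / (1 - q)) (at b)"
          using q unfolding q_def by (auto intro!: derivative_eq_intros simp: mult_ac)
        moreover have eq: "8 * K / \<kappa> * (\<kappa> / 4 * q / (1 - q)) = 2 * K * q / (1 - q)"
          using \<kappa> q by (simp add: divide_simps)
        ultimately show ?thesis unfolding P_def eq[symmetric] by (intro DERIV_cmult)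
      qed
      have "Re (deriv zeta_reg (Complex (1 / 2 + b) t) / zeta_reg (Complex (1 / 2 + b) t)) \<le> 2 * K * q / (1 - q)"
        using C(3)[OF b0 b(2), of t] complex_Re_le_cmod order_trans
        unfolding q_def K_def \<kappa>_def T_def by blast
      thus "\<exists>y. ((\<lambda>b. F b - P b) has_real_derivative y) (at b) \<and> y \<le> 0"
        using DERIV_diff[OF F' P'] by (intro exI conjI) auto
    qed
    moreover have "P (3 / 4) \<le> 0"
    proof -
      have "ln (1 - exp (- \<kappa> * (3 / 4) / 4)) \<le> 0" using \<kappa> by (subst ln_le_zero_iff) auto
      thus ?thesis unfolding P_def using K \<kappa> by (intro mult_nonneg_nonpos) auto
    qed
    moreover have "F (3 / 4) \<ge> ln c0"
    proof -
      have "norm (zeta_reg (Complex (1 / 2 + 3 / 4) t)) \<ge> c0" by (intro c0(2)) simp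
      thus ?thesis unfolding F_def using c0(1) line[of "3 / 4"]
        by (simp, smt (verit) ln_le_cancel_iff)
    qed
    moreover have "- P a \<le> 8 * K / \<kappa> * ln (5 / a)"
    proof -
      have "- ln (1 - exp (- (\<kappa> * a / 4))) \<le> ln (1 + 1 / (\<kappa> * a / 4))"
        using a \<kappa> by (intro neg_ln_one_minus_exp_le) auto
      \<comment> \<open>Since \<kappa> >= 1 and a <= 1, the argument is at most 1/a + 4/a.\<close>
      also have "\<dots> \<le> ln (5 / a)"
      proof (subst ln_le_cancel_iff)
        have "a \<le> \<kappa> * a" using a \<kappa> by simp
        hence "4 / (\<kappa> * a) \<le> 4 / a" using a \<kappa> by (intro divide_left_mono) auto
        moreover have "1 \<le> 1 / a" using a by (simp add: field_simps)
        ultimately show "1 + 1 / (\<kappa> * a / 4) \<le> 5 / a" by simp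
      qed (use a \<kappa> in \<open>auto intro!: add_pos_pos\<close>)
      finally have "8 * K / \<kappa> * (- ln (1 - exp (- (\<kappa> * a / 4)))) \<le> 8 * K / \<kappa> * ln (5 / a)"
        using K \<kappa> by (intro mult_left_mono) auto
      thus ?thesis by (simp add: P_def)
    qed
    ultimately have "ln c0 \<le> F a + 8 * K / \<kappa> * ln (5 / a)" by linarith
    hence "exp (ln c0) \<le> exp (F a + 8 * K / \<kappa> * ln (5 / a))" by simp
    hence "c0 \<le> norm (zeta_reg (Complex (1 / 2 + a) t)) * exp (8 * K / \<kappa> * ln (5 / a))"
      using c0(1) nz[OF a(1)] unfolding exp_add by (simp add: F_def line)
    also have "\<dots> \<le> norm (zeta_reg (Complex (1 / 2 + a) t)) * exp (C' * (ln T / \<kappa>) * ln (5 / a))"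
    proof -
      have "8 * C * (ln T / \<kappa> * ln (5 / a)) \<le> C' * (ln T / \<kappa> * ln (5 / a))"
        using lT1 \<kappa> a by (intro mult_right_mono) (auto simp: C'_def)
      hence "8 * K / \<kappa> * ln (5 / a) \<le> C' * (ln T / \<kappa>) * ln (5 / a)" by (simp add: K_def mult_ac)
      thus ?thesis by (intro mult_left_mono) auto
    qed
    finally have "1 / c0 * c0 \<le> C' * (norm (zeta_reg (Complex (1 / 2 + a) t)) * exp (C' * (ln T / \<kappa>) * ln (5 / a)))"
      using c0(1) by (intro mult_mono) (auto simp: C'_def le_max_iff_disj)
    thus "1 \<le> norm (zeta_reg (Complex (1 / 2 + a) t)) * (C' * exp (C' * (ln (\<bar>t\<bar> + T0) / ln (ln (\<bar>t\<bar> + T0))) * ln (5 / a)))"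
      using c0(1) by (simp add: T_def \<kappa>_def mult_ac)
  qed
qed

subsection \<open>Perron's formula\<close>

definition vline :: "real \<Rightarrow> real \<Rightarrow> real \<Rightarrow> complex" where
  "vline c R = linepath (Complex c (- R)) (Complex c R)"

definition rect_sides :: "real \<Rightarrow> real \<Rightarrow> real \<Rightarrow> complex set" where
  "rect_sides a b R = {z. a \<le> Re z \<and> Re z \<le> b \<and> \<bar>Im z\<bar> \<le> R \<and> (Re z = a \<or> Re z = b \<or> \<bar>Im z\<bar> = R)}"

lemma path_image_rect_sides:
  assumes "a \<le> b" "0 \<le> R"
  shows "path_image (rectpath (Complex a (- R)) (Complex b R)) = rect_sides a b R"
proof -
  have *: "\<bar>x\<bar> \<le> R \<longleftrightarrow> - R \<le> x \<and> x \<le> R" "\<bar>x\<bar> = R \<longleftrightarrow> x = - R \<or> x = R" for x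
    using assms by auto
  show ?thesis
    using assms unfolding rect_sides_def * by (subst path_image_rectpath) auto
qed

lemma contour_integral_rect_sides:
  assumes ab: "a \<le> b" and R: "0 \<le> R" and cont: "continuous_on (rect_sides a b R) f"
  shows "contour_integral (rectpath (Complex a (- R)) (Complex b R)) f =
           contour_integral (linepath (Complex a (- R)) (Complex b (- R))) f
         + contour_integral (vline b R) f
         - contour_integral (linepath (Complex a R) (Complex b R)) f
         - contour_integral (vline a R) f"
proof -
  have sub: "closed_segment (Complex a (- R)) (Complex b (- R)) \<subseteq> rect_sides a b R"
    "closed_segment (Complex b (- R)) (Complex b R) \<subseteq> rect_sides a b R"
    "closed_segment (Complex a R) (Complex b R) \<subseteq> rect_sides a b R"
    "closed_segment (Complex a (- R)) (Complex a R) \<subseteq> rect_sides a b R"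
    using ab R by (auto simp: closed_segment_same_Re closed_segment_same_Im closed_segment_eq_real_ivl rect_sides_def)
  have c: "continuous_on (closed_segment (Complex a (- R)) (Complex b (- R))) f"
    "continuous_on (closed_segment (Complex b (- R)) (Complex b R)) f"
    "continuous_on (closed_segment (Complex a R) (Complex b R)) f"
    "continuous_on (closed_segment (Complex a (- R)) (Complex a R)) f"
    using sub cont continuous_on_subset by blast+
  have c': "continuous_on (closed_segment (Complex b R) (Complex a R)) f"
    "continuous_on (closed_segment (Complex a R) (Complex a (- R))) f"
    using c(3,4) by (simp_all add: closed_segment_commute)
  note i = c(1,2) c'
  have "contour_integral (rectpath (Complex a (- R)) (Complex b R)) f =
           contour_integral (linepath (Complex a (- R)) (Complex b (- R))) f
         + (contour_integral (linepath (Complex b (- R)) (Complex b R)) f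
         + (contour_integral (linepath (Complex b R) (Complex a R)) f
         + contour_integral (linepath (Complex a R) (Complex a (- R))) f))"
    using i[THEN contour_integrable_continuous_linepath]
    by (simp add: rectpath_def Let_def)
  thus ?thesis
    using contour_integral_reverse_linepath[OF c(3)] contour_integral_reverse_linepath[OF c(4)]
    by (simp add: vline_def)
qed

lemma norm_contour_integral_hline_le:
  assumes ab: "a \<le> b" and cont: "continuous_on {z. Im z = y \<and> a \<le> Re z \<and> Re z \<le> b} f"
    and B: "\<And>z. Im z = y \<Longrightarrow> a \<le> Re z \<Longrightarrow> Re z \<le> b \<Longrightarrow> norm (f z) \<le> B"
  shows "norm (contour_integral (linepath (Complex a y) (Complex b y)) f) \<le> B * (b - a)"
proof -
  have seg: "closed_segment (Complex a y) (Complex b y) = {z. Im z = y \<and> a \<le> Re z \<and> Re z \<le> b}"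
    using ab by (auto simp: closed_segment_same_Im closed_segment_eq_real_ivl)
  have B0: "0 \<le> B" using B[of "Complex a y"] ab by (auto intro: order_trans[OF norm_ge_zero])
  have "norm (contour_integral (linepath (Complex a y) (Complex b y)) f) \<le> B * norm (Complex b y - Complex a y)"
    using cont B B0 seg by (intro contour_integral_bound_linepath contour_integrable_continuous_linepath) auto
  also have "norm (Complex b y - Complex a y) = b - a" using ab by (simp add: cmod_def)
  finally show ?thesis .
qed

lemma norm_contour_integral_vline_le:
  assumes R: "0 \<le> R" and cont: "continuous_on {z. Re z = c \<and> \<bar>Im z\<bar> \<le> R} f"
    and B: "\<And>z. Re z = c \<Longrightarrow> \<bar>Im z\<bar> \<le> R \<Longrightarrow> norm (f z) \<le> B"
  shows "norm (contour_integral (vline c R) f) \<le> B * (2 * R)"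
proof -
  have seg: "closed_segment (Complex c (- R)) (Complex c R) = {z. Re z = c \<and> \<bar>Im z\<bar> \<le> R}"
    using R by (auto simp: closed_segment_same_Re closed_segment_eq_real_ivl)
  have B0: "0 \<le> B" using B[of "Complex c 0"] R by (auto intro: order_trans[OF norm_ge_zero])
  have "norm (contour_integral (vline c R) f) \<le> B * norm (Complex c R - Complex c (- R))"
    unfolding vline_def
    using cont B B0 seg by (intro contour_integral_bound_linepath contour_integrable_continuous_linepath) auto
  also have "norm (Complex c R - Complex c (- R)) = 2 * R" using R by (simp add: cmod_def real_sqrt_mult)
  finally show ?thesis .
qed

text \<open>Telescoping: (k + 1) / (s (s + 1) ... (s + k + 1)) is the difference of the products of
  length k + 1 starting at s and at s + 1; Pascal's rule combines the coefficients. With it,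
  Cauchy's formula for simple poles evaluates the Perron kernel.\<close>

lemma partial_fractions_pochhammer:
  fixes s :: "'a :: field_char_0"
  assumes "\<And>j. j \<le> k \<Longrightarrow> s + of_nat j \<noteq> 0"
  shows "1 / pochhammer s (Suc k) = (\<Sum>m\<le>k. (- 1) ^ m * of_nat (k choose m) / fact k / (s + of_nat m))"
  using assms
proof (induction k arbitrary: s)
  case 0
  thus ?case by simp
next
  case (Suc k)
  define g where "g = (\<lambda>m::nat. 1 / (s + of_nat m))"
  have IH1: "1 / pochhammer s (Suc k) = (\<Sum>m\<le>k. (- 1) ^ m * of_nat (k choose m) * g m) / fact k"
    using Suc.IH[of s] Suc.prems by (simp add: g_def sum_divide_distrib mult.commute)
  have "s + 1 + of_nat j \<noteq> 0" if "j \<le> k" for j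
    using Suc.prems[of "Suc j"] that by (simp add: add_ac)
  from Suc.IH[OF this] have IH2: "1 / pochhammer (s + 1) (Suc k) = (\<Sum>m\<le>k. (- 1) ^ m * of_nat (k choose m) * g (Suc m)) / fact k"
    by (simp add: g_def sum_divide_distrib add_ac mult.commute)
  have nz: "s \<noteq> 0" "s + of_nat (Suc k) \<noteq> 0" "pochhammer (s + 1) k \<noteq> 0"
  proof -
    show "s \<noteq> 0" "s + of_nat (Suc k) \<noteq> 0" using Suc.prems[of 0] Suc.prems[of "Suc k"] by simp_all
    show "pochhammer (s + 1) k \<noteq> 0"
    proof
      assume "pochhammer (s + 1) k = 0"
      then obtain j where "j < k" "s + 1 = - of_nat j" by (auto simp: pochhammer_eq_0_iff)
      moreover have "s + of_nat (Suc j) = (s + 1) + of_nat j" by (simp add: add_ac)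
      ultimately show False using Suc.prems[of "Suc j"] by simp
    qed
  qed
  define p where "p = pochhammer (s + 1) k"
  have p1: "pochhammer s (Suc k) = s * p" by (simp add: pochhammer_rec p_def)
  have p2: "pochhammer (s + 1) (Suc k) = p * (s + of_nat (Suc k))"
    by (simp add: pochhammer_Suc p_def add_ac)
  have p3: "pochhammer s (Suc (Suc k)) = s * p * (s + of_nat (Suc k))"
    by (simp add: pochhammer_rec[of s "Suc k"] p2 mult_ac del: of_nat_Suc)
  have k1: "(of_nat (Suc k) :: 'a) \<noteq> 0" by (simp del: of_nat_Suc)
  have "1 / pochhammer s (Suc (Suc k)) = (1 / pochhammer s (Suc k) - 1 / pochhammer (s + 1) (Suc k)) / of_nat (Suc k)"
    unfolding p1 p2 p3 using nz[folded p_def] k1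
    by (simp add: divide_simps del: of_nat_Suc)
  also have "\<dots> = ((\<Sum>m\<le>k. (- 1) ^ m * of_nat (k choose m) * g m)
        - (\<Sum>m\<le>k. (- 1) ^ m * of_nat (k choose m) * g (Suc m))) / fact (Suc k)"
    unfolding IH1 IH2 by (simp add: diff_divide_distrib divide_divide_eq_left mult.commute)
  also have "(\<Sum>m\<le>k. (- 1) ^ m * of_nat (k choose m) * g m)
        - (\<Sum>m\<le>k. (- 1) ^ m * of_nat (k choose m) * g (Suc m)) =
        (\<Sum>m\<le>Suc k. (- 1) ^ m * of_nat (Suc k choose m) * g m)"
  proof -
    have "(\<Sum>m\<le>k. (- 1) ^ m * of_nat (k choose m) * g m) = (\<Sum>m\<le>Suc k. (- 1) ^ m * of_nat (k choose m) * g m)"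
      by simp
    also have "\<dots> = g 0 + (\<Sum>m\<le>k. (- 1) ^ Suc m * of_nat (k choose Suc m) * g (Suc m))"
      by (subst sum.atMost_Suc_shift) simp
    finally have 1: "(\<Sum>m\<le>k. (- 1) ^ m * of_nat (k choose m) * g m) =
        g 0 + (\<Sum>m\<le>k. (- 1) ^ Suc m * of_nat (k choose Suc m) * g (Suc m))" .
    have "(\<Sum>m\<le>Suc k. (- 1) ^ m * of_nat (Suc k choose m) * g m) =
        g 0 + (\<Sum>m\<le>k. (- 1) ^ Suc m * of_nat (Suc k choose Suc m) * g (Suc m))"
      by (subst sum.atMost_Suc_shift) simp
    also have "(\<Sum>m\<le>k. (- 1) ^ Suc m * of_nat (Suc k choose Suc m) * g (Suc m)) =
        (\<Sum>m\<le>k. (- 1) ^ Suc m * of_nat (k choose Suc m) * g (Suc m)) - (\<Sum>m\<le>k. (- 1) ^ m * of_nat (k choose m) * g (Suc m))"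
      unfolding sum_subtractf[symmetric]
      by (intro sum.cong) (simp_all add: algebra_simps)
    finally show ?thesis using 1 by simp
  qed
  finally show ?case unfolding sum_divide_distrib
    by (rule trans) (intro sum.cong, simp_all add: g_def mult.commute del: fact_Suc)
qed

lemma norm_pochhammer_ge:
  fixes z :: complex
  assumes "R \<ge> 0" "\<And>j. j \<le> k \<Longrightarrow> norm (z + of_nat j) \<ge> R"
  shows "norm (pochhammer z (Suc k)) \<ge> R ^ Suc k"
proof -
  have "(\<Prod>i\<in>{0..<Suc k}. R) \<le> (\<Prod>i\<in>{0..<Suc k}. norm (z + of_nat i))"
    using assms by (intro prod_mono) auto
  thus ?thesis by (simp only: pochhammer_prod prod_norm[symmetric] prod_constant card_atLeastLessThan) simp
qed

definition perron_kernel :: "nat \<Rightarrow> real \<Rightarrow> complex \<Rightarrow> complex" where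
  "perron_kernel k y s = of_real y powr s / pochhammer s (Suc k)"

text \<open>The condition on \<open>y powr Re z\<close> covers both directions of shifting from Re z
  = 2: left for y >= 1, right for y < 1.\<close>

lemma norm_perron_kernel_le:
  assumes y: "y > 0" and pw: "y powr Re z \<le> y\<^sup>2" and R: "R > 0" "\<And>j. j \<le> k \<Longrightarrow> norm (z + of_nat j) \<ge> R"
  shows "norm (perron_kernel k y z) \<le> y\<^sup>2 / R ^ Suc k"
proof -
  have "norm (perron_kernel k y z) = y powr Re z / norm (pochhammer z (Suc k))"
    using y by (simp add: perron_kernel_def norm_divide norm_powr_real_powr)
  also have "\<dots> \<le> y\<^sup>2 / R ^ Suc k"
    using norm_pochhammer_ge[of R k z] R pw by (intro frac_le) auto
  finally show ?thesis .
qed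

lemma perron_kernel_holomorphic:
  assumes "y > 0" "\<And>z j. z \<in> S \<Longrightarrow> j \<le> k \<Longrightarrow> z \<noteq> - of_nat j"
  shows "perron_kernel k y holomorphic_on S"
  unfolding perron_kernel_def pochhammer_prod
  using assms by (intro holomorphic_intros) (auto simp: add_eq_0_iff2)

text \<open>The contour is closed to the left around the poles 0, -1, ..., -k, whose residues add up
  to the binomial expansion of (1 - 1/y)^k / k!. The explicit factor y^2 in the error makes it
  summable over n when y = x / n.\<close>

lemma perron_ge_1:
  assumes y: "y \<ge> 1" and R: "R > 0"
  shows "norm (contour_integral (vline 2 R) (perron_kernel k y) - 2 * pi * \<i> * of_real ((1 - 1 / y) ^ k / fact k))
           \<le> y\<^sup>2 / R ^ Suc k * (4 * R + 2 * real k + 4)"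
proof -
  \<comment> \<open>Keeps the left edge at distance at least R from every pole.\<close>
  define a where "a = - R - real k"
  define f where "f = perron_kernel k y"
  define \<gamma> where "\<gamma> = rectpath (Complex a (- R)) (Complex 2 R)"
  have a2: "a \<le> 2" using R by (simp add: a_def)
  have im: "path_image \<gamma> = rect_sides a 2 R"
    unfolding \<gamma>_def using a2 R by (intro path_image_rect_sides) auto
  have nz: "z + of_nat j \<noteq> 0" if "z \<in> rect_sides a 2 R" "j \<le> k" for z j
  proof
    assume "z + of_nat j = 0"
    hence "Re z = - real j" "Im z = 0" by (auto simp: complex_eq_iff)
    thus False using that R by (auto simp: rect_sides_def a_def)
  qed
  have cont: "continuous_on (rect_sides a 2 R) f"
    unfolding f_def using y nz
    by (intro holomorphic_on_imp_continuous_on perron_kernel_holomorphic) (auto simp: add_eq_0_iff2)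
  have res: "((\<lambda>s. of_real y powr s / (s + of_nat m)) has_contour_integral 2 * pi * \<i> * of_real ((1 / y) ^ m)) \<gamma>"
    if m: "m \<le> k" for m
  proof -
    have w: "winding_number \<gamma> (- of_nat m) = 1"
      unfolding \<gamma>_def using R m by (intro winding_number_rectpath) (auto simp: in_box_complex_iff a_def)
    have "((\<lambda>s. of_real y powr s / (s - (- of_nat m))) has_contour_integral
            2 * pi * \<i> * winding_number \<gamma> (- of_nat m) * of_real y powr (- of_nat m)) \<gamma>"
    proof (rule Cauchy_integral_formula_convex_simple[of UNIV])
      show "(\<lambda>s. of_real y powr s) holomorphic_on UNIV" using y by (intro holomorphic_intros) auto
      show "path_image \<gamma> \<subseteq> UNIV - {- of_nat m}" using nz[OF _ m] unfolding im by force
    qed (auto simp: \<gamma>_def)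
    moreover have "of_real y powr (- of_nat m :: complex) = of_real ((1 / y) ^ m)"
      using y by (simp add: powr_minus powr_nat' power_one_over field_simps)
    ultimately show ?thesis by (simp add: w)
  qed
  define c where "c = (\<lambda>m. (- 1) ^ m * of_nat (k choose m) / fact k :: complex)"
  have "((\<lambda>s. \<Sum>m\<le>k. c m * (of_real y powr s / (s + of_nat m))) has_contour_integral
          (\<Sum>m\<le>k. c m * (2 * pi * \<i> * of_real ((1 / y) ^ m)))) \<gamma>"
    by (intro has_contour_integral_sum has_contour_integral_lmul res) auto
  hence "(f has_contour_integral (\<Sum>m\<le>k. c m * (2 * pi * \<i> * of_real ((1 / y) ^ m)))) \<gamma>"
  proof (rule has_contour_integral_eq)
    fix s assume "s \<in> path_image \<gamma>"
    hence "1 / pochhammer s (Suc k) = (\<Sum>m\<le>k. c m / (s + of_nat m))"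
      unfolding c_def using nz im by (intro partial_fractions_pochhammer) auto
    hence "f s = of_real y powr s * (\<Sum>m\<le>k. c m / (s + of_nat m))"
      by (simp add: f_def perron_kernel_def divide_inverse)
    thus "(\<Sum>m\<le>k. c m * (of_real y powr s / (s + of_nat m))) = f s"
      by (simp add: sum_distrib_left mult_ac)
  qed
  moreover have "(\<Sum>m\<le>k. c m * (2 * pi * \<i> * of_real ((1 / y) ^ m))) = 2 * pi * \<i> * of_real ((1 - 1 / y) ^ k / fact k)"
  proof -
    have "(- 1 / y + 1) ^ k = (\<Sum>m\<le>k. of_nat (k choose m) * (- 1 / y) ^ m * 1 ^ (k - m))"
      by (rule binomial_ring)
    hence "of_real ((1 - 1 / y) ^ k) = (\<Sum>m\<le>k. of_nat (k choose m) * (- 1) ^ m * of_real ((1 / y) ^ m) :: complex)"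
      by (simp add: power_minus[of "1 / y"] mult_ac)
    thus ?thesis by (simp add: c_def sum_distrib_left sum_divide_distrib mult_ac)
  qed
  ultimately have tot: "contour_integral \<gamma> f = 2 * pi * \<i> * of_real ((1 - 1 / y) ^ k / fact k)"
    using contour_integral_unique by metis
  define B where "B = y\<^sup>2 / R ^ Suc k"
  have bd: "norm (f z) \<le> B" if z: "Re z \<le> 2" "Re z = a \<or> \<bar>Im z\<bar> = R" for z
    unfolding f_def B_def
  proof (rule norm_perron_kernel_le)
    have "y powr Re z \<le> y powr 2" using y z by (intro powr_mono) auto
    thus "y powr Re z \<le> y\<^sup>2" using y by simp
    fix j assume j: "j \<le> k"
    show "R \<le> norm (z + of_nat j)"
    proof (cases "\<bar>Im z\<bar> = R")
      case True
      thus ?thesis using abs_Im_le_cmod[of "z + of_nat j"] by simp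
    next
      case False
      hence "Re z = a" using z by simp
      thus ?thesis using abs_Re_le_cmod[of "z + of_nat j"] j R by (simp add: a_def)
    qed
  qed (use y R in auto)
  have "norm (contour_integral (linepath (Complex a (- R)) (Complex 2 (- R))) f) \<le> B * (2 - a)"
    using R a2 by (intro norm_contour_integral_hline_le bd continuous_on_subset[OF cont]) (auto simp: rect_sides_def)
  moreover have "norm (contour_integral (linepath (Complex a R) (Complex 2 R)) f) \<le> B * (2 - a)"
    using R a2 by (intro norm_contour_integral_hline_le bd continuous_on_subset[OF cont]) (auto simp: rect_sides_def)
  moreover have "norm (contour_integral (vline a R) f) \<le> B * (2 * R)"
    using R a2 by (intro norm_contour_integral_vline_le bd continuous_on_subset[OF cont]) (auto simp: rect_sides_def)
  moreover have "contour_integral (vline 2 R) f - contour_integral \<gamma> f =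
      contour_integral (linepath (Complex a R) (Complex 2 R)) f + contour_integral (vline a R) f
       - contour_integral (linepath (Complex a (- R)) (Complex 2 (- R))) f"
    unfolding \<gamma>_def using a2 R by (subst contour_integral_rect_sides[OF _ _ cont]) auto
  ultimately have "norm (contour_integral (vline 2 R) f - contour_integral \<gamma> f) \<le> B * (2 - a) + B * (2 * R) + B * (2 - a)"
    by (smt (verit) norm_triangle_ineq norm_triangle_ineq4)
  also have "\<dots> = B * (4 * R + 2 * real k + 4)" by (simp add: a_def algebra_simps)
  finally show ?thesis unfolding tot by (simp add: B_def f_def)
qed

text \<open>The contour is closed to the right, where there are no poles. The error is stated as in
  \<open>perron_ge_1\<close>, so that one formula serves all n.\<close>

lemma perron_lt_1:
  assumes y: "0 < y" "y < 1" and R: "R > 0"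
  shows "norm (contour_integral (vline 2 R) (perron_kernel k y))
           \<le> y\<^sup>2 / R ^ Suc k * (4 * R + 2 * real k + 4)"
proof -
  define f where "f = perron_kernel k y"
  define \<gamma> where "\<gamma> = rectpath (Complex 2 (- R)) (Complex (2 + R) R)"
  have b2: "2 \<le> 2 + R" using R by simp
  have im: "path_image \<gamma> = rect_sides 2 (2 + R) R"
    unfolding \<gamma>_def using b2 R by (intro path_image_rect_sides) auto
  have sub: "rect_sides 2 (2 + R) R \<subseteq> {z. Re z > 0}" by (auto simp: rect_sides_def)
  have holo: "f holomorphic_on {z. Re z > 0}"
    unfolding f_def using y by (intro perron_kernel_holomorphic) auto
  have cont: "continuous_on (rect_sides 2 (2 + R) R) f"
    by (rule continuous_on_subset[OF holomorphic_on_imp_continuous_on[OF holo] sub])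
  have "(f has_contour_integral 0) \<gamma>"
    using im sub by (intro Cauchy_theorem_convex_simple[OF holo convex_halfspace_Re_gt]) (auto simp: \<gamma>_def)
  hence tot: "contour_integral \<gamma> f = 0" by (rule contour_integral_unique)
  define B where "B = y\<^sup>2 / R ^ Suc k"
  have B0: "B \<ge> 0" using R by (simp add: B_def)
  have bd: "norm (f z) \<le> B" if z: "2 \<le> Re z" "Re z = 2 + R \<or> \<bar>Im z\<bar> = R" for z
    unfolding f_def B_def
  proof (rule norm_perron_kernel_le)
    have "y powr Re z \<le> y powr 2" using y z by (intro powr_mono') auto
    thus "y powr Re z \<le> y\<^sup>2" using y by simp
    fix j
    show "R \<le> norm (z + of_nat j)"
    proof (cases "\<bar>Im z\<bar> = R")
      case True
      thus ?thesis using abs_Im_le_cmod[of "z + of_nat j"] by simp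
    next
      case False
      hence "Re z = 2 + R" using z by simp
      thus ?thesis using abs_Re_le_cmod[of "z + of_nat j"] R by simp
    qed
  qed (use y R in auto)
  have "norm (contour_integral (linepath (Complex 2 (- R)) (Complex (2 + R) (- R))) f) \<le> B * (2 + R - 2)"
    using R by (intro norm_contour_integral_hline_le bd continuous_on_subset[OF cont]) (auto simp: rect_sides_def)
  moreover have "norm (contour_integral (linepath (Complex 2 R) (Complex (2 + R) R)) f) \<le> B * (2 + R - 2)"
    using R by (intro norm_contour_integral_hline_le bd continuous_on_subset[OF cont]) (auto simp: rect_sides_def)
  moreover have "norm (contour_integral (vline (2 + R) R) f) \<le> B * (2 * R)"
    using R by (intro norm_contour_integral_vline_le bd continuous_on_subset[OF cont]) (auto simp: rect_sides_def)
  moreover have "contour_integral (vline 2 R) f =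
      contour_integral (linepath (Complex 2 (- R)) (Complex (2 + R) (- R))) f + contour_integral (vline (2 + R) R) f
       - contour_integral (linepath (Complex 2 R) (Complex (2 + R) R)) f"
    using contour_integral_rect_sides[OF b2 _ cont] R tot by (simp add: \<gamma>_def)
  ultimately have "norm (contour_integral (vline 2 R) f) \<le> B * (2 + R - 2) + B * (2 * R) + B * (2 + R - 2)"
    by (smt (verit) norm_triangle_ineq norm_triangle_ineq4)
  also have "\<dots> \<le> B * (4 * R + 2 * real k + 4)"
    using mult_nonneg_nonneg[OF B0, of "2 * real k + 4"] by (simp add: algebra_simps)
  finally show ?thesis by (simp add: B_def f_def)
qed

definition perron_weight :: "nat \<Rightarrow> real \<Rightarrow> real" where
  "perron_weight k y = (if y \<ge> 1 then (1 - 1 / y) ^ k / fact k else 0)"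

lemma norm_perron_integral_diff_le:
  assumes y: "0 < y" and R: "R > 0"
  shows "norm (contour_integral (vline 2 R) (perron_kernel k y) - 2 * pi * \<i> * of_real (perron_weight k y))
           \<le> y\<^sup>2 / R ^ Suc k * (4 * R + 2 * real k + 4)"
  using perron_ge_1[of y R k] perron_lt_1[of y R k] y R
  by (cases "y \<ge> 1") (simp_all add: perron_weight_def)

lemma riesz_weight_of_nat:
  assumes "k \<ge> 1" "u \<le> 1"
  shows "riesz_weight (real k) u = (1 - u) ^ k"
  using assms by (cases "u = 1") (auto simp: riesz_weight_def powr_realpow)

lemma perron_weight_sums_riesz_M:
  assumes k: "k \<ge> 1" and x: "x > 0"
  shows "(\<lambda>n. of_int (moebius_mu (Suc n)) * perron_weight k (x / real (Suc n))) sums riesz_M (real k) x"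
proof -
  define N where "N = {n. real (Suc n) \<le> x}"
  have finN: "finite N"
    by (rule finite_subset[of _ "{..nat \<lceil>x\<rceil>}"]) (auto simp: N_def, linarith)
  have "(\<lambda>n. of_int (moebius_mu (Suc n)) * perron_weight k (x / real (Suc n))) sums
          (\<Sum>n\<in>N. of_int (moebius_mu (Suc n)) * perron_weight k (x / real (Suc n)))"
    by (rule sums_finite[OF finN]) (auto simp: N_def perron_weight_def field_simps)
  also have "(\<Sum>n\<in>N. of_int (moebius_mu (Suc n)) * perron_weight k (x / real (Suc n))) =
      (\<Sum>n | 1 \<le> n \<and> real n \<le> x. of_int (moebius_mu n) * perron_weight k (x / real n))"
    by (rule sum.reindex_bij_witness[of _ "\<lambda>n. n - 1" Suc]) (auto simp: N_def)
  also have "\<dots> = (\<Sum>n | 1 \<le> n \<and> real n \<le> x. (1 / Gamma (real k + 1)) * (of_int (moebius_mu n) * riesz_weight (real k) (real n / x)))"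
  proof (rule sum.cong)
    fix n assume n: "n \<in> {n. 1 \<le> n \<and> real n \<le> x}"
    have "riesz_weight (real k) (real n / x) = (1 - real n / x) ^ k"
      using n k x by (intro riesz_weight_of_nat) auto
    moreover have "Gamma (real k + 1) = fact k" using Gamma_fact[of k, where ?'a = real] by (simp add: add.commute)
    ultimately show "of_int (moebius_mu n) * perron_weight k (x / real n) =
       (1 / Gamma (real k + 1)) * (of_int (moebius_mu n) * riesz_weight (real k) (real n / x))"
      using n by (simp add: perron_weight_def)
  qed simp
  also have "\<dots> = riesz_M (real k) x" by (simp add: riesz_M_def sum_distrib_left)
  finally show ?thesis .
qed

text \<open>The integrand of Perron's formula, with 1 / zeta written as (s - 1) / zeta_reg so that
  it is also holomorphic at s = 1.\<close>

definition riesz_integrand :: "nat \<Rightarrow> real \<Rightarrow> complex \<Rightarrow> complex" where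
  "riesz_integrand k x s = of_real x powr s * (s - 1) / (zeta_reg s * pochhammer s (Suc k))"

text \<open>On the finite segment at Re s = 2 the terms are bounded by (x / n)^2, so sum and
  integral can be exchanged. The truncation errors of the individual terms carry the same factor and
  are summable too.\<close>

lemma riesz_M_truncated_perron:
  assumes k: "k \<ge> 1" and x: "x > 0" and R: "R > 0"
  shows "norm (contour_integral (vline 2 R) (riesz_integrand k x) - 2 * pi * \<i> * of_real (riesz_M (real k) x))
           \<le> x\<^sup>2 * (\<Sum>n. 1 / (real (Suc n))\<^sup>2) * (4 * R + 2 * real k + 4) / R ^ Suc k"
proof -
  define f where "f = (\<lambda>n s. of_int (moebius_mu (Suc n)) * perron_kernel k (x / real (Suc n)) s)"
  define Q where "Q = closed_segment (Complex 2 (- R)) (Complex 2 R)"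
  have Q: "Re s = 2" if "s \<in> Q" for s
    using that R by (auto simp: Q_def closed_segment_same_Re)
  have xn: "x / real (Suc n) > 0" for n using x by simp
  have mu: "\<bar>real_of_int (moebius_mu n)\<bar> \<le> 1" for n
    using abs_moebius_mu_le[of n] by linarith
  have s2: "summable (\<lambda>n. 1 / (real (Suc n))\<^sup>2)"
    using inverse_squares_sums by (simp add: sums_iff)
  have fb: "norm (f n s) \<le> x\<^sup>2 * (1 / (real (Suc n))\<^sup>2)" if "s \<in> Q" for n s
  proof -
    have "norm (f n s) \<le> 1 * norm (perron_kernel k (x / real (Suc n)) s)"
      unfolding f_def norm_mult using mu by (intro mult_right_mono) auto
    also have "norm (perron_kernel k (x / real (Suc n)) s) \<le> (x / real (Suc n))\<^sup>2 / 1 ^ Suc k"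
    proof (rule norm_perron_kernel_le[OF xn])
      show "(x / real (Suc n)) powr Re s \<le> (x / real (Suc n))\<^sup>2"
        using Q[OF that] xn[of n] by (simp del: of_nat_Suc)
      fix j
      show "1 \<le> norm (s + of_nat j)"
        using complex_Re_le_cmod[of "s + of_nat j"] Q[OF that] by simp
    qed simp
    finally show ?thesis by (simp add: power_divide)
  qed
  have sums: "(\<lambda>n. f n s) sums riesz_integrand k x s" if "s \<in> Q" for s
  proof -
    have s: "Re s > 1 + 0" using Q[OF that] by simp
    have "(\<lambda>n. of_int (moebius_mu (Suc n)) * of_nat (Suc n) powr (- s)) sums dsum (\<lambda>n. of_int (moebius_mu n)) s"
      by (rule dsum_sums[of _ 1 0, OF _ s]) (use mu in \<open>simp add: Let_def\<close>)
    also have "dsum (\<lambda>n. of_int (moebius_mu n)) s = 1 / zeta s"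
      using dsum_moebius_mult_zeta[of s] zeta_nonzero_Re_gt_1[of s] s by (simp add: field_simps)
    finally have "(\<lambda>n. (of_real x powr s / pochhammer s (Suc k)) * (of_int (moebius_mu (Suc n)) * of_nat (Suc n) powr (- s)))
        sums ((of_real x powr s / pochhammer s (Suc k)) * (1 / zeta s))" by (rule sums_mult)
    moreover have "(of_real x powr s / pochhammer s (Suc k)) * (of_int (moebius_mu (Suc n)) * of_nat (Suc n) powr (- s)) = f n s" for n
    proof -
      have "of_real (x / real (Suc n)) powr s = of_real x powr s * of_nat (Suc n) powr (- s)"
      proof -
        have l: "ln (x / real (Suc n)) = ln x - ln (real (Suc n))" using x by (simp add: ln_div)
        have "(of_real (x / real (Suc n)) :: complex) powr s = exp (s * of_real (ln x - ln (real (Suc n))))"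
          using x xn[of n] by (simp add: powr_def Ln_of_real l[symmetric] del: of_nat_Suc of_real_divide)
        also have "\<dots> = exp (s * of_real (ln x)) * exp (- s * of_real (ln (real (Suc n))))"
          by (simp add: exp_add[symmetric] algebra_simps)
        also have "\<dots> = of_real x powr s * of_nat (Suc n) powr (- s)"
          using x by (simp add: powr_def Ln_of_real Ln_of_nat del: of_nat_Suc)
        finally show ?thesis .
      qed
      thus ?thesis by (simp add: f_def perron_kernel_def)
    qed
    moreover have "(of_real x powr s / pochhammer s (Suc k)) * (1 / zeta s) = riesz_integrand k x s"
      using s by (auto simp: riesz_integrand_def zeta_reg_def)
    ultimately show ?thesis by simp
  qed
  have pk: "continuous_on Q (perron_kernel k (x / real (Suc n)))" for n
    using xn Q by (intro holomorphic_on_imp_continuous_on perron_kernel_holomorphic) fastforce+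
  have "uniform_limit Q (\<lambda>N s. \<Sum>n<N. f n s) (\<lambda>s. suminf (\<lambda>n. f n s)) sequentially"
    by (rule Weierstrass_m_test[OF fb summable_mult[OF s2]])
  hence ul: "uniform_limit (closed_segment (Complex 2 (- R)) (Complex 2 R)) (\<lambda>N s. \<Sum>n<N. f n s) (riesz_integrand k x) sequentially"
    unfolding Q_def[symmetric] by (rule uniform_limit_cong'[THEN iffD1, rotated -1]) (use sums in \<open>auto simp: sums_iff\<close>)
  obtain J where J: "(riesz_integrand k x has_contour_integral J) (linepath (Complex 2 (- R)) (Complex 2 R))"
    "(\<lambda>n. contour_integral (linepath (Complex 2 (- R)) (Complex 2 R)) (f n)) sums J"
    by (rule contour_integral_sums_linepath[OF ul])
       (use pk in \<open>auto simp: f_def Q_def intro!: continuous_intros\<close>)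
  have "contour_integral (linepath (Complex 2 (- R)) (Complex 2 R)) (f n) =
      of_int (moebius_mu (Suc n)) * contour_integral (vline 2 R) (perron_kernel k (x / real (Suc n)))" for n
    unfolding f_def vline_def using pk[of n]
    by (intro contour_integral_lmul contour_integrable_continuous_linepath) (simp add: Q_def)
  with J(2) have S1: "(\<lambda>n. of_int (moebius_mu (Suc n)) * contour_integral (vline 2 R) (perron_kernel k (x / real (Suc n)))) sums J"
    by simp
  have "(\<lambda>n. 2 * pi * \<i> * of_real (of_int (moebius_mu (Suc n)) * perron_weight k (x / real (Suc n))))
          sums (2 * pi * \<i> * of_real (riesz_M (real k) x))"
    by (intro sums_mult sums_of_real perron_weight_sums_riesz_M k x)
  from sums_diff[OF S1 this]
  have D: "(\<lambda>n. of_int (moebius_mu (Suc n)) * (contour_integral (vline 2 R) (perron_kernel k (x / real (Suc n)))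
            - 2 * pi * \<i> * of_real (perron_weight k (x / real (Suc n)))))
          sums (J - 2 * pi * \<i> * of_real (riesz_M (real k) x))"
    by (simp add: algebra_simps)
  have E: "norm (of_int (moebius_mu (Suc n)) * (contour_integral (vline 2 R) (perron_kernel k (x / real (Suc n)))
            - 2 * pi * \<i> * of_real (perron_weight k (x / real (Suc n)))))
        \<le> (x\<^sup>2 * ((4 * R + 2 * real k + 4) / R ^ Suc k)) * (1 / (real (Suc n))\<^sup>2)" for n
  proof -
    have "norm (of_int (moebius_mu (Suc n)) * (contour_integral (vline 2 R) (perron_kernel k (x / real (Suc n)))
            - 2 * pi * \<i> * of_real (perron_weight k (x / real (Suc n))))) \<le>
        1 * norm (contour_integral (vline 2 R) (perron_kernel k (x / real (Suc n)))
            - 2 * pi * \<i> * of_real (perron_weight k (x / real (Suc n))))"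
      unfolding norm_mult using mu by (intro mult_right_mono) auto
    also have "\<dots> \<le> 1 * ((x / real (Suc n))\<^sup>2 / R ^ Suc k * (4 * R + 2 * real k + 4))"
      by (intro mult_left_mono norm_perron_integral_diff_le xn R) auto
    also have "\<dots> = (x\<^sup>2 * ((4 * R + 2 * real k + 4) / R ^ Suc k)) * (1 / (real (Suc n))\<^sup>2)"
      by (simp add: power_divide)
    finally show ?thesis .
  qed
  have "norm (J - 2 * pi * \<i> * of_real (riesz_M (real k) x)) \<le> (\<Sum>n. (x\<^sup>2 * ((4 * R + 2 * real k + 4) / R ^ Suc k)) * (1 / (real (Suc n))\<^sup>2))"
    unfolding sums_unique[OF D] by (rule norm_suminf_le[OF E summable_mult[OF s2]])
  also have "\<dots> = (x\<^sup>2 * ((4 * R + 2 * real k + 4) / R ^ Suc k)) * (\<Sum>n. 1 / (real (Suc n))\<^sup>2)"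
    by (rule suminf_mult[OF s2])
  finally show ?thesis
    using contour_integral_unique[OF J(1)] by (simp add: vline_def mult_ac)
qed

text \<open>The total mass of 1 / (1 + t^2) is pi, so the bound is uniform in R.\<close>

lemma norm_contour_integral_vline_le_pi:
  assumes R: "R > 0" and cont: "continuous_on {z. Re z = c \<and> \<bar>Im z\<bar> \<le> R} f"
    and A: "\<And>z. Re z = c \<Longrightarrow> norm (f z) \<le> A / (1 + (Im z)\<^sup>2)"
  shows "norm (contour_integral (vline c R) f) \<le> A * pi"
proof -
  have seg: "closed_segment (Complex c (- R)) (Complex c R) = {z. Re z = c \<and> \<bar>Im z\<bar> \<le> R}"
    using R by (auto simp: closed_segment_same_Re closed_segment_eq_real_ivl)
  have A0: "A \<ge> 0" using A[of "Complex c 0"] by (auto intro: order_trans[OF norm_ge_zero])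
  define I where "I = contour_integral (vline c R) f"
  have "(f has_contour_integral I) (vline c R)"
    unfolding I_def vline_def using cont seg
    by (intro has_contour_integral_integral contour_integrable_continuous_linepath) simp
  hence int: "((\<lambda>x. f (Complex c x)) has_integral (- \<i> * I)) {- R..R}"
    unfolding vline_def using R by (subst (asm) has_contour_integral_linepath_same_Re_iff) auto
  have "((\<lambda>t. A / (1 + t\<^sup>2)) has_integral (A * arctan R - A * arctan (- R))) {- R..R}"
  proof (rule fundamental_theorem_of_calculus)
    show "((\<lambda>t. A * arctan t) has_vector_derivative A / (1 + x\<^sup>2)) (at x within {- R..R})" for x
      unfolding has_real_derivative_iff_has_vector_derivative[symmetric]
      by (auto intro!: derivative_eq_intros simp: divide_inverse)
  qed (use R in auto)
  hence int': "(\<lambda>t. A / (1 + t\<^sup>2)) integrable_on {- R..R}"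
    and val: "integral {- R..R} (\<lambda>t. A / (1 + t\<^sup>2)) = A * arctan R - A * arctan (- R)"
    by (auto simp: has_integral_integrable_integral)
  have "norm (integral {- R..R} (\<lambda>x. f (Complex c x))) \<le> integral {- R..R} (\<lambda>t. A / (1 + t\<^sup>2))"
  proof (rule integral_norm_bound_integral[OF _ int'])
    show "norm (f (Complex c t)) \<le> A / (1 + t\<^sup>2)" for t using A[of "Complex c t"] by simp
  qed (use int in \<open>auto simp: has_integral_integrable_integral\<close>)
  hence "norm (- \<i> * I) \<le> A * arctan R - A * arctan (- R)"
    using int by (simp add: has_integral_integrable_integral val)
  also have "\<dots> = A * (2 * arctan R)" by (simp add: arctan_minus)
  also have "\<dots> \<le> A * pi" using arctan_ubound[of R] A0 by (intro mult_left_mono) auto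
  finally show ?thesis by (simp add: I_def norm_mult)
qed

text \<open>The bound A is only for the horizontal edges, which vanish as R tends to infinity, so it
  may depend on x in any way. Only the left line survives: B pi divided by 2 pi.\<close>

lemma riesz_M_bound_of_strip:
  assumes RH: "riemann_hypothesis" and k: "k \<ge> 1" and x: "x > 0" and \<sigma>: "1 / 2 < \<sigma>" "\<sigma> < 2"
    and strip: "\<And>s. \<sigma> \<le> Re s \<Longrightarrow> Re s \<le> 2 \<Longrightarrow> norm (riesz_integrand k x s) \<le> A / (1 + (Im s)\<^sup>2)"
    and left: "\<And>s. Re s = \<sigma> \<Longrightarrow> norm (riesz_integrand k x s) \<le> B / (1 + (Im s)\<^sup>2)"
  shows "\<bar>riesz_M (real k) x\<bar> \<le> B / 2"
proof -
  define F where "F = riesz_integrand k x"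
  have "pochhammer s (Suc k) \<noteq> 0" if "Re s > 1 / 2" for s
    using that by (auto simp: pochhammer_eq_0_iff)
  hence holo: "F holomorphic_on {s. Re s > 1 / 2}"
    unfolding F_def riesz_integrand_def using x zeta_reg_nonzero[OF RH]
    by (intro holomorphic_intros holomorphic_on_subset[OF zeta_reg_holomorphic])
       (auto simp: pochhammer_prod intro!: holomorphic_intros)
  note contF = holomorphic_on_imp_continuous_on[OF holo]
  define Z where "Z = (\<Sum>n. 1 / (real (Suc n))\<^sup>2)"
  define G where "G = (\<lambda>R. x\<^sup>2 * Z * (4 * R + 2 * real k + 4) / R ^ Suc k + 2 * (A / (1 + R\<^sup>2) * (2 - \<sigma>)) + B * pi)"
  have main: "2 * pi * \<bar>riesz_M (real k) x\<bar> \<le> G R" if R: "R > 0" for R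
  proof -
    define \<gamma> where "\<gamma> = rectpath (Complex \<sigma> (- R)) (Complex 2 R)"
    have im: "path_image \<gamma> = rect_sides \<sigma> 2 R"
      unfolding \<gamma>_def using \<sigma> R by (intro path_image_rect_sides) auto
    have sub: "rect_sides \<sigma> 2 R \<subseteq> {s. Re s > 1 / 2}" using \<sigma> by (auto simp: rect_sides_def)
    have cont: "continuous_on (rect_sides \<sigma> 2 R) F" by (rule continuous_on_subset[OF contF sub])
    have "(F has_contour_integral 0) \<gamma>"
      using im sub by (intro Cauchy_theorem_convex_simple[OF holo convex_halfspace_Re_gt]) (auto simp: \<gamma>_def)
    hence "contour_integral \<gamma> F = 0" by (rule contour_integral_unique)
    hence eq: "contour_integral (vline 2 R) F = contour_integral (linepath (Complex \<sigma> R) (Complex 2 R)) F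
         + contour_integral (vline \<sigma> R) F - contour_integral (linepath (Complex \<sigma> (- R)) (Complex 2 (- R))) F"
      using contour_integral_rect_sides[of \<sigma> 2 R F] \<sigma> R cont by (simp add: \<gamma>_def algebra_simps)
    have "norm (contour_integral (linepath (Complex \<sigma> R) (Complex 2 R)) F) \<le> A / (1 + R\<^sup>2) * (2 - \<sigma>)"
    proof (rule norm_contour_integral_hline_le)
      show "continuous_on {z. Im z = R \<and> \<sigma> \<le> Re z \<and> Re z \<le> 2} F"
        using \<sigma> by (intro continuous_on_subset[OF contF]) auto
      fix z assume "Im z = R" "\<sigma> \<le> Re z" "Re z \<le> 2"
      thus "norm (F z) \<le> A / (1 + R\<^sup>2)" using strip[of z] by (simp add: F_def)
    qed (use \<sigma> in auto)
    moreover have "norm (contour_integral (linepath (Complex \<sigma> (- R)) (Complex 2 (- R))) F) \<le> A / (1 + R\<^sup>2) * (2 - \<sigma>)"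
    proof (rule norm_contour_integral_hline_le)
      show "continuous_on {z. Im z = - R \<and> \<sigma> \<le> Re z \<and> Re z \<le> 2} F"
        using \<sigma> by (intro continuous_on_subset[OF contF]) auto
      fix z assume "Im z = - R" "\<sigma> \<le> Re z" "Re z \<le> 2"
      thus "norm (F z) \<le> A / (1 + R\<^sup>2)" using strip[of z] by (simp add: F_def)
    qed (use \<sigma> in auto)
    moreover have "norm (contour_integral (vline \<sigma> R) F) \<le> B * pi"
    proof (rule norm_contour_integral_vline_le_pi[OF R])
      show "continuous_on {z. Re z = \<sigma> \<and> \<bar>Im z\<bar> \<le> R} F"
        using \<sigma> by (intro continuous_on_subset[OF contF]) auto
    qed (use left in \<open>simp add: F_def\<close>)
    ultimately have "norm (contour_integral (vline 2 R) F) \<le> 2 * (A / (1 + R\<^sup>2) * (2 - \<sigma>)) + B * pi"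
      unfolding eq by (smt (verit) norm_triangle_ineq norm_triangle_ineq4)
    moreover have "norm (contour_integral (vline 2 R) F - 2 * pi * \<i> * of_real (riesz_M (real k) x))
           \<le> x\<^sup>2 * Z * (4 * R + 2 * real k + 4) / R ^ Suc k"
      unfolding F_def Z_def by (rule riesz_M_truncated_perron[OF k x R])
    ultimately have "norm (2 * pi * \<i> * of_real (riesz_M (real k) x)) \<le> G R"
      unfolding G_def by (smt (verit) norm_triangle_ineq2 norm_minus_commute)
    thus ?thesis by (simp add: norm_mult)
  qed
  have "((\<lambda>R. x\<^sup>2 * Z * (4 * R + 2 * real k + 4) / R ^ Suc k) \<longlongrightarrow> 0) at_top"
  proof -
    have "((\<lambda>R. x\<^sup>2 * Z * ((4 + (2 * real k + 4) / R) / R ^ k)) \<longlongrightarrow> x\<^sup>2 * Z * 0) at_top"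
    proof (intro tendsto_intros real_tendsto_divide_at_top[where c = 4])
      show "filterlim (\<lambda>R::real. R ^ k) at_top at_top" using k by (intro filterlim_pow_at_top filterlim_ident) auto
      have "((\<lambda>R. 4 + (2 * real k + 4) / R) \<longlongrightarrow> 4 + 0) at_top"
        by (intro tendsto_add tendsto_const real_tendsto_divide_at_top[OF tendsto_const] filterlim_ident)
      thus "((\<lambda>R. 4 + (2 * real k + 4) / R) \<longlongrightarrow> 4) at_top" by simp
    qed
    hence "((\<lambda>R. x\<^sup>2 * Z * ((4 + (2 * real k + 4) / R) / R ^ k)) \<longlongrightarrow> 0) at_top" by simp
    thus ?thesis
    proof (rule Lim_transform_eventually)
      show "\<forall>\<^sub>F R in at_top. x\<^sup>2 * Z * ((4 + (2 * real k + 4) / R) / R ^ k) = x\<^sup>2 * Z * (4 * R + 2 * real k + 4) / R ^ Suc k"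
        using eventually_gt_at_top[of 0] by eventually_elim (simp add: field_simps)
    qed
  qed
  moreover have "((\<lambda>R::real. 2 * (A / (1 + R\<^sup>2) * (2 - \<sigma>))) \<longlongrightarrow> 0) at_top"
  proof -
    have "((\<lambda>R::real. A / (1 + R\<^sup>2)) \<longlongrightarrow> 0) at_top"
      by (rule real_tendsto_divide_at_top[OF tendsto_const]) real_asymp
    from tendsto_mult_right_zero[OF this, of "2 * (2 - \<sigma>)"] show ?thesis by (simp add: mult_ac)
  qed
  ultimately have "(G \<longlongrightarrow> 0 + 0 + B * pi) at_top"
    unfolding G_def by (intro tendsto_add tendsto_const)
  hence "2 * pi * \<bar>riesz_M (real k) x\<bar> \<le> 0 + 0 + B * pi"
    by (rule tendsto_lowerbound) (auto intro: eventually_mono[OF eventually_gt_at_top[of 0]] main)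
  hence "pi * (2 * \<bar>riesz_M (real k) x\<bar>) \<le> pi * B" by (simp add: mult_ac)
  hence "2 * \<bar>riesz_M (real k) x\<bar> \<le> B" by (subst (asm) mult_le_cancel_left_pos) auto
  thus ?thesis by simp
qed

subsection \<open>Riesz means of fractional order\<close>

lemma has_integral_beta_interval:
  fixes \<alpha> x y :: real
  assumes \<alpha>: "\<alpha> > 0" and k: "k \<ge> 1" and y: "y < x"
  shows "((\<lambda>u. (u - y) ^ k * (x - u) powr (\<alpha> - 1)) has_integral
           ((x - y) powr (real k + \<alpha>) * Beta (real k + 1) \<alpha>)) {y..x}"
proof -
  define w where "w = x - y"
  have w: "w > 0" using y by (simp add: w_def)
  have "((\<lambda>t. t powr (real k + 1 - 1) * (1 - t) powr (\<alpha> - 1)) has_integral Beta (real k + 1) \<alpha>) (cbox 0 1)"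
    using has_integral_Beta_real[of "real k + 1" \<alpha>] \<alpha> by simp
  from has_integral_affinity'[OF this, of "1 / w" "- y / w"] w
  have aff: "((\<lambda>u. ((1 / w) *\<^sub>R u + - y / w) powr (real k + 1 - 1) * (1 - ((1 / w) *\<^sub>R u + - y / w)) powr (\<alpha> - 1))
      has_integral (Beta (real k + 1) \<alpha> /\<^sub>R (1 / w) ^ DIM(real))) (cbox ((0 - - y / w) /\<^sub>R (1 / w)) ((1 - - y / w) /\<^sub>R (1 / w)))"
    by simp
  have e: "(1 / w) *\<^sub>R u + - y / w = (u - y) / w" "c /\<^sub>R (1 / w) ^ DIM(real) = c * w" for u c
    using w by (simp_all add: diff_divide_distrib)
  have e': "(0 - - y / w) /\<^sub>R (1 / w) = y" "(1 - - y / w) /\<^sub>R (1 / w) = x"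
    using w by (simp, simp add: distrib_left, simp add: w_def)
  have "((\<lambda>u. ((u - y) / w) powr real k * (1 - (u - y) / w) powr (\<alpha> - 1)) has_integral (Beta (real k + 1) \<alpha> * w)) {y..x}"
    using aff unfolding e e' by simp
  hence "((\<lambda>u. w powr (real k + \<alpha> - 1) * (((u - y) / w) powr real k * (1 - (u - y) / w) powr (\<alpha> - 1))) has_integral
      (w powr (real k + \<alpha> - 1) * (Beta (real k + 1) \<alpha> * w))) {y..x}"
    by (rule has_integral_mult_right)
  moreover have "w powr (real k + \<alpha> - 1) * (Beta (real k + 1) \<alpha> * w) = w powr (real k + \<alpha>) * Beta (real k + 1) \<alpha>"
    using w by (simp add: powr_diff)
  moreover have "w powr (real k + \<alpha> - 1) * (((u - y) / w) powr real k * (1 - (u - y) / w) powr (\<alpha> - 1)) =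
      (u - y) ^ k * (x - u) powr (\<alpha> - 1)" if u: "u \<in> {y..x}" for u
  proof -
    have "1 - (u - y) / w = (x - u) / w" using w by (simp add: w_def field_simps)
    hence 1: "(1 - (u - y) / w) powr (\<alpha> - 1) = (x - u) powr (\<alpha> - 1) / w powr (\<alpha> - 1)"
      using u w by (simp add: powr_divide)
    have 2: "((u - y) / w) powr real k = (u - y) ^ k / w powr real k"
    proof (cases "u = y")
      \<comment> \<open>Here k >= 1 matters: \<open>0 powr 0\<close> is 0 but \<open>0 ^ 0\<close>
        is 1.\<close>
      case True
      thus ?thesis using k by simp
    next
      case False
      thus ?thesis using u w by (simp add: powr_divide powr_realpow)
    qed
    have "real k + \<alpha> - 1 = real k + (\<alpha> - 1)" by simp
    hence "w powr (real k + \<alpha> - 1) = w powr real k * w powr (\<alpha> - 1)" by (simp only: powr_add)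
    thus ?thesis unfolding 1 2 using w by simp
  qed
  ultimately show ?thesis unfolding w_def by (metis (no_types, lifting) has_integral_eq)
qed

text \<open>Cutting off with \<open>max 0\<close> lets all n share the interval {0..x}, so a finite
  sum over n can be integrated term by term.\<close>

lemma has_integral_beta_truncated:
  fixes \<alpha> x y :: real
  assumes \<alpha>: "\<alpha> > 0" and k: "k \<ge> 1" and y: "0 \<le> y" "y \<le> x"
  shows "((\<lambda>u. max 0 (u - y) ^ k * (x - u) powr (\<alpha> - 1)) has_integral
           ((x - y) powr (real k + \<alpha>) * Beta (real k + 1) \<alpha>)) {0..x}"
proof (cases "y = x")
  case True
  have "((\<lambda>u. 0) has_integral (0::real)) {0..x}" by simp
  thus ?thesis
    by (rule has_integral_eq_rhs[OF has_integral_eq, rotated]) (use True k in auto)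
next
  case False
  have "((\<lambda>u. if u \<in> {y..x} then (u - y) ^ k * (x - u) powr (\<alpha> - 1) else 0) has_integral
           ((x - y) powr (real k + \<alpha>) * Beta (real k + 1) \<alpha>)) {0..x}"
    using y False by (subst has_integral_restrict) (auto intro!: has_integral_beta_interval \<alpha> k)
  thus ?thesis
    by (rule has_integral_eq[rotated]) (use k in \<open>auto simp: max_def\<close>)
qed

lemma truncated_sum_eq_riesz_M:
  assumes k: "k \<ge> 1" and u: "0 < u" "u \<le> x"
  shows "(\<Sum>n | 1 \<le> n \<and> real n \<le> x. of_int (moebius_mu n) * max 0 (u - real n) ^ k) = u ^ k * fact k * riesz_M (real k) u"
proof -
  have fin: "finite {n. 1 \<le> n \<and> real n \<le> x}"
    by (rule finite_subset[of _ "{..nat \<lceil>x\<rceil>}"]) (auto, linarith)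
  have "(\<Sum>n | 1 \<le> n \<and> real n \<le> x. of_int (moebius_mu n) * max 0 (u - real n) ^ k) =
        (\<Sum>n | 1 \<le> n \<and> real n \<le> u. of_int (moebius_mu n) * max 0 (u - real n) ^ k)"
    using k u by (intro sum.mono_neutral_right fin) (auto simp: max_def)
  also have "\<dots> = (\<Sum>n | 1 \<le> n \<and> real n \<le> u. u ^ k * (of_int (moebius_mu n) * riesz_weight (real k) (real n / u)))"
  proof (rule sum.cong)
    fix n assume n: "n \<in> {n. 1 \<le> n \<and> real n \<le> u}"
    have e: "u * (1 - real n / u) = u - real n" using u by (simp add: field_simps)
    have "riesz_weight (real k) (real n / u) = (1 - real n / u) ^ k"
      using n k u by (intro riesz_weight_of_nat) auto
    hence "u ^ k * riesz_weight (real k) (real n / u) = (u - real n) ^ k"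
      by (simp add: power_mult_distrib[symmetric] e)
    thus "of_int (moebius_mu n) * max 0 (u - real n) ^ k = u ^ k * (of_int (moebius_mu n) * riesz_weight (real k) (real n / u))"
      using n by (simp add: max_def mult_ac)
  qed simp
  also have "\<dots> = u ^ k * fact k * riesz_M (real k) u"
    using Gamma_fact[of k, where ?'a = real] by (simp add: riesz_M_def sum_distrib_left add.commute mult_ac)
  finally show ?thesis .
qed

text \<open>
  Up to constants \<open>x\<^sup>\<tau> M\<^sub>\<tau>(x)\<close> is the fractional integral of order \<open>\<alpha>\<close> of \<open>u\<^sup>k M\<^sub>k(u)\<close>; the same Beta factor
  appears in the upper bound and cancels.
\<close>
lemma riesz_M_fractional_bound:
  assumes k: "k \<ge> 1" and \<alpha>: "0 < \<alpha>" and x: "x > 0"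
    and D: "\<And>u. 0 < u \<Longrightarrow> u \<le> x \<Longrightarrow> \<bar>riesz_M (real k) u\<bar> \<le> D"
  shows "\<bar>riesz_M (real k + \<alpha>) x\<bar> \<le> D"
proof -
  define N where "N = {n. 1 \<le> n \<and> real n \<le> x}"
  define \<tau> where "\<tau> = real k + \<alpha>"
  define B where "B = Beta (real k + 1) \<alpha>"
  have B: "B > 0" using \<alpha> unfolding B_def Beta_def by (intro divide_pos_pos mult_pos_pos Gamma_real_pos) auto
  have D0: "D \<ge> 0" using D[of x] x by simp
  have finN: "finite N"
    unfolding N_def by (rule finite_subset[of _ "{..nat \<lceil>x\<rceil>}"]) (auto, linarith)
  have I1: "((\<lambda>u. \<Sum>n\<in>N. of_int (moebius_mu n) * (max 0 (u - real n) ^ k * (x - u) powr (\<alpha> - 1))) has_integral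
        (\<Sum>n\<in>N. of_int (moebius_mu n) * ((x - real n) powr \<tau> * B))) {0..x}"
    unfolding \<tau>_def B_def
    by (intro has_integral_sum finN has_integral_mult_right has_integral_beta_truncated \<alpha> k) (auto simp: N_def)
  have I2: "((\<lambda>u. fact k * D * (max 0 (u - 0) ^ k * (x - u) powr (\<alpha> - 1))) has_integral
        (fact k * D * ((x - 0) powr \<tau> * B))) {0..x}"
    unfolding \<tau>_def B_def
    by (intro has_integral_mult_right has_integral_beta_truncated \<alpha> k) (use x in auto)
  have le: "norm (\<Sum>n\<in>N. of_int (moebius_mu n) * (max 0 (u - real n) ^ k * (x - u) powr (\<alpha> - 1))) \<le>
      fact k * D * (max 0 (u - 0) ^ k * (x - u) powr (\<alpha> - 1))" if u: "u \<in> {0..x}" for u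
  proof (cases "u = 0")
    case True
    hence "(\<Sum>n\<in>N. of_int (moebius_mu n) * (max 0 (u - real n) ^ k * (x - u) powr (\<alpha> - 1))) = 0"
      using k by (intro sum.neutral) (auto simp: max_def)
    thus ?thesis using D0 True by simp
  next
    case False
    hence u0: "0 < u" "u \<le> x" using u by auto
    have "(\<Sum>n\<in>N. of_int (moebius_mu n) * (max 0 (u - real n) ^ k * (x - u) powr (\<alpha> - 1))) =
        (x - u) powr (\<alpha> - 1) * (\<Sum>n\<in>N. of_int (moebius_mu n) * max 0 (u - real n) ^ k)"
      by (simp add: sum_distrib_left mult_ac)
    also have "\<dots> = (x - u) powr (\<alpha> - 1) * (u ^ k * fact k * riesz_M (real k) u)"
      unfolding N_def by (simp only: truncated_sum_eq_riesz_M[OF k u0])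
    finally have "norm (\<Sum>n\<in>N. of_int (moebius_mu n) * (max 0 (u - real n) ^ k * (x - u) powr (\<alpha> - 1)))
        = (x - u) powr (\<alpha> - 1) * u ^ k * fact k * \<bar>riesz_M (real k) u\<bar>"
      using u0 by (simp add: abs_mult)
    also have "\<dots> \<le> (x - u) powr (\<alpha> - 1) * u ^ k * fact k * D"
      using u0 by (intro mult_left_mono D) auto
    finally show ?thesis using u0 by (simp add: mult_ac)
  qed
  have "norm (integral {0..x} (\<lambda>u. \<Sum>n\<in>N. of_int (moebius_mu n) * (max 0 (u - real n) ^ k * (x - u) powr (\<alpha> - 1))))
     \<le> integral {0..x} (\<lambda>u. fact k * D * (max 0 (u - 0) ^ k * (x - u) powr (\<alpha> - 1)))"
    by (rule integral_norm_bound_integral[OF has_integral_integrable[OF I1] has_integral_integrable[OF I2] le])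
  hence "\<bar>\<Sum>n\<in>N. of_int (moebius_mu n) * ((x - real n) powr \<tau> * B)\<bar> \<le> fact k * D * (x powr \<tau> * B)"
    unfolding integral_unique[OF I1] integral_unique[OF I2] by simp
  also have "(\<Sum>n\<in>N. of_int (moebius_mu n) * ((x - real n) powr \<tau> * B)) = B * (\<Sum>n\<in>N. of_int (moebius_mu n) * (x - real n) powr \<tau>)"
    by (simp add: sum_distrib_left mult_ac)
  finally have "B * \<bar>\<Sum>n\<in>N. of_int (moebius_mu n) * (x - real n) powr \<tau>\<bar> \<le> B * (fact k * D * x powr \<tau>)"
    using B by (simp add: abs_mult mult_ac)
  hence le1: "\<bar>\<Sum>n\<in>N. of_int (moebius_mu n) * (x - real n) powr \<tau>\<bar> \<le> fact k * D * x powr \<tau>"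
    using B by (subst (asm) mult_le_cancel_left_pos) auto
  have \<tau>: "\<tau> > 0" using \<alpha> by (simp add: \<tau>_def add_nonneg_pos)
  have eq: "(\<Sum>n\<in>N. of_int (moebius_mu n) * riesz_weight \<tau> (real n / x)) = (\<Sum>n\<in>N. of_int (moebius_mu n) * (x - real n) powr \<tau>) / x powr \<tau>"
    unfolding sum_divide_distrib
  proof (rule sum.cong)
    fix n assume n: "n \<in> N"
    have "1 - real n / x = (x - real n) / x" using x by (simp add: field_simps)
    hence "(1 - real n / x) powr \<tau> = (x - real n) powr \<tau> / x powr \<tau>"
      using n x by (simp add: powr_divide N_def)
    thus "of_int (moebius_mu n) * riesz_weight \<tau> (real n / x) = of_int (moebius_mu n) * (x - real n) powr \<tau> / x powr \<tau>"
      using \<tau> by (simp add: riesz_weight_def)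
  qed simp
  \<comment> \<open>After the Beta factors cancel, the normalisations leave the ratio fact k / Gamma
    (\<tau> + 1). It is below 1 because k + 1 >= 2 lies where Gamma increases.\<close>
  have G: "Gamma (\<tau> + 1) > fact k"
  proof -
    have "Gamma (real k + 1) < Gamma (\<tau> + 1)"
      using k \<alpha> by (intro Gamma_real_strict_mono) (auto simp: \<tau>_def)
    thus ?thesis using Gamma_fact[of k, where ?'a = real] by (simp add: add.commute)
  qed
  have "\<bar>riesz_M \<tau> x\<bar> = \<bar>\<Sum>n\<in>N. of_int (moebius_mu n) * (x - real n) powr \<tau>\<bar> / (x powr \<tau> * Gamma (\<tau> + 1))"
    using \<tau> eq unfolding riesz_M_def N_def[symmetric] by (simp add: abs_mult abs_divide field_simps)
  also have "\<dots> \<le> fact k * D * x powr \<tau> / (x powr \<tau> * fact k)"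
    using le1 G x D0 by (intro frac_le mult_left_mono) auto
  also have "\<dots> = D" using x by simp
  finally show ?thesis by (simp add: \<tau>_def)
qed

section \<open>Rising factorials against 1 / zeta, and the choice of the order\<close>

text \<open>A single term of the exponential series is at most its sum.\<close>

lemma power_self_le_fact_exp: "real k ^ k \<le> fact k * exp (real k)"
proof -
  have s: "(\<lambda>n. real k ^ n /\<^sub>R fact n) sums exp (real k)" by (rule exp_converges)
  have "sum (\<lambda>n. real k ^ n /\<^sub>R fact n) {k} \<le> exp (real k)"
    using s by (intro sum_le_suminf[of _ "{k}", THEN order_trans]) (auto simp: sums_iff)
  thus ?thesis by (simp add: divide_simps mult.commute)
qed

lemma fact_ge_exp: "k \<ge> 1 \<Longrightarrow> exp (real k * (ln (real k) - 1)) \<le> fact k"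
proof -
  assume k: "k \<ge> 1"
  have "exp (real k * (ln (real k) - 1)) = real k ^ k / exp (real k)"
    using k by (simp add: right_diff_distrib exp_diff exp_of_nat_mult)
  also have "\<dots> \<le> fact k" using power_self_le_fact_exp[of k] by (simp add: divide_simps)
  finally show ?thesis .
qed

text \<open>The factors s, s + 1, s + 2 of the full product are set aside: they cancel s - 1 and
  provide the decay 1 / (1 + t^2). The rest is bounded by its real parts, 3 * 4 * ... * k, or by its
  imaginary parts.\<close>

lemma norm_pochhammer_shift_ge:
  fixes s :: complex
  assumes s: "Re s \<ge> 0" and k: "k \<ge> 2"
  shows "norm (pochhammer (s + 3) (k - 2)) \<ge> fact k / 2" "norm (pochhammer (s + 3) (k - 2)) \<ge> \<bar>Im s\<bar> ^ (k - 2)"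
proof -
  have "fact k = pochhammer (1 :: real) 2 * pochhammer (1 + of_nat 2) (k - 2)"
    unfolding pochhammer_fact using k by (intro pochhammer_product)
  moreover have "pochhammer (1 :: real) 2 = 2" by (simp add: pochhammer_Suc numeral_2_eq_2)
  ultimately have "fact k / 2 = (pochhammer 3 (k - 2) :: real)" by simp
  also have "\<dots> \<le> norm (pochhammer (s + 3) (k - 2))"
    unfolding pochhammer_prod prod_norm[symmetric]
  proof (intro prod_mono conjI)
    fix i
    show "3 + real i \<le> norm (s + 3 + of_nat i)"
      using complex_Re_le_cmod[of "s + 3 + of_nat i"] s by simp
  qed auto
  finally show "norm (pochhammer (s + 3) (k - 2)) \<ge> fact k / 2" .
  have "(\<Prod>i\<in>{0..<k - 2}. \<bar>Im s\<bar>) \<le> (\<Prod>i\<in>{0..<k - 2}. norm (s + 3 + of_nat i))"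
  proof (intro prod_mono conjI)
    fix i
    show "\<bar>Im s\<bar> \<le> norm (s + 3 + of_nat i)"
      using abs_Im_le_cmod[of "s + 3 + of_nat i"] by simp
  qed auto
  thus "norm (pochhammer (s + 3) (k - 2)) \<ge> \<bar>Im s\<bar> ^ (k - 2)"
    by (simp add: pochhammer_prod prod_norm[symmetric])
qed

text \<open>L stands for ln (ln x), and 2 L for the size of ln (5 / a). Below height L the factorial
  is compared through k (ln k - 1) with L ln (2 L) / ln (ln (2 L)); above it the power t^(k - 2)
  needs k - 2 >= 4 C L / ln (ln L). The constant 32 satisfies both requirements with room to
  spare.\<close>

lemma exp_le_norm_pochhammer:
  fixes C T0 :: real
  assumes C: "C \<ge> 1" and T0: "T0 \<ge> exp (exp 1)"
  shows "\<forall>\<^sub>F L in at_top. \<forall>k s. real k \<ge> 32 * C * L / ln (ln L) \<longrightarrow> Re s \<ge> 0 \<longrightarrow>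
      exp (2 * C * L * (ln (\<bar>Im s\<bar> + T0) / ln (ln (\<bar>Im s\<bar> + T0)))) \<le> 2 * norm (pochhammer (s + 3) (k - 2))"
proof -
  have "C > 0" using C by simp
  have "\<forall>\<^sub>F L in at_top. 32 * C * L / ln (ln L) * (ln (32 * C * L / ln (ln L)) - 1) \<ge> 2 * C * L * (ln (2 * L) / ln (ln (2 * L)))"
    using \<open>C > 0\<close> by real_asymp
  moreover have "\<forall>\<^sub>F L in at_top. 32 * C * L / ln (ln L) \<ge> exp 1"
    using \<open>C > 0\<close> by real_asymp
  moreover have "\<forall>\<^sub>F L in at_top. 32 * C * L / ln (ln L) - 2 \<ge> 4 * C * L / ln (ln L)"
    using \<open>C > 0\<close> by real_asymp
  moreover have "\<forall>\<^sub>F L in at_top. L \<ge> max T0 2" by (rule eventually_ge_at_top)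
  ultimately show ?thesis
  proof eventually_elim
    case (elim L)
    define K where "K = 32 * C * L / ln (ln L)"
    have L: "L \<ge> T0" "L \<ge> 2" using elim(4) by auto
    have T0p: "T0 > 0" using T0 exp_gt_zero[of "exp 1::real"] by linarith
    have lT: "ln T \<ge> exp 1" if "T \<ge> T0" for T
      using that T0 T0p by (subst ln_ge_iff) auto
    have e1: "exp 1 \<ge> (1::real)" using exp_ge_add_one_self[of "1::real"] by linarith
    have llT: "ln (ln T) \<ge> 1" if "T \<ge> T0" for T
      using lT[OF that] e1 by (subst ln_ge_iff) (linarith, simp)
    have lTp: "ln (ln T) / ln T > 0" "ln T > 0" if "T \<ge> T0" for T
      using lT[OF that] llT[OF that] e1 by (auto intro!: divide_pos_pos; linarith)+
    show ?case
    proof (intro allI impI)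
      fix k :: nat and s :: complex
      assume k: "real k \<ge> 32 * C * L / ln (ln L)" and s: "Re s \<ge> 0"
      have kK: "real k \<ge> K" using k by (simp add: K_def)
      have K: "K \<ge> exp 1" "K - 2 \<ge> 4 * C * L / ln (ln L)" using elim(2,3) by (auto simp: K_def)
      have "4 * C * L / ln (ln L) \<ge> 0"
        using C L llT[OF L(1)] by (intro divide_nonneg_nonneg mult_nonneg_nonneg) linarith+
      hence k2: "k \<ge> 2" using K(2) kK by linarith
      define t where "t = \<bar>Im s\<bar>"
      define T where "T = t + T0"
      have T: "T \<ge> T0" by (simp add: T_def t_def)
      show "exp (2 * C * L * (ln (\<bar>Im s\<bar> + T0) / ln (ln (\<bar>Im s\<bar> + T0)))) \<le> 2 * norm (pochhammer (s + 3) (k - 2))"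
        unfolding t_def[symmetric] T_def[symmetric]
      proof (cases "t \<le> L")
        case True
        have "ln T \<le> ln (2 * L)" using True L T0p T by (subst ln_le_cancel_iff) (auto simp: T_def)
        \<comment> \<open>ln v / v decreases for v >= e, and T >= exp (exp 1) puts v = ln T in that
          range. The left-hand side of the goal is thus largest at T = 2 L.\<close>
        hence "ln (ln (2 * L)) / ln (2 * L) \<le> ln (ln T) / ln T"
          using lT[OF T] by (intro ln_x_over_x_mono) auto
        moreover have "ln (ln T) / ln T > 0" "ln (ln (2 * L)) / ln (2 * L) > 0"
          using lTp(1)[OF T] lTp(1)[of "2 * L"] L by auto
        ultimately have "inverse (ln (ln T) / ln T) \<le> inverse (ln (ln (2 * L)) / ln (2 * L))"
          by (intro le_imp_inverse_le) auto
        hence "2 * C * L * (ln T / ln (ln T)) \<le> 2 * C * L * (ln (2 * L) / ln (ln (2 * L)))"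
          using C L by (intro mult_left_mono) auto
        also have "\<dots> \<le> K * (ln K - 1)" using elim(1) by (simp add: K_def)
        also have "\<dots> \<le> real k * (ln (real k) - 1)"
        proof (rule mult_mono)
          have "0 < K" using K(1) exp_gt_zero[of "1::real"] by linarith
          thus "ln K - 1 \<le> ln (real k) - 1" using kK by simp
          have "0 < real k" using k2 by simp
          have "1 \<le> ln K" using K(1) \<open>0 < K\<close> by (subst ln_ge_iff) auto
          thus "0 \<le> ln K - 1" by simp
        qed (use kK in auto)
        finally have "exp (2 * C * L * (ln T / ln (ln T))) \<le> exp (real k * (ln (real k) - 1))" by simp
        also have "\<dots> \<le> fact k" using k2 by (intro fact_ge_exp) auto
        also have "\<dots> \<le> 2 * norm (pochhammer (s + 3) (k - 2))"
          using norm_pochhammer_shift_ge(1)[OF s k2] by simp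
        finally show "exp (2 * C * L * (ln T / ln (ln T))) \<le> 2 * norm (pochhammer (s + 3) (k - 2))" .
      next
        case False
        hence t: "t > L" "t \<ge> 2" using L by auto
        \<comment> \<open>T0 <= L < t gives the first inequality and t >= 2 the next; replacing T by
          t costs a factor 2 in the logarithm.\<close>
        have "T \<le> 2 * t" using t L by (simp add: T_def)
        also have "\<dots> \<le> t * t" using t by (intro mult_right_mono) auto
        finally have "ln T \<le> ln (t * t)" using T T0p t by (subst ln_le_cancel_iff) auto
        also have "\<dots> = 2 * ln t" using t by (subst ln_mult) auto
        finally have lnT: "ln T \<le> 2 * ln t" .
        have "L \<le> T" using t T0p by (simp add: T_def)
        hence "ln L \<le> ln T" using L by (subst ln_le_cancel_iff) auto
        hence llL: "ln (ln L) \<le> ln (ln T)" using lTp(2)[OF L(1)] lTp(2)[OF T] by (subst ln_le_cancel_iff) auto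
        have "ln T / ln (ln T) \<le> 2 * ln t / ln (ln L)"
          using lnT llL llT[OF L(1)] t by (intro frac_le) auto
        hence "2 * C * L * (ln T / ln (ln T)) \<le> 2 * C * L * (2 * ln t / ln (ln L))"
          using C L by (intro mult_left_mono) auto
        also have "\<dots> = 4 * C * L / ln (ln L) * ln t" by simp
        also have "\<dots> \<le> real (k - 2) * ln t"
          using K(2) kK k2 t by (intro mult_right_mono) (auto simp: of_nat_diff)
        finally have "exp (2 * C * L * (ln T / ln (ln T))) \<le> exp (real (k - 2) * ln t)" by simp
        also have "\<dots> = t ^ (k - 2)" using t by (subst exp_of_nat_mult) auto
        also have "\<dots> \<le> norm (pochhammer (s + 3) (k - 2))"
          unfolding t_def by (rule norm_pochhammer_shift_ge(2)[OF s k2])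
        finally show "exp (2 * C * L * (ln T / ln (ln T))) \<le> 2 * norm (pochhammer (s + 3) (k - 2))"
          using norm_ge_zero[of "pochhammer (s + 3) (k - 2)"] by linarith
      qed
    qed
  qed
qed

text \<open>The factor u^s of the integrand is left out and A does not depend on x, so the estimate
  for one x serves \<open>riesz_integrand k u\<close> for every u <= x.\<close>

lemma zeta_pochhammer_bound:
  assumes RH: "riemann_hypothesis"
  obtains C A where "C \<ge> 1" "A > 0"
    "\<forall>\<^sub>F x in at_top. \<forall>k s. real k \<ge> 32 * C * ln (ln x) / ln (ln (ln (ln x))) \<longrightarrow>
       1 / 2 + 1 / ln x \<le> Re s \<longrightarrow> Re s \<le> 2 \<longrightarrow>
       norm ((s - 1) / (zeta_reg s * pochhammer s (Suc k))) \<le> A / (1 + (Im s)\<^sup>2)"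
proof -
  obtain C T0 where C: "C \<ge> 1" "T0 \<ge> exp (exp 1)"
    "\<And>a t. 0 < a \<Longrightarrow> a \<le> 3 / 4 \<Longrightarrow>
       1 \<le> norm (zeta_reg (Complex (1 / 2 + a) t)) * (C * exp (C * (ln (\<bar>t\<bar> + T0) / ln (ln (\<bar>t\<bar> + T0))) * ln (5 / a)))"
    using zeta_reg_lower_near_line[OF RH] by metis
  obtain c0 where c0: "c0 > 0" "\<And>s. 5 / 4 \<le> Re s \<Longrightarrow> norm (zeta_reg s) \<ge> c0"
    using zeta_reg_lower by metis
  define A0 where "A0 = 2 * C + 2 / c0"
  have A0: "2 * C \<le> A0" "2 / c0 \<le> A0" "A0 > 0" using C(1) c0(1) by (auto simp: A0_def add_pos_pos)
  have "C > 0" using C(1) by simp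
  have T0p: "T0 > 0" using C(2) exp_gt_zero[of "exp 1::real"] by linarith
  have llT: "ln T / ln (ln T) > 0" if "T \<ge> T0" for T
  proof -
    have "exp 1 \<le> ln T" using that C(2) T0p by (subst ln_ge_iff) auto
    moreover have "exp 1 > (1::real)" by simp
    ultimately have "ln T > 1" by linarith
    thus ?thesis by simp
  qed
  have fl: "filterlim (\<lambda>x::real. ln (ln x)) at_top at_top" by real_asymp
  have ev1: "\<forall>\<^sub>F x in at_top. \<forall>k s. real k \<ge> 32 * C * ln (ln x) / ln (ln (ln (ln x))) \<longrightarrow> Re s \<ge> 0 \<longrightarrow>
      exp (2 * C * ln (ln x) * (ln (\<bar>Im s\<bar> + T0) / ln (ln (\<bar>Im s\<bar> + T0)))) \<le> 2 * norm (pochhammer (s + 3) (k - 2))"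
    by (rule eventually_compose_filterlim[OF exp_le_norm_pochhammer[OF C(1,2)] fl])
  have ev2: "\<forall>\<^sub>F x in at_top. 32 * C * ln (ln x) / ln (ln (ln (ln x))) \<ge> 3"
    using \<open>C > 0\<close> by real_asymp
  have ev3: "\<forall>\<^sub>F x::real in at_top. ln (ln x) \<ge> ln 5 \<and> ln x \<ge> 1"
    by (intro eventually_conj; real_asymp)
  from ev1 ev2 ev3 have ev: "\<forall>\<^sub>F x in at_top. \<forall>k s. real k \<ge> 32 * C * ln (ln x) / ln (ln (ln (ln x))) \<longrightarrow>
       1 / 2 + 1 / ln x \<le> Re s \<longrightarrow> Re s \<le> 2 \<longrightarrow>
       norm ((s - 1) / (zeta_reg s * pochhammer s (Suc k))) \<le> 2 * A0 / (1 + (Im s)\<^sup>2)"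
  proof eventually_elim
    case (elim x)
    show ?case
    proof (intro allI impI)
      fix k :: nat and s :: complex
      assume k: "real k \<ge> 32 * C * ln (ln x) / ln (ln (ln (ln x)))"
        and s: "1 / 2 + 1 / ln x \<le> Re s" "Re s \<le> 2"
      define t where "t = Im s"
      define T where "T = \<bar>t\<bar> + T0"
      have T: "T \<ge> T0" by (simp add: T_def)
      have lnx: "1 / ln x > 0" using elim(3) by simp
      have Res: "Re s \<ge> 1 / 2" using s(1) lnx by linarith
      have k3: "k \<ge> 3" using k elim(2) by linarith
      define P where "P = norm (pochhammer (s + 3) (k - 2))"
      have P: "exp (2 * C * ln (ln x) * (ln T / ln (ln T))) \<le> 2 * P"
        using elim(1) k Res unfolding P_def T_def t_def by auto
      have P1: "1 \<le> 2 * P"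
        using norm_pochhammer_shift_ge(1)[of s k] Res k3 fact_ge_1[of k, where ?'a = real] unfolding P_def by linarith
      have key: "1 \<le> A0 * norm (zeta_reg s) * P"
      proof (cases "Re s \<le> 5 / 4")
        case True
        define a where "a = Re s - 1 / 2"
        have a: "0 < a" "a \<le> 3 / 4" "1 / ln x \<le> a" using s(1) lnx True unfolding a_def by linarith+
        have s_eq: "Complex (1 / 2 + a) t = s" by (simp add: a_def t_def complex_eq_iff)
        \<comment> \<open>The distance from the critical line is at least 1 / ln x, and ln 5 is
          absorbed by a second ln (ln x): the origin of the factor 2 in the exponent.\<close>
        have "5 / a \<le> 5 * ln x" using a elim(3) by (simp add: field_simps)
        hence "ln (5 / a) \<le> ln (5 * ln x)" using a elim(3) by (subst ln_le_cancel_iff) auto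
        also have "\<dots> = ln 5 + ln (ln x)" using elim(3) by (subst ln_mult) auto
        finally have "ln (5 / a) \<le> 2 * ln (ln x)" using elim(3) by linarith
        hence "C * (ln T / ln (ln T)) * ln (5 / a) \<le> C * (ln T / ln (ln T)) * (2 * ln (ln x))"
          using C(1) less_imp_le[OF llT[OF T]] by (intro mult_left_mono mult_nonneg_nonneg) linarith+
        also have "\<dots> = 2 * C * ln (ln x) * (ln T / ln (ln T))" by simp
        finally have "exp (C * (ln T / ln (ln T)) * ln (5 / a)) \<le> exp (2 * C * ln (ln x) * (ln T / ln (ln T)))" by simp
        hence "exp (C * (ln T / ln (ln T)) * ln (5 / a)) \<le> 2 * P" using P by linarith
        hence "norm (zeta_reg s) * (C * exp (C * (ln T / ln (ln T)) * ln (5 / a))) \<le> norm (zeta_reg s) * (C * (2 * P))"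
          using C(1) by (intro mult_left_mono) auto
        with C(3)[OF a(1,2), of t] have "1 \<le> norm (zeta_reg s) * (C * (2 * P))"
          unfolding s_eq T_def by linarith
        also have "\<dots> = 2 * C * (norm (zeta_reg s) * P)" by simp
        also have "\<dots> \<le> A0 * (norm (zeta_reg s) * P)"
          using A0 by (intro mult_right_mono) (auto simp: P_def)
        finally show ?thesis by (simp add: mult_ac)
      next
        case False
        hence "c0 \<le> norm (zeta_reg s)" by (intro c0(2)) simp
        hence "1 / c0 * c0 \<le> 1 / c0 * norm (zeta_reg s)" using c0(1) by (intro mult_left_mono) auto
        hence "1 \<le> 1 / c0 * norm (zeta_reg s)" using c0(1) by simp
        also have "\<dots> \<le> 1 / c0 * norm (zeta_reg s) * (2 * P)"
          using mult_left_mono[OF P1, of "1 / c0 * norm (zeta_reg s)"] c0(1) by simp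
        also have "\<dots> = 2 / c0 * (norm (zeta_reg s) * P)" by simp
        also have "\<dots> \<le> A0 * (norm (zeta_reg s) * P)"
          using A0 by (intro mult_right_mono) (auto simp: P_def)
        finally show ?thesis by (simp add: mult_ac)
      qed
      \<comment> \<open>The factor s + 1 of the product cancels the numerator s - 1, and s (s + 2)
        yields 1 + t^2.\<close>
      have s1: "norm (s - 1) \<le> norm (s + 1)"
      proof (rule power2_le_imp_le)
        show "(norm (s - 1))\<^sup>2 \<le> (norm (s + 1))\<^sup>2"
          unfolding cmod_power2 using Res by (simp add: power2_eq_square algebra_simps)
      qed simp
      have s2: "(1 + t\<^sup>2) / 2 \<le> norm s * norm (s + 2)"
      proof (rule power2_le_imp_le)
        have "1 / 2 * (1 / 2) \<le> Re s * Re s" using Res by (intro mult_mono) auto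
        hence "(1 + t\<^sup>2) / 4 \<le> (norm s)\<^sup>2"
        proof -
          have "(1 + b) / 4 \<le> a + b" if "1 / 4 \<le> a" "0 \<le> b" for a b :: real
            using that by (simp add: field_simps)
          from this[of "(Re s)\<^sup>2" "(Im s)\<^sup>2"] show ?thesis
            using \<open>1 / 2 * (1 / 2) \<le> Re s * Re s\<close> unfolding cmod_power2 t_def
            by (simp add: power2_eq_square)
        qed
        moreover have "1 + t\<^sup>2 \<le> (norm (s + 2))\<^sup>2"
        proof -
          have "1 * 1 \<le> (Re s + 2) * (Re s + 2)" using Res by (intro mult_mono) auto
          thus ?thesis unfolding cmod_power2 t_def by (simp add: power2_eq_square)
        qed
        ultimately have "(1 + t\<^sup>2) / 4 * (1 + t\<^sup>2) \<le> (norm s)\<^sup>2 * (norm (s + 2))\<^sup>2"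
          by (intro mult_mono) auto
        thus "((1 + t\<^sup>2) / 2)\<^sup>2 \<le> (norm s * norm (s + 2))\<^sup>2"
          by (simp add: power2_eq_square power_mult_distrib mult_ac)
      qed simp
      have poch: "pochhammer s (Suc k) = s * (s + 1) * (s + 2) * pochhammer (s + 3) (k - 2)"
      proof -
        have "pochhammer s (Suc k) = pochhammer s 3 * pochhammer (s + of_nat 3) (Suc k - 3)"
          using k3 by (intro pochhammer_product) auto
        moreover have "pochhammer s 3 = s * (s + 1) * (s + 2)"
          by (simp add: pochhammer_Suc numeral_3_eq_3)
        moreover have "Suc k - 3 = k - 2" using k3 by simp
        ultimately show ?thesis by simp
      qed
      have D: "norm (zeta_reg s * pochhammer s (Suc k)) = norm (s + 1) * ((norm s * norm (s + 2)) * (norm (zeta_reg s) * P))"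
        unfolding poch norm_mult P_def by (simp add: mult_ac)
      have "norm (s - 1) * (1 + t\<^sup>2) * 1 \<le> norm (s + 1) * (2 * (norm s * norm (s + 2))) * (A0 * norm (zeta_reg s) * P)"
        using s1 s2 key by (intro mult_mono) auto
      also have "\<dots> = 2 * A0 * norm (zeta_reg s * pochhammer s (Suc k))"
        unfolding D by (simp add: mult_ac)
      finally have fin: "norm (s - 1) * (1 + t\<^sup>2) \<le> 2 * A0 * norm (zeta_reg s * pochhammer s (Suc k))" by simp
      have nz: "norm (zeta_reg s * pochhammer s (Suc k)) > 0"
      proof -
        have "zeta_reg s \<noteq> 0" "P \<noteq> 0" using key by auto
        moreover have "s \<noteq> 0" "s + 1 \<noteq> 0" "s + 2 \<noteq> 0" using Res by (auto simp: complex_eq_iff)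
        ultimately show ?thesis unfolding poch by (simp add: P_def)
      qed
      have tp: "1 + t\<^sup>2 > 0" by (simp add: add_pos_nonneg)
      show "norm ((s - 1) / (zeta_reg s * pochhammer s (Suc k))) \<le> 2 * A0 / (1 + (Im s)\<^sup>2)"
        unfolding norm_divide t_def[symmetric] using fin nz tp
        by (subst pos_divide_le_eq) (auto simp: field_simps)
    qed
  qed
  show ?thesis using that[OF C(1) _ ev] A0(3) by simp
qed

theorem theorem3:
  assumes "riemann_hypothesis"
  shows "\<exists>C\<^sub>0 :: real. C\<^sub>0 > 0 \<and>
           (\<forall>\<tau> :: real \<Rightarrow> real.
              (\<forall>\<^sub>F x in at_top. \<tau> x \<ge> C\<^sub>0 * ln (ln x) / ln (ln (ln (ln x)))) \<longrightarrow>
              (\<lambda>x. riesz_M (\<tau> x) x) \<in> O[at_top](\<lambda>x. x powr (1 / 2)))"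
proof -
  obtain C A where C: "C \<ge> 1" "A > 0"
    "\<forall>\<^sub>F x in at_top. \<forall>k s. real k \<ge> 32 * C * ln (ln x) / ln (ln (ln (ln x))) \<longrightarrow>
       1 / 2 + 1 / ln x \<le> Re s \<longrightarrow> Re s \<le> 2 \<longrightarrow>
       norm ((s - 1) / (zeta_reg s * pochhammer s (Suc k))) \<le> A / (1 + (Im s)\<^sup>2)"
    by (rule zeta_pochhammer_bound[OF assms]) (rule that)
  have "C > 0" using C(1) by simp
  have ev2: "\<forall>\<^sub>F x in at_top. 32 * C * ln (ln x) / ln (ln (ln (ln x))) \<ge> 3"
    using \<open>C > 0\<close> by real_asymp
  have ev3: "\<forall>\<^sub>F x::real in at_top. ln x \<ge> 1 \<and> x > 0"
    by (intro eventually_conj; real_asymp)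
  show ?thesis
  \<comment> \<open>Twice the constant for integer orders, to allow for rounding down: k > \<tau> x
    - 1 >= 2 Y - 1 >= Y.\<close>
  proof (intro exI[of _ "64 * C"] conjI allI impI)
    show "64 * C > 0" using \<open>C > 0\<close> by simp
    fix \<tau> :: "real \<Rightarrow> real"
    assume \<tau>: "\<forall>\<^sub>F x in at_top. \<tau> x \<ge> 64 * C * ln (ln x) / ln (ln (ln (ln x)))"
    have "\<forall>\<^sub>F x in at_top. norm (riesz_M (\<tau> x) x) \<le> A * exp 1 / 2 * norm (x powr (1 / 2))"
      using C(3) ev2 ev3 \<tau>
    proof eventually_elim
      case (elim x)
      define k where "k = nat \<lfloor>\<tau> x\<rfloor>"
      define \<alpha> where "\<alpha> = \<tau> x - real k"
      define Y where "Y = 32 * C * ln (ln x) / ln (ln (ln (ln x)))"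
      have Y: "Y \<ge> 3" "\<tau> x \<ge> 2 * Y" using elim(2,4) by (auto simp: Y_def)
      have \<alpha>: "0 \<le> \<alpha>" "\<alpha> < 1" using Y by (auto simp: \<alpha>_def k_def) linarith+
      have kY: "real k \<ge> Y" using Y \<alpha> by (simp add: \<alpha>_def)
      have k1: "k \<ge> 1" using kY Y by simp
      define \<sigma> where "\<sigma> = 1 / 2 + 1 / ln x"
      have lnx: "0 < 1 / ln x" "1 / ln x \<le> 1"
        using elim(3) divide_pos_pos[of 1 "ln x"] divide_le_eq_1_pos[of "ln x" 1] by linarith+
      have \<sigma>: "1 / 2 < \<sigma>" "\<sigma> < 2" using lnx unfolding \<sigma>_def by linarith+
      have x: "x > 0" using elim(3) by simp
      \<comment> \<open>Needed on all of (0, x] for the fractional integral; k and \<sigma> are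
        those of x, and only the factor u^\<sigma> depends on u.\<close>
      have bd: "\<bar>riesz_M (real k) u\<bar> \<le> A * exp 1 / 2 * x powr (1 / 2)" if u: "0 < u" "u \<le> x" for u
      proof -
        have int: "norm (riesz_integrand k u s) \<le> u powr Re s * (A / (1 + (Im s)\<^sup>2))"
          if "\<sigma> \<le> Re s" "Re s \<le> 2" for s
        proof -
          have "norm (riesz_integrand k u s) = u powr Re s * norm ((s - 1) / (zeta_reg s * pochhammer s (Suc k)))"
            using u by (simp add: riesz_integrand_def norm_mult norm_divide norm_powr_real_powr)
          also have "\<dots> \<le> u powr Re s * (A / (1 + (Im s)\<^sup>2))"
            using elim(1) kY that unfolding Y_def \<sigma>_def by (intro mult_left_mono) auto
          finally show ?thesis .
        qed
        have "\<bar>riesz_M (real k) u\<bar> \<le> (A * u powr \<sigma>) / 2"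
        proof (rule riesz_M_bound_of_strip[OF assms k1 u(1) \<sigma>])
          fix s assume s: "\<sigma> \<le> Re s" "Re s \<le> 2"
          \<comment> \<open>A crude bound across the strip suffices, as it affects only the
            horizontal edges.\<close>
          have "u powr Re s \<le> max 1 (u\<^sup>2)"
          proof (cases "u \<ge> 1")
            case True
            have "u powr Re s \<le> u powr 2" using True s by (intro powr_mono) auto
            thus ?thesis using u by simp
          next
            case False
            have "u powr Re s \<le> 1" using False u s \<sigma> by (intro powr_le1) auto
            thus ?thesis by simp
          qed
          hence "u powr Re s * (A / (1 + (Im s)\<^sup>2)) \<le> max 1 (u\<^sup>2) * (A / (1 + (Im s)\<^sup>2))"
            using C(2) by (intro mult_right_mono divide_nonneg_nonneg) auto
          thus "norm (riesz_integrand k u s) \<le> (max 1 (u\<^sup>2) * A) / (1 + (Im s)\<^sup>2)"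
            using int[OF s] by simp
        next
          fix s assume s: "Re s = \<sigma>"
          thus "norm (riesz_integrand k u s) \<le> (A * u powr \<sigma>) / (1 + (Im s)\<^sup>2)"
            using int[of s] \<sigma> by (simp add: mult_ac)
        qed
        also have "u powr \<sigma> \<le> x powr \<sigma>" using u \<sigma> by (intro powr_mono2) auto
        also have "x powr \<sigma> = x powr (1 / 2) * exp 1"
        proof -
          \<comment> \<open>This identity is the reason for the shift 1 / ln x: moving off the
            critical line costs only a factor e.\<close>
          have "x powr (1 / ln x) = exp 1" using x elim(3) by (auto simp: powr_def)
          thus ?thesis unfolding \<sigma>_def powr_add by simp
        qed
        finally show ?thesis using C(2) by (simp add: mult_ac)
      qed
      have "\<bar>riesz_M (\<tau> x) x\<bar> \<le> A * exp 1 / 2 * x powr (1 / 2)"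
      proof (cases "\<alpha> = 0")
        case True
        thus ?thesis using bd[of x] x by (simp add: \<alpha>_def)
      next
        case False
        hence "\<alpha> > 0" using \<alpha> by simp
        from riesz_M_fractional_bound[OF k1 this x bd] show ?thesis by (simp add: \<alpha>_def)
      qed
      thus ?case by simp
    qed
    thus "(\<lambda>x. riesz_M (\<tau> x) x) \<in> O[at_top](\<lambda>x. x powr (1 / 2))" by (rule bigoI)
  qed
qed

end
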